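(* Let $N$ and $H$ be groups, let $Z=Z(N)$ be the centre of $N$, and let $K=\mathrm{Aut}(N)\times\mathrm{Aut}(H)$. For $\varpi\in\mathrm{Hom}(H,\mathrm{Out}(N))$ let $K_\varpi$ be the stabiliser of $\varpi$ in $K$. The set $\mathrm{Gr}(N,H)$ of virtual isomorphism classes of extensions of $H$ by $N$ can be written as a quotient set in two ways: \[ \mathrm{Gr}(N,H)\ \cong\ \frac{\mathrm{Ex}(N,H)}{K}\ \cong\ \coprod_{\varpi\in\mathrm{Hom}(H,\mathrm{Out}(N))/K}\frac{\mathrm{Ex}_\varpi(N,H)}{K_\varpi}, \] where the disjoint union is over representatives of the $K$-orbits. If the $H^2(H,{}_\varpi Z)$-torsor $\mathrm{Ex}_\varpi(N,H)$ admits a $K_\varpi$-stable (i.e. $K_\varpi$-fixed) element, then there is a $K_\varpi$-equivariant bijection $\mathrm{Ex}_\varpi(N,H)\cong H^2(H,{}_\varpi Z)$. If the automorphism exact sequence \[ 1\to N/Z\to\mathrm{Aut}(N)\to\mathrm{Out}(N)\to 1 \] splits, then every $\mathrm{Ex}_\varpi(N,H)$ admits a $K_\varpi$-stable element and \[ \mathrm{Gr}(N,H)\ \cong\ \coprod_{\varpi\in\mathrm{Hom}(H,\mathrm{Out}(N))/K}\frac{H^2(H,{}_\varpi Z)}{K_\varpi}. \]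
   Context: Extensions of $H$ by $N$ are short exact sequences $E=(1\to N\xrightarrow{\iota}G\xrightarrow{\pi}H\to 1)$ of groups. Two extensions (with middle groups $G,G'$) are virtually isomorphic if there is a group isomorphism $G\to G'$ that restricts to an automorphism of $N$ (hence induces an automorphism of $H$). They are equivalent if there is such an isomorphism inducing the identity on both $N$ and $H$. $\mathrm{Gr}(N,H)$ and $\mathrm{Ex}(N,H)$ denote the sets of virtual isomorphism classes and of equivalence classes, respectively. The coupling of $E$ is the homomorphism $\varpi:H\to\mathrm{Out}(N)$ obtained by composing a set-theoretic section $H\to G$ with the conjugation map $G\to\mathrm{Aut}(N)\to\mathrm{Out}(N)$; it does not depend on the section, and depends only on the equivalence class of $E$. $\mathrm{Ex}_\varpi(N,H)\subseteq\mathrm{Ex}(N,H)$ is the (possibly empty) subset of classes of extensions with coupling $\varpi$. ${}_\varpi Z$ is $Z$ with the $H$-action coming from $\varpi$. The group $K$ acts on $\mathrm{Ex}(N,H)$ by $(\alpha,\beta)\cdot E=(1\to N\xrightarrow{\iota\circ\alpha^{-1}}G\xrightarrow{\beta\circ\pi}H\to1)$, and on $\mathrm{Hom}(H,\mathrm{Out}(N))$ by $((\alpha,\beta)\star\varpi)(h)=\bar\alpha\,\varpi(\beta^{-1}(h))\,\bar\alpha^{-1}$, where $\bar\alpha$ is the image of $\alpha$ in $\mathrm{Out}(N)$. The stabiliser $K_\varpi$ acts on $\mathrm{Ex}_\varpi(N,H)$, and acts on $H^2(H,{}_\varpi Z)$ by $((\alpha,\beta)\cdot\tau)(g,h)=\alpha(\tau(\beta^{-1}(g),\beta^{-1}(h)))$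 on cocycles. When nonempty, $\mathrm{Ex}_\varpi(N,H)$ is a torsor over $H^2(H,{}_\varpi Z)$ as follows. Choosing a section with value $1$ at $1_H$, write the middle group of an extension as $N\times H$ with multiplication $(a,g)(b,h)=(a\cdot{}^{\phi(g)}b\cdot f(g,h),gh)$, where $\phi:H\to\mathrm{Aut}(N)$ and $f:H\times H\to N$. The class $[\tau]$ sends this extension to the one given by $(\phi,\tau\cdot f)$. *)

theory Defs
  imports "HOL-Algebra.Group_Action"
begin

section \<open>Automorphisms, outer automorphisms and the centre\<close>

definition Inn :: "('n, 'a) monoid_scheme \<Rightarrow> ('n \<Rightarrow> 'n) set" where
  "Inn N = (\<lambda>g. \<lambda>x\<in>carrier N. g \<otimes>\<^bsub>N\<^esub> x \<otimes>\<^bsub>N\<^esub> inv\<^bsub>N\<^esub> g) ` carrier N"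

definition Out :: "('n, 'a) monoid_scheme \<Rightarrow> ('n \<Rightarrow> 'n) set monoid" where
  "Out N = AutoGroup N Mod Inn N"

definition out_class :: "('n, 'a) monoid_scheme \<Rightarrow> ('n \<Rightarrow> 'n) \<Rightarrow> ('n \<Rightarrow> 'n) set" where
  "out_class N \<alpha> = Inn N #>\<^bsub>AutoGroup N\<^esub> \<alpha>"

definition centre :: "('n, 'a) monoid_scheme \<Rightarrow> 'n set" where
  "centre N = {z \<in> carrier N. \<forall>x\<in>carrier N. z \<otimes>\<^bsub>N\<^esub> x = x \<otimes>\<^bsub>N\<^esub> z}"

definition aut_sequence_splits :: "('n, 'a) monoid_scheme \<Rightarrow> bool" where
  "aut_sequence_splits N \<longleftrightarrow>
     (\<exists>s\<in>hom (Out N) (AutoGroup N). \<forall>x\<in>carrier (Out N). out_class N (s x) = x)"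

abbreviation K :: "('n, 'a) monoid_scheme \<Rightarrow> ('h, 'b) monoid_scheme \<Rightarrow> (('n \<Rightarrow> 'n) \<times> ('h \<Rightarrow> 'h)) monoid"
  where "K N H \<equiv> AutoGroup N \<times>\<times> AutoGroup H"


section \<open>Extensions\<close>

record ('n, 'h, 'g) extension =
  middle :: "'g monoid"
  incl :: "'n \<Rightarrow> 'g"
  projn :: "'g \<Rightarrow> 'h"

definition is_extension ::
  "('n, 'a) monoid_scheme \<Rightarrow> ('h, 'b) monoid_scheme \<Rightarrow> ('n, 'h, 'g) extension \<Rightarrow> bool" where
  "is_extension N H E \<longleftrightarrow>
     group (middle E) \<and> incl E \<in> mon N (middle E) \<and> projn E \<in> epi (middle E) H \<and>
     incl E ` carrier N = kernel (middle E) H (projn E)"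

text \<open>Both relations allow the two middle groups to live on different types.\<close>

definition ext_rel :: "('n, 'a) monoid_scheme \<Rightarrow> ('h, 'b) monoid_scheme \<Rightarrow>
    (('n, 'h, 'g) extension \<times> ('n, 'h, 'k) extension) set" where
  "ext_rel N H = {(E, E'). is_extension N H E \<and> is_extension N H E' \<and>
     (\<exists>\<theta>\<in>iso (middle E) (middle E').
        (\<forall>n\<in>carrier N. \<theta> (incl E n) = incl E' n) \<and>
        (\<forall>g\<in>carrier (middle E). projn E' (\<theta> g) = projn E g))}"

definition virt_rel :: "('n, 'a) monoid_scheme \<Rightarrow> ('h, 'b) monoid_scheme \<Rightarrow>
    (('n, 'h, 'g) extension \<times> ('n, 'h, 'k) extension) set" where
  "virt_rel N H = {(E, E'). is_extension N H E \<and> is_extension N H E' \<and>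
     (\<exists>\<theta>\<in>iso (middle E) (middle E'). \<exists>\<alpha>\<in>auto N.
        \<forall>n\<in>carrier N. \<theta> (incl E n) = incl E' (\<alpha> n))}"

text \<open>
  The middle group of an extension of \<open>H\<close> by \<open>N\<close> has the cardinality of \<open>N \<times> H\<close>, so nothing is
  lost by forming the sets of classes from extensions whose middle group lives on the type
  \<open>'n \<times> 'h\<close>; see lemma \<open>extension_on_product_type\<close> below.
\<close>

definition Ex_all :: "('n, 'a) monoid_scheme \<Rightarrow> ('h, 'b) monoid_scheme \<Rightarrow>
    ('n, 'h, 'n \<times> 'h) extension set set" where
  "Ex_all N H = {E. is_extension N H E} // ext_rel N H"

definition Gr :: "('n, 'a) monoid_scheme \<Rightarrow> ('h, 'b) monoid_scheme \<Rightarrow>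
    ('n, 'h, 'n \<times> 'h) extension set set" where
  "Gr N H = {E. is_extension N H E} // virt_rel N H"

definition ext_class :: "('n, 'a) monoid_scheme \<Rightarrow> ('h, 'b) monoid_scheme \<Rightarrow>
    ('n, 'h, 'n \<times> 'h) extension \<Rightarrow> ('n, 'h, 'n \<times> 'h) extension set" where
  "ext_class N H E = ext_rel N H `` {E}"


section \<open>The coupling\<close>

definition conj_aut :: "('n, 'a) monoid_scheme \<Rightarrow> ('n, 'h, 'g) extension \<Rightarrow> 'g \<Rightarrow> 'n \<Rightarrow> 'n" where
  "conj_aut N E g = (\<lambda>n\<in>carrier N.
     inv_into (carrier N) (incl E) (g \<otimes>\<^bsub>middle E\<^esub> incl E n \<otimes>\<^bsub>middle E\<^esub> inv\<^bsub>middle E\<^esub> g))"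

definition coupling :: "('n, 'a) monoid_scheme \<Rightarrow> ('h, 'b) monoid_scheme \<Rightarrow>
    ('n, 'h, 'g) extension \<Rightarrow> 'h \<Rightarrow> ('n \<Rightarrow> 'n) set" where
  "coupling N H E = (\<lambda>h\<in>carrier H.
     out_class N (conj_aut N E (inv_into (carrier (middle E)) (projn E) h)))"

definition Hom_Out :: "('n, 'a) monoid_scheme \<Rightarrow> ('h, 'b) monoid_scheme \<Rightarrow>
    ('h \<Rightarrow> ('n \<Rightarrow> 'n) set) set" where
  "Hom_Out N H = hom H (Out N) \<inter> extensional (carrier H)"

definition Ex_of :: "('n, 'a) monoid_scheme \<Rightarrow> ('h, 'b) monoid_scheme \<Rightarrow>
    ('h \<Rightarrow> ('n \<Rightarrow> 'n) set) \<Rightarrow> ('n, 'h, 'n \<times> 'h) extension set set" where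
  "Ex_of N H \<omega> = ext_class N H ` {E. is_extension N H E \<and> coupling N H E = \<omega>}"


section \<open>The actions of \<open>K\<close>\<close>

definition act_ext :: "('n, 'a) monoid_scheme \<Rightarrow> ('h, 'b) monoid_scheme \<Rightarrow>
    ('n \<Rightarrow> 'n) \<times> ('h \<Rightarrow> 'h) \<Rightarrow> ('n, 'h, 'g) extension \<Rightarrow> ('n, 'h, 'g) extension" where
  "act_ext N H k E =
     \<lparr>middle = middle E,
      incl = incl E \<circ> inv\<^bsub>AutoGroup N\<^esub> (fst k),
      projn = snd k \<circ> projn E\<rparr>"

text \<open>The union is over representatives; it is a single class by lemma \<open>act_Ex_class\<close>.\<close>

definition act_Ex :: "('n, 'a) monoid_scheme \<Rightarrow> ('h, 'b) monoid_scheme \<Rightarrow>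
    ('n \<Rightarrow> 'n) \<times> ('h \<Rightarrow> 'h) \<Rightarrow>
    ('n, 'h, 'n \<times> 'h) extension set \<Rightarrow> ('n, 'h, 'n \<times> 'h) extension set" where
  "act_Ex N H k X = (\<Union>E\<in>X. ext_class N H (act_ext N H k E))"

definition act_Hom :: "('n, 'a) monoid_scheme \<Rightarrow> ('h, 'b) monoid_scheme \<Rightarrow>
    ('n \<Rightarrow> 'n) \<times> ('h \<Rightarrow> 'h) \<Rightarrow> ('h \<Rightarrow> ('n \<Rightarrow> 'n) set) \<Rightarrow> 'h \<Rightarrow> ('n \<Rightarrow> 'n) set" where
  "act_Hom N H k \<omega> = (\<lambda>h\<in>carrier H.
     out_class N (fst k) \<otimes>\<^bsub>Out N\<^esub> \<omega> ((inv\<^bsub>AutoGroup H\<^esub> (snd k)) h)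
       \<otimes>\<^bsub>Out N\<^esub> inv\<^bsub>Out N\<^esub> (out_class N (fst k)))"

definition K_of :: "('n, 'a) monoid_scheme \<Rightarrow> ('h, 'b) monoid_scheme \<Rightarrow>
    ('h \<Rightarrow> ('n \<Rightarrow> 'n) set) \<Rightarrow> (('n \<Rightarrow> 'n) \<times> ('h \<Rightarrow> 'h)) monoid" where
  "K_of N H \<omega> = K N H \<lparr>carrier := stabilizer (K N H) (act_Hom N H) \<omega>\<rparr>"

definition orbit_representatives :: "('n, 'a) monoid_scheme \<Rightarrow> ('h, 'b) monoid_scheme \<Rightarrow>
    ('h \<Rightarrow> ('n \<Rightarrow> 'n) set) set \<Rightarrow> bool" where
  "orbit_representatives N H R \<longleftrightarrow> R \<subseteq> Hom_Out N H \<and>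
     (\<forall>Q\<in>orbits (K N H) (Hom_Out N H) (act_Hom N H). \<exists>!\<omega>. \<omega> \<in> Q \<inter> R)"

definition is_stable :: "('n, 'a) monoid_scheme \<Rightarrow> ('h, 'b) monoid_scheme \<Rightarrow>
    ('h \<Rightarrow> ('n \<Rightarrow> 'n) set) \<Rightarrow> ('n, 'h, 'n \<times> 'h) extension set \<Rightarrow> bool" where
  "is_stable N H \<omega> X \<longleftrightarrow> (\<forall>k\<in>carrier (K_of N H \<omega>). act_Ex N H k X = X)"


section \<open>Second cohomology with coefficients in the centre\<close>

text \<open>
  An element of \<open>Out N\<close> is a coset, i.e. a set of automorphisms; they all restrict to the same
  automorphism of the centre.
\<close>

definition centre_act :: "('h \<Rightarrow> ('n \<Rightarrow> 'n) set) \<Rightarrow> 'h \<Rightarrow> 'n \<Rightarrow> 'n" where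
  "centre_act \<omega> h z = (SOME \<alpha>. \<alpha> \<in> \<omega> h) z"

definition cocycles :: "('n, 'a) monoid_scheme \<Rightarrow> ('h, 'b) monoid_scheme \<Rightarrow>
    ('h \<Rightarrow> ('n \<Rightarrow> 'n) set) \<Rightarrow> ('h \<times> 'h \<Rightarrow> 'n) set" where
  "cocycles N H \<omega> = {\<tau> \<in> carrier H \<times> carrier H \<rightarrow>\<^sub>E centre N.
     \<forall>g\<in>carrier H. \<forall>h\<in>carrier H. \<forall>k\<in>carrier H.
       centre_act \<omega> g (\<tau> (h, k)) \<otimes>\<^bsub>N\<^esub> \<tau> (g, h \<otimes>\<^bsub>H\<^esub> k)
         = \<tau> (g, h) \<otimes>\<^bsub>N\<^esub> \<tau> (g \<otimes>\<^bsub>H\<^esub> h, k)}"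

definition coboundary :: "('n, 'a) monoid_scheme \<Rightarrow> ('h, 'b) monoid_scheme \<Rightarrow>
    ('h \<Rightarrow> ('n \<Rightarrow> 'n) set) \<Rightarrow> ('h \<Rightarrow> 'n) \<Rightarrow> 'h \<times> 'h \<Rightarrow> 'n" where
  "coboundary N H \<omega> \<sigma> = restrict (\<lambda>(g, h).
     centre_act \<omega> g (\<sigma> h) \<otimes>\<^bsub>N\<^esub> inv\<^bsub>N\<^esub> (\<sigma> (g \<otimes>\<^bsub>H\<^esub> h)) \<otimes>\<^bsub>N\<^esub> \<sigma> g) (carrier H \<times> carrier H)"

definition cocycle_group :: "('n, 'a) monoid_scheme \<Rightarrow> ('h, 'b) monoid_scheme \<Rightarrow>
    ('h \<Rightarrow> ('n \<Rightarrow> 'n) set) \<Rightarrow> ('h \<times> 'h \<Rightarrow> 'n) monoid" where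
  "cocycle_group N H \<omega> =
     \<lparr>carrier = cocycles N H \<omega>,
      mult = \<lambda>\<sigma> \<tau>. \<lambda>x\<in>carrier H \<times> carrier H. \<sigma> x \<otimes>\<^bsub>N\<^esub> \<tau> x,
      one = \<lambda>x\<in>carrier H \<times> carrier H. \<one>\<^bsub>N\<^esub>\<rparr>"

definition H2 :: "('n, 'a) monoid_scheme \<Rightarrow> ('h, 'b) monoid_scheme \<Rightarrow>
    ('h \<Rightarrow> ('n \<Rightarrow> 'n) set) \<Rightarrow> ('h \<times> 'h \<Rightarrow> 'n) set monoid" where
  "H2 N H \<omega> = cocycle_group N H \<omega> Mod (coboundary N H \<omega> ` (carrier H \<rightarrow> centre N))"

definition act_cocycle :: "('h, 'b) monoid_scheme \<Rightarrow> ('n \<Rightarrow> 'n) \<times> ('h \<Rightarrow> 'h) \<Rightarrow>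
    ('h \<times> 'h \<Rightarrow> 'n) \<Rightarrow> 'h \<times> 'h \<Rightarrow> 'n" where
  "act_cocycle H k \<tau> = restrict (\<lambda>(g, h).
     fst k (\<tau> ((inv\<^bsub>AutoGroup H\<^esub> (snd k)) g, (inv\<^bsub>AutoGroup H\<^esub> (snd k)) h))) (carrier H \<times> carrier H)"

text \<open>
  For \<open>k \<in> K_of N H \<omega>\<close> the map \<open>act_cocycle H k\<close> is an automorphism of the cocycle group preserving
  the coboundaries, so the image of a coset is the coset of the image.
\<close>

definition act_H2 :: "('h, 'b) monoid_scheme \<Rightarrow> ('n \<Rightarrow> 'n) \<times> ('h \<Rightarrow> 'h) \<Rightarrow>
    ('h \<times> 'h \<Rightarrow> 'n) set \<Rightarrow> ('h \<times> 'h \<Rightarrow> 'n) set" where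
  "act_H2 H k c = act_cocycle H k ` c"


section \<open>The torsor structure\<close>

definition crossed_ext :: "('n, 'a) monoid_scheme \<Rightarrow> ('h, 'b) monoid_scheme \<Rightarrow>
    ('h \<Rightarrow> 'n \<Rightarrow> 'n) \<Rightarrow> ('h \<times> 'h \<Rightarrow> 'n) \<Rightarrow> ('n, 'h, 'n \<times> 'h) extension" where
  "crossed_ext N H \<phi> f =
     \<lparr>middle =
        \<lparr>carrier = carrier N \<times> carrier H,
         mult = \<lambda>(a, g) (b, h). (a \<otimes>\<^bsub>N\<^esub> \<phi> g b \<otimes>\<^bsub>N\<^esub> f (g, h), g \<otimes>\<^bsub>H\<^esub> h),
         one = (\<one>\<^bsub>N\<^esub>, \<one>\<^bsub>H\<^esub>)\<rparr>,
      incl = \<lambda>a. (a, \<one>\<^bsub>H\<^esub>),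
      projn = snd\<rparr>"

text \<open>
  The pairs \<open>(\<phi>, f)\<close> with \<open>crossed_ext N H \<phi> f \<in> X\<close> are those read off from the sections with value
  \<open>\<one>\<close> at \<open>\<one>\<close> of members of \<open>X\<close>; that \<open>crossed_ext N H \<phi> f\<close> is an extension forces
  \<open>\<phi> \<one> = id\<close> and \<open>f (\<one>, h) = f (g, \<one>) = \<one>\<close>. Accordingly only normalised cocycles \<open>\<tau>\<close> in the
  cohomology class are used; every class contains one.
\<close>

definition shift :: "('n, 'a) monoid_scheme \<Rightarrow> ('h, 'b) monoid_scheme \<Rightarrow>
    ('h \<times> 'h \<Rightarrow> 'n) set \<Rightarrow>
    ('n, 'h, 'n \<times> 'h) extension set \<Rightarrow> ('n, 'h, 'n \<times> 'h) extension set" where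
  "shift N H c X = \<Union> {ext_class N H (crossed_ext N H \<phi> (\<lambda>x. \<tau> x \<otimes>\<^bsub>N\<^esub> f x)) | \<phi> f \<tau>.
     \<phi> \<in> carrier H \<rightarrow> auto N \<and> f \<in> carrier H \<times> carrier H \<rightarrow> carrier N \<and>
     crossed_ext N H \<phi> f \<in> X \<and>
     \<tau> \<in> c \<and> (\<forall>g\<in>carrier H. \<tau> (\<one>\<^bsub>H\<^esub>, g) = \<one>\<^bsub>N\<^esub> \<and> \<tau> (g, \<one>\<^bsub>H\<^esub>) = \<one>\<^bsub>N\<^esub>)}"

definition is_torsor :: "('g, 'a) monoid_scheme \<Rightarrow> 'x set \<Rightarrow> ('g \<Rightarrow> 'x \<Rightarrow> 'x) \<Rightarrow> bool" where
  "is_torsor G S act \<longleftrightarrow> S \<noteq> {} \<and> group_action G S (\<lambda>g. restrict (act g) S) \<and>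
     (\<forall>x\<in>S. \<forall>y\<in>S. \<exists>!g. g \<in> carrier G \<and> act g x = y)"


section \<open>Well-definedness\<close>

lemma is_extensionD:
  assumes "is_extension N H E"
  shows "group (middle E)" "incl E \<in> hom N (middle E)" "inj_on (incl E) (carrier N)"
    "projn E \<in> hom (middle E) H" "projn E ` carrier (middle E) = carrier H"
    "incl E ` carrier N = {x \<in> carrier (middle E). projn E x = \<one>\<^bsub>H\<^esub>}"
  using assms by (auto simp: is_extension_def mon_def epi_def kernel_def)

lemma ext_rel_refl: "is_extension N H E \<Longrightarrow> (E, E) \<in> ext_rel N H"
  unfolding ext_rel_def using iso_set_refl by force

lemma ext_rel_sym:
  assumes "(E, E') \<in> ext_rel N H" shows "(E', E) \<in> ext_rel N H"
proof -
  have E: "is_extension N H E" and E': "is_extension N H E'"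
    using assms by (auto simp: ext_rel_def)
  interpret G: group "middle E" by (rule is_extensionD(1)[OF E])
  obtain \<theta> where \<theta>: "\<theta> \<in> iso (middle E) (middle E')"
    and i: "\<forall>n\<in>carrier N. \<theta> (incl E n) = incl E' n"
    and p: "\<forall>g\<in>carrier (middle E). projn E' (\<theta> g) = projn E g"
    using assms by (auto simp: ext_rel_def)
  let ?\<eta> = "inv_into (carrier (middle E)) \<theta>"
  have bij: "bij_betw \<theta> (carrier (middle E)) (carrier (middle E'))"
    using \<theta> by (simp add: iso_def)
  have mem: "incl E n \<in> carrier (middle E)" if "n \<in> carrier N" for n
    using is_extensionD(2)[OF E] that by (auto simp: hom_def)
  have "?\<eta> \<in> iso (middle E') (middle E)" by (rule G.iso_set_sym[OF \<theta>])
  moreover have "?\<eta> (incl E' n) = incl E n" if "n \<in> carrier N" for n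
    using i mem[OF that] that bij_betw_inv_into_left[OF bij] by metis
  moreover have "projn E (?\<eta> g) = projn E' g" if "g \<in> carrier (middle E')" for g
    using p that bij_betw_inv_into_right[OF bij that] bij
    by (metis bij_betw_def inv_into_into)
  ultimately show ?thesis using E E' unfolding ext_rel_def by blast
qed

lemma ext_rel_trans:
  assumes "(E, E') \<in> ext_rel N H" "(E', E'') \<in> ext_rel N H"
  shows "(E, E'') \<in> ext_rel N H"
proof -
  obtain \<theta> where \<theta>: "\<theta> \<in> iso (middle E) (middle E')"
    "\<forall>n\<in>carrier N. \<theta> (incl E n) = incl E' n"
    "\<forall>g\<in>carrier (middle E). projn E' (\<theta> g) = projn E g"
    using assms(1) by (auto simp: ext_rel_def)
  obtain \<eta> where \<eta>: "\<eta> \<in> iso (middle E') (middle E'')"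
    "\<forall>n\<in>carrier N. \<eta> (incl E' n) = incl E'' n"
    "\<forall>g\<in>carrier (middle E'). projn E'' (\<eta> g) = projn E' g"
    using assms(2) by (auto simp: ext_rel_def)
  have "\<eta> \<circ> \<theta> \<in> iso (middle E) (middle E'')" using \<theta> \<eta> iso_set_trans by blast
  moreover have "\<theta> g \<in> carrier (middle E')" if "g \<in> carrier (middle E)" for g
    using \<theta>(1) that by (auto simp: iso_def hom_def)
  ultimately show ?thesis
    using assms \<theta> \<eta> unfolding ext_rel_def by (auto intro!: bexI[of _ "\<eta> \<circ> \<theta>"])
qed

lemma equiv_ext_rel: "equiv {E. is_extension N H E} (ext_rel N H)"
  unfolding equiv_def refl_on_def sym_def trans_def
  by (auto intro: ext_rel_refl ext_rel_sym ext_rel_trans) (auto simp: ext_rel_def)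

lemma transport_extension:
  fixes E :: "('n, 'h, 'g) extension" and j :: "'g \<Rightarrow> 'k"
  assumes E: "is_extension N H E" and "group N" "group H" and inj: "inj_on j (carrier (middle E))"
  shows "\<exists>E' :: ('n, 'h, 'k) extension. (E, E') \<in> ext_rel N H"
proof -
  interpret G: group "middle E" by (rule is_extensionD(1)[OF E])
  let ?G = "middle E"
  define r where "r = inv_into (carrier ?G) j"
  have r[simp]: "r (j x) = x" if "x \<in> carrier ?G" for x
    unfolding r_def using inj that by simp
  define M where "M = \<lparr>carrier = j ` carrier ?G, mult = \<lambda>x y. j (r x \<otimes>\<^bsub>?G\<^esub> r y), one = j \<one>\<^bsub>?G\<^esub>\<rparr>"
  have M[simp]: "carrier M = j ` carrier ?G" "\<one>\<^bsub>M\<^esub> = j \<one>\<^bsub>?G\<^esub>"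
    "\<And>x y. x \<otimes>\<^bsub>M\<^esub> y = j (r x \<otimes>\<^bsub>?G\<^esub> r y)" by (simp_all add: M_def)
  have grp: "group M"
  proof (rule groupI)
    fix x assume "x \<in> carrier M"
    then obtain u where u: "u \<in> carrier ?G" "x = j u" by auto
    then show "\<exists>y\<in>carrier M. y \<otimes>\<^bsub>M\<^esub> x = \<one>\<^bsub>M\<^esub>"
      by (intro bexI[of _ "j (inv\<^bsub>?G\<^esub> u)"]) auto
  qed (auto simp: G.m_assoc)
  have iso: "j \<in> iso ?G M"
    using inj by (auto simp: iso_def hom_def bij_betw_def)
  define E' where "E' = \<lparr>middle = M, incl = j \<circ> incl E, projn = projn E \<circ> r\<rparr>"
  have inc: "incl E n \<in> carrier ?G" if "n \<in> carrier N" for n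
    using is_extensionD(2)[OF E] that by (auto simp: hom_def)
  have "is_extension N H E'"
    unfolding is_extension_def
  proof (intro conjI)
    show "group (middle E')" using grp by (simp add: E'_def)
    have "j \<in> mon ?G M" using iso by (simp add: iso_iff_mon_epi)
    then show "incl E' \<in> mon N (middle E')"
      using E mon_compose by (auto simp: E'_def is_extension_def)
    have "r \<in> iso M ?G" unfolding r_def by (rule G.iso_set_sym[OF iso])
    then have "r \<in> epi M ?G" by (simp add: iso_iff_mon_epi)
    then show "projn E' \<in> epi (middle E') H"
      using E epi_compose by (auto simp: E'_def is_extension_def)
    have "incl E' ` carrier N = j ` kernel ?G H (projn E)"
      using E unfolding is_extension_def by (metis (no_types) E'_def extension.select_convs(2) image_comp)
    also have "\<dots> = kernel (middle E') H (projn E')"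
      by (auto simp: kernel_def E'_def)
    finally show "incl E' ` carrier N = kernel (middle E') H (projn E')" .
  qed
  then have "(E, E') \<in> ext_rel N H"
    using E iso unfolding ext_rel_def E'_def by (auto intro!: bexI[of _ j])
  then show ?thesis by blast
qed

text \<open>Every extension, on whatever type its middle group lives, is equivalent to one on \<open>'n \<times> 'h\<close>.\<close>

lemma extension_on_product_type:
  fixes N :: "('n, 'a) monoid_scheme" and H :: "('h, 'b) monoid_scheme"
    and E :: "('n, 'h, 'g) extension"
  assumes "group N" "group H" and E: "is_extension N H E"
  shows "\<exists>E' :: ('n, 'h, 'n \<times> 'h) extension. (E, E') \<in> ext_rel N H"
proof -
  interpret G: group "middle E" by (rule is_extensionD(1)[OF E])
  interpret H: group H by fact
  interpret p: group_hom "middle E" H "projn E"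
    using is_extensionD(4)[OF E] by unfold_locales
  let ?G = "middle E"
  define s where "s g = inv_into (carrier ?G) (projn E) (projn E g)" for g
  define j where
    "j g = (inv_into (carrier N) (incl E) (g \<otimes>\<^bsub>?G\<^esub> inv\<^bsub>?G\<^esub> (s g)), projn E g)" for g
  have s: "s g \<in> carrier ?G" "projn E (s g) = projn E g" if "g \<in> carrier ?G" for g
    using that unfolding s_def by (auto intro: inv_into_into f_inv_into_f)
  have ker: "g \<otimes>\<^bsub>?G\<^esub> inv\<^bsub>?G\<^esub> (s g) \<in> incl E ` carrier N" if "g \<in> carrier ?G" for g
    using s[OF that] that by (simp add: is_extensionD(6)[OF E])
  have "inj_on j (carrier ?G)"
  proof (rule inj_onI)
    fix x y assume x: "x \<in> carrier ?G" and y: "y \<in> carrier ?G" and eq: "j x = j y"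
    have sxy: "s x = s y" using eq by (simp add: j_def s_def)
    have "x \<otimes>\<^bsub>?G\<^esub> inv\<^bsub>?G\<^esub> (s x) = y \<otimes>\<^bsub>?G\<^esub> inv\<^bsub>?G\<^esub> (s y)"
      using eq inv_into_injective[OF _ ker[OF x] ker[OF y]] by (simp add: j_def)
    then show "x = y" using x y s[OF x] sxy by simp
  qed
  from transport_extension[OF E \<open>group N\<close> \<open>group H\<close> this] show ?thesis .
qed

lemma carrier_AutoGroup [simp]: "carrier (AutoGroup N) = auto N"
  by (simp add: AutoGroup_def)

lemma mult_AutoGroup:
  "\<alpha> \<in> auto N \<Longrightarrow> \<beta> \<in> auto N \<Longrightarrow> \<alpha> \<otimes>\<^bsub>AutoGroup N\<^esub> \<beta> = compose (carrier N) \<alpha> \<beta>"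
  by (simp add: AutoGroup_def BijGroup_def auto_def)

lemma autoD:
  assumes "\<alpha> \<in> auto N"
  shows "\<alpha> \<in> hom N N" "bij_betw \<alpha> (carrier N) (carrier N)" "\<alpha> \<in> extensional (carrier N)"
  using assms by (auto simp: auto_def Bij_def)

lemma auto_iso: "\<alpha> \<in> auto N \<Longrightarrow> \<alpha> \<in> iso N N"
  using autoD[of \<alpha> N] by (simp add: iso_def)

lemma inv_auto: "group N \<Longrightarrow> \<alpha> \<in> auto N \<Longrightarrow> inv\<^bsub>AutoGroup N\<^esub> \<alpha> \<in> auto N"
  using group.inv_closed[OF group.AutoGroup, of N \<alpha>] by simp

lemma (in group) inv_cancel_left:
  assumes "x \<in> carrier G" "y \<in> carrier G"
  shows "x \<otimes> (inv x \<otimes> y) = y" "inv x \<otimes> (x \<otimes> y) = y"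
  using assms by (simp_all add: m_assoc[symmetric])

lemma inner_mem_auto:
  assumes "group N" and g: "g \<in> carrier N"
  shows "(\<lambda>x\<in>carrier N. g \<otimes>\<^bsub>N\<^esub> x \<otimes>\<^bsub>N\<^esub> inv\<^bsub>N\<^esub> g) \<in> auto N"
proof -
  interpret group N by fact
  have "bij_betw (\<lambda>x\<in>carrier N. g \<otimes>\<^bsub>N\<^esub> x \<otimes>\<^bsub>N\<^esub> inv\<^bsub>N\<^esub> g) (carrier N) (carrier N)"
    by (rule conjugation_is_bij[OF g])
  moreover have "g \<otimes>\<^bsub>N\<^esub> (x \<otimes>\<^bsub>N\<^esub> y) \<otimes>\<^bsub>N\<^esub> inv\<^bsub>N\<^esub> g
      = (g \<otimes>\<^bsub>N\<^esub> x \<otimes>\<^bsub>N\<^esub> inv\<^bsub>N\<^esub> g) \<otimes>\<^bsub>N\<^esub> (g \<otimes>\<^bsub>N\<^esub> y \<otimes>\<^bsub>N\<^esub> inv\<^bsub>N\<^esub> g)"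
    if "x \<in> carrier N" "y \<in> carrier N" for x y
    using that g by (simp add: m_assoc inv_solve_left)
  ultimately show ?thesis
    using g by (auto simp: auto_def hom_def Bij_def)
qed

lemma subgroup_Inn:
  assumes "group N" shows "subgroup (Inn N) (AutoGroup N)"
proof -
  interpret N: group N by fact
  interpret A: group "AutoGroup N" by (rule N.AutoGroup)
  let ?c = "\<lambda>g. \<lambda>x\<in>carrier N. g \<otimes>\<^bsub>N\<^esub> x \<otimes>\<^bsub>N\<^esub> inv\<^bsub>N\<^esub> g"
  have "group_hom N (AutoGroup N) ?c"
  proof unfold_locales
    show "?c \<in> hom N (AutoGroup N)"
    proof (rule homI)
      show "?c g \<in> carrier (AutoGroup N)" if "g \<in> carrier N" for g
        using inner_mem_auto[OF assms that] by simp
      show "?c (g \<otimes>\<^bsub>N\<^esub> h) = ?c g \<otimes>\<^bsub>AutoGroup N\<^esub> ?c h"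
        if "g \<in> carrier N" "h \<in> carrier N" for g h
        unfolding mult_AutoGroup[OF inner_mem_auto[OF assms that(1)] inner_mem_auto[OF assms that(2)]]
        using that by (auto simp: compose_def fun_eq_iff N.m_assoc N.inv_mult_group)
    qed
  qed
  from group_hom.img_is_subgroup[OF this] show ?thesis by (simp add: Inn_def)
qed

lemma incl_conj_aut:
  assumes "group N" "group H" and E: "is_extension N H E"
    and g: "g \<in> carrier (middle E)" and n: "n \<in> carrier N"
  shows "conj_aut N E g n \<in> carrier N"
    and "incl E (conj_aut N E g n) = g \<otimes>\<^bsub>middle E\<^esub> incl E n \<otimes>\<^bsub>middle E\<^esub> inv\<^bsub>middle E\<^esub> g"
proof -
  interpret G: group "middle E" by (rule is_extensionD(1)[OF E])
  interpret H: group H by fact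
  interpret p: group_hom "middle E" H "projn E"
    using is_extensionD(4)[OF E] by unfold_locales
  have "incl E n \<in> {x \<in> carrier (middle E). projn E x = \<one>\<^bsub>H\<^esub>}"
    using n is_extensionD(6)[OF E] by blast
  then have "g \<otimes>\<^bsub>middle E\<^esub> incl E n \<otimes>\<^bsub>middle E\<^esub> inv\<^bsub>middle E\<^esub> g \<in> incl E ` carrier N"
    using g by (simp add: is_extensionD(6)[OF E])
  then show "conj_aut N E g n \<in> carrier N"
    and "incl E (conj_aut N E g n) = g \<otimes>\<^bsub>middle E\<^esub> incl E n \<otimes>\<^bsub>middle E\<^esub> inv\<^bsub>middle E\<^esub> g"
    using n by (simp_all add: conj_aut_def inv_into_into f_inv_into_f)
qed

lemma conj_aut_eqI:
  assumes "is_extension N H E" "n \<in> carrier N" "m \<in> carrier N"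
    and "incl E m = g \<otimes>\<^bsub>middle E\<^esub> incl E n \<otimes>\<^bsub>middle E\<^esub> inv\<^bsub>middle E\<^esub> g"
  shows "conj_aut N E g n = m"
  using assms(2,3) is_extensionD(3)[OF assms(1)]
  by (simp add: conj_aut_def assms(4)[symmetric])

lemma conj_aut_auto:
  assumes "group N" "group H" and E: "is_extension N H E" and g: "g \<in> carrier (middle E)"
  shows "conj_aut N E g \<in> auto N"
proof -
  interpret N: group N by fact
  interpret G: group "middle E" by (rule is_extensionD(1)[OF E])
  interpret i: group_hom N "middle E" "incl E"
    using is_extensionD(2)[OF E] by unfold_locales
  note c = incl_conj_aut[OF \<open>group N\<close> \<open>group H\<close> E]
  have inv: "conj_aut N E g' (conj_aut N E h n) = n"
    if "g' \<in> carrier (middle E)" "h \<in> carrier (middle E)" "g' \<otimes>\<^bsub>middle E\<^esub> h = \<one>\<^bsub>middle E\<^esub>"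
      "n \<in> carrier N" for g' h n
  proof (rule conj_aut_eqI[OF E])
    have h: "h = inv\<^bsub>middle E\<^esub> g'"
      using that G.inv_equality[of h g'] G.inv_comm[of g' h] G.inv_equality by metis
    show "incl E n = g' \<otimes>\<^bsub>middle E\<^esub> incl E (conj_aut N E h n) \<otimes>\<^bsub>middle E\<^esub> inv\<^bsub>middle E\<^esub> g'"
      using that(1,4) by (simp add: c h G.m_assoc G.inv_cancel_left)
  qed (use that c in auto)
  have "bij_betw (conj_aut N E g) (carrier N) (carrier N)"
    by (rule bij_betw_byWitness[of _ "conj_aut N E (inv\<^bsub>middle E\<^esub> g)"])
      (use g c inv in auto)
  moreover have "conj_aut N E g (x \<otimes>\<^bsub>N\<^esub> y) = conj_aut N E g x \<otimes>\<^bsub>N\<^esub> conj_aut N E g y"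
    if "x \<in> carrier N" "y \<in> carrier N" for x y
    by (rule conj_aut_eqI[OF E])
      (use that g c in \<open>simp_all add: G.m_assoc G.inv_cancel_left\<close>)
  ultimately show ?thesis
    using c g by (auto simp: auto_def hom_def Bij_def) (simp add: conj_aut_def)
qed

text \<open>The coupling does not depend on the section, and depends only on the equivalence class.\<close>

lemma coupling_section:
  assumes "group N" "group H" and E: "is_extension N H E" and g: "g \<in> carrier (middle E)"
  shows "coupling N H E (projn E g) = out_class N (conj_aut N E g)"
proof -
  interpret N: group N by fact
  interpret A: group "AutoGroup N" by (rule N.AutoGroup)
  interpret G: group "middle E" by (rule is_extensionD(1)[OF E])
  interpret H: group H by fact
  interpret p: group_hom "middle E" H "projn E"
    using is_extensionD(4)[OF E] by unfold_locales
  interpret i: group_hom N "middle E" "incl E"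
    using is_extensionD(2)[OF E] by unfold_locales
  let ?G = "middle E"
  note c = incl_conj_aut[OF \<open>group N\<close> \<open>group H\<close> E]
  define s where "s = inv_into (carrier ?G) (projn E) (projn E g)"
  have s: "s \<in> carrier ?G" "projn E s = projn E g"
    using g unfolding s_def by (auto intro: inv_into_into f_inv_into_f)
  have "g \<otimes>\<^bsub>?G\<^esub> inv\<^bsub>?G\<^esub> s \<in> incl E ` carrier N"
    using s g by (simp add: is_extensionD(6)[OF E])
  then obtain m where m: "m \<in> carrier N" "incl E m = g \<otimes>\<^bsub>?G\<^esub> inv\<^bsub>?G\<^esub> s" by auto
  define a where "a = (\<lambda>x\<in>carrier N. m \<otimes>\<^bsub>N\<^esub> x \<otimes>\<^bsub>N\<^esub> inv\<^bsub>N\<^esub> m)"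
  have a: "a \<in> auto N" "a \<in> Inn N"
    using inner_mem_auto[OF \<open>group N\<close> m(1)] m(1) by (auto simp: a_def Inn_def)
  have cs: "conj_aut N E s \<in> auto N" by (rule conj_aut_auto[OF assms(1,2) E s(1)])
  have "conj_aut N E g = a \<otimes>\<^bsub>AutoGroup N\<^esub> conj_aut N E s"
    unfolding mult_AutoGroup[OF a(1) cs]
  proof (rule extensionalityI[of _ "carrier N"])
    fix n assume n: "n \<in> carrier N"
    have "conj_aut N E g n = m \<otimes>\<^bsub>N\<^esub> conj_aut N E s n \<otimes>\<^bsub>N\<^esub> inv\<^bsub>N\<^esub> m"
      by (rule conj_aut_eqI[OF E])
        (use n m s g c in \<open>simp_all add: G.m_assoc G.inv_cancel_left G.inv_mult_group\<close>)
    then show "conj_aut N E g n = compose (carrier N) a (conj_aut N E s) n"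
      using n c(1)[OF s(1) n] by (simp add: compose_def a_def)
  qed (auto simp: conj_aut_def compose_def)
  then have "out_class N (conj_aut N E g) = (Inn N #>\<^bsub>AutoGroup N\<^esub> a) #>\<^bsub>AutoGroup N\<^esub> conj_aut N E s"
    using A.coset_mult_assoc[of "Inn N" a "conj_aut N E s"] a cs subgroup.subset[OF subgroup_Inn[OF assms(1)]]
    by (simp add: out_class_def)
  also have "Inn N #>\<^bsub>AutoGroup N\<^esub> a = Inn N"
    using A.coset_join2[OF _ subgroup_Inn[OF assms(1)] a(2)] a(1) by simp
  finally show ?thesis
    using g by (simp add: coupling_def out_class_def s_def)
qed

lemma coupling_ext_rel:
  assumes "group N" "group H" "(E, E') \<in> ext_rel N H"
  shows "coupling N H E = coupling N H E'"
proof -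
  have E: "is_extension N H E" and E': "is_extension N H E'"
    using assms by (auto simp: ext_rel_def)
  obtain \<theta> where \<theta>: "\<theta> \<in> iso (middle E) (middle E')"
    and i: "\<And>n. n \<in> carrier N \<Longrightarrow> \<theta> (incl E n) = incl E' n"
    and p: "\<And>g. g \<in> carrier (middle E) \<Longrightarrow> projn E' (\<theta> g) = projn E g"
    using assms by (auto simp: ext_rel_def)
  interpret N: group N by fact
  interpret G: group "middle E" by (rule is_extensionD(1)[OF E])
  interpret G': group "middle E'" by (rule is_extensionD(1)[OF E'])
  interpret i: group_hom N "middle E" "incl E"
    using is_extensionD(2)[OF E] by unfold_locales
  interpret t: group_hom "middle E" "middle E'" \<theta>
    using \<theta> by unfold_locales (simp add: iso_def)
  note c = incl_conj_aut[OF \<open>group N\<close> \<open>group H\<close> E]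
  show ?thesis
  proof (rule extensionalityI[of _ "carrier H"])
    fix h assume "h \<in> carrier H"
    then obtain g where g: "g \<in> carrier (middle E)" "projn E g = h"
      using is_extensionD(5)[OF E] by (metis imageE)
    have "conj_aut N E' (\<theta> g) = conj_aut N E g"
    proof (rule extensionalityI[of _ "carrier N"])
      fix n assume n: "n \<in> carrier N"
      show "conj_aut N E' (\<theta> g) n = conj_aut N E g n"
        by (rule conj_aut_eqI[OF E'])
          (use n g c[OF g(1) n] i[of n, symmetric] i[of "conj_aut N E g n", symmetric] in simp_all)
    qed (auto simp: conj_aut_def)
    then show "coupling N H E h = coupling N H E' h"
      using coupling_section[OF assms(1,2) E g(1)]
        coupling_section[OF assms(1,2) E', of "\<theta> g"] g p by simp
  qed (auto simp: coupling_def)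
qed

lemma act_ext_is_extension:
  assumes "group N" "group H" "k \<in> carrier (K N H)" and E: "is_extension N H E"
  shows "is_extension N H (act_ext N H k E)"
proof -
  interpret H: group H by fact
  define a where "a = inv\<^bsub>AutoGroup N\<^esub> (fst k)"
  define b where "b = snd k"
  have k: "fst k \<in> auto N" "b \<in> auto H" using assms(3) by (auto simp: DirProd_def b_def)
  have a: "a \<in> auto N" using inv_auto[OF assms(1) k(1)] by (simp add: a_def)
  interpret b: group_hom H H b using autoD(1)[OF k(2)] by unfold_locales
  have "a \<in> mon N N" "b \<in> epi H H"
    using auto_iso[OF a] auto_iso[OF k(2)] by (simp_all add: iso_iff_mon_epi)
  then have "incl E \<circ> a \<in> mon N (middle E)" "b \<circ> projn E \<in> epi (middle E) H"
    using E mon_compose epi_compose by (auto simp: is_extension_def)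
  moreover have "b x = \<one>\<^bsub>H\<^esub> \<longleftrightarrow> x = \<one>\<^bsub>H\<^esub>" if "x \<in> carrier H" for x
    using that autoD(2)[OF k(2)] b.hom_one unfolding bij_betw_def inj_on_def
    by (metis H.one_closed)
  then have "kernel (middle E) H (b \<circ> projn E) = kernel (middle E) H (projn E)"
    using is_extensionD(5)[OF E] by (auto simp: kernel_def)
  moreover have "(incl E \<circ> a) ` carrier N = incl E ` carrier N"
    using autoD(2)[OF a] by (metis bij_betw_def image_comp)
  ultimately show ?thesis
    using E by (simp add: is_extension_def act_ext_def a_def b_def)
qed

lemma act_ext_rel:
  assumes "group N" "group H" and k: "k \<in> carrier (K N H)" and r: "(E, E') \<in> ext_rel N H"
  shows "(act_ext N H k E, act_ext N H k E') \<in> ext_rel N H"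
proof -
  have "is_extension N H (act_ext N H k E)" "is_extension N H (act_ext N H k E')"
    using r act_ext_is_extension[OF assms(1-3)] by (auto simp: ext_rel_def)
  moreover have "inv\<^bsub>AutoGroup N\<^esub> (fst k) \<in> auto N"
    using k inv_auto[OF assms(1)] by (auto simp: DirProd_def)
  then have "(inv\<^bsub>AutoGroup N\<^esub> (fst k)) n \<in> carrier N" if "n \<in> carrier N" for n
    using autoD(2) that bij_betwE by metis
  moreover obtain \<theta> where "\<theta> \<in> iso (middle E) (middle E')"
    "\<forall>n\<in>carrier N. \<theta> (incl E n) = incl E' n"
    "\<forall>g\<in>carrier (middle E). projn E' (\<theta> g) = projn E g"
    using r by (auto simp: ext_rel_def)
  ultimately show ?thesis
    unfolding ext_rel_def by (auto simp: act_ext_def intro!: bexI[of _ \<theta>])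
qed

lemma act_Ex_class:
  assumes "group N" "group H" "k \<in> carrier (K N H)" and E: "is_extension N H E"
  shows "act_Ex N H k (ext_class N H E) = ext_class N H (act_ext N H k E)"
proof -
  have "ext_class N H (act_ext N H k E') = ext_class N H (act_ext N H k E)"
    if "E' \<in> ext_class N H E" for E'
    using equiv_class_eq[OF equiv_ext_rel act_ext_rel[OF assms(1-3)], of E E'] that
    by (simp add: ext_class_def)
  moreover have "E \<in> ext_class N H E"
    using E ext_rel_refl by (auto simp: ext_class_def)
  ultimately show ?thesis unfolding act_Ex_def by blast
qed

end

theory Submission
  imports Defs
begin

text \<open>
Everything is read off from factor sets. Choosing a section of \<open>G \<rightarrow> H\<close> with value \<open>\<one>\<close> at
\<open>\<one>\<close> shows any extension to be equivalent to \<open>crossed_ext N H \<phi> f\<close> for a pair \<open>(\<phi>, f)\<close> satisfying the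
conditions collected in \<open>factor_set\<close>, and \<open>\<phi>\<close> may be prescribed to be any lift of the coupling
that is trivial at \<open>\<one>\<close> (\<open>extension_crossed\<close>). Two such pairs give equivalent extensions exactly
when they differ by a map \<open>m : H \<rightarrow> N\<close>, the change of section (\<open>crossed_rel_iff\<close>). The rest
is computation with these two facts.

The first two quotients are formal. A virtual isomorphism is an isomorphism of middle groups inducing
some \<open>\<alpha>\<close> on \<open>N\<close> and hence some \<open>\<beta>\<close> on \<open>H\<close>; read as a map between extensions it is
an equivalence from \<open>(\<alpha>, \<beta>) \<cdot> E\<close> to \<open>E'\<close>, so virtual isomorphism classes are \<open>K\<close>-orbits
(\<open>virt_rel_iff\<close>). The coupling is a \<open>K\<close>-equivariant map from extension classes to
\<open>Hom(H, Out N)\<close> whose fibres are the sets \<open>Ex_of N H \<omega>\<close>, and the orbits of a \<open>K\<close>-set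
fibred over another one are the orbits of the stabilisers on the fibres over representatives
(\<open>orbits_fibration\<close>).

For a fixed coupling \<open>\<omega>\<close> and a fixed lift \<open>\<phi>\<close>, two admissible \<open>f\<close> differ by a cocycle
with values in the centre (\<open>difference_cocycle\<close>), because both of them express the same automorphism
\<open>\<phi> g \<circ> \<phi> h \<circ> (\<phi> (g h))\<^sup>-\<^sup>1\<close> as an inner one; and a change of section that keeps \<open>\<phi>\<close>
fixed is central, so it changes \<open>f\<close> by a coboundary (\<open>twist_rel_iff\<close>). This is the torsor
structure. The group \<open>K_of N H \<omega>\<close> acts on lifts, factor sets and cocycles by the same formulas, so
\<open>k (c X) = (k c) (k X)\<close> (\<open>act_Ex_shift\<close>), and a fixed base point turns the torsor into an
equivariant copy of \<open>H2 N H \<omega>\<close>.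

If \<open>s\<close> splits the automorphism sequence, the semidirect product along \<open>s \<circ> \<omega>\<close> is a fixed
point: an element of \<open>K_of N H \<omega>\<close> changes the action \<open>s \<circ> \<omega>\<close> only by conjugation with an inner
automorphism, and a conjugated action gives an equivalent semidirect product
(\<open>split_stable_class\<close>).
\<close>

section \<open>Orbits of group actions\<close>

lemma bij_betw_quotient_kernel:
  assumes r: "r = {(x, y). x \<in> A \<and> y \<in> A \<and> F x = F y}"
  shows "\<exists>\<Phi>. bij_betw \<Phi> (A // r) (F ` A) \<and> (\<forall>C\<in>A // r. \<forall>x\<in>C. \<Phi> C = F x)"
proof -
  define \<Phi> where "\<Phi> C = the_elem (F ` C)" for C
  have val: "\<Phi> (r `` {x}) = F x" if "x \<in> A" for x
  proof -
    have "F ` (r `` {x}) = {F x}" using that by (auto simp: r)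
    then show ?thesis by (simp add: \<Phi>_def)
  qed
  have mem: "F y = F x" if "y \<in> r `` {x}" for x y
    using that by (auto simp: r)
  have cls: "r `` {x} = r `` {y}" if "x \<in> A" "y \<in> A" "F x = F y" for x y
    using that by (auto simp: r)
  have "inj_on \<Phi> (A // r)"
  proof (rule inj_onI)
    fix C D assume "C \<in> A // r" "D \<in> A // r" and eq: "\<Phi> C = \<Phi> D"
    then obtain x y where "x \<in> A" "C = r `` {x}" "y \<in> A" "D = r `` {y}"
      by (auto simp: quotient_def)
    then show "C = D" using eq val[of x] val[of y] cls[of x y] by simp
  qed
  moreover have "\<Phi> ` (A // r) = F ` A"
  proof -
    have "\<Phi> ` (A // r) = (\<lambda>x. \<Phi> (r `` {x})) ` A" by (auto simp: quotient_def)
    also have "\<dots> = F ` A" by (rule image_cong[OF refl val])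
    finally show ?thesis .
  qed
  moreover have "\<Phi> C = F x" if "C \<in> A // r" "x \<in> C" for C x
  proof -
    obtain y where "y \<in> A" "C = r `` {y}" using \<open>C \<in> A // r\<close> by (auto simp: quotient_def)
    then show ?thesis using val[of y] mem[of x y] \<open>x \<in> C\<close> by simp
  qed
  ultimately show ?thesis by (intro exI[of _ \<Phi>]) (simp add: bij_betw_def)
qed

lemma bij_betw_Sigma_fibrewise:
  assumes "\<And>i. i \<in> I \<Longrightarrow> bij_betw (f i) (A i) (B i)"
  shows "bij_betw (\<lambda>(i, x). (i, f i x)) (Sigma I A) (Sigma I B)"
proof -
  have "inj_on (\<lambda>(i, x). (i, f i x)) (Sigma I A)"
    using assms by (force simp: inj_on_def bij_betw_def)
  moreover have "(\<lambda>(i, x). (i, f i x)) ` Sigma I A = Sigma I B"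
  proof (intro subset_antisym subsetI)
    fix p assume "p \<in> (\<lambda>(i, x). (i, f i x)) ` Sigma I A"
    then show "p \<in> Sigma I B" using bij_betwE[OF assms] by auto
  next
    fix p assume "p \<in> Sigma I B"
    then obtain i y where p: "p = (i, y)" "i \<in> I" "y \<in> B i" by auto
    then obtain x where "x \<in> A i" "y = f i x"
      using bij_betw_imp_surj_on[OF assms] by (metis imageE)
    then show "p \<in> (\<lambda>(i, x). (i, f i x)) ` Sigma I A"
      using p by (intro image_eqI[of _ _ "(i, x)"]) auto
  qed
  ultimately show ?thesis by (simp add: bij_betw_def)
qed

text \<open>
A \<open>group_action\<close> is a homomorphism into the group of extensional bijections of a set, whereas the
actions considered here are formulas that also have values outside the set they act on; hence the
restriction. The three usual axioms suffice, as the inverse element provides the inverse map.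
\<close>

lemma group_action_restrictI:
  assumes "group G"
    and closed: "\<And>g x. g \<in> carrier G \<Longrightarrow> x \<in> S \<Longrightarrow> act g x \<in> S"
    and one: "\<And>x. x \<in> S \<Longrightarrow> act \<one>\<^bsub>G\<^esub> x = x"
    and mult: "\<And>g h x. g \<in> carrier G \<Longrightarrow> h \<in> carrier G \<Longrightarrow> x \<in> S \<Longrightarrow>
      act (g \<otimes>\<^bsub>G\<^esub> h) x = act g (act h x)"
  shows "group_action G S (\<lambda>g. restrict (act g) S)"
proof -
  interpret G: group G by fact
  have cancel: "act (inv\<^bsub>G\<^esub> g) (act g x) = x" "act g (act (inv\<^bsub>G\<^esub> g) x) = x"
    if "g \<in> carrier G" "x \<in> S" for g x
    using that by (simp_all add: mult[symmetric] one)
  have Bij: "restrict (act g) S \<in> Bij S" if g: "g \<in> carrier G" for g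
  proof -
    have "bij_betw (act g) S S"
      by (rule bij_betw_byWitness[of _ "act (inv\<^bsub>G\<^esub> g)"]) (use g cancel closed in auto)
    then show ?thesis by (simp add: Bij_def)
  qed
  have "(\<lambda>g. restrict (act g) S) \<in> hom G (BijGroup S)"
  proof (rule homI)
    show "restrict (act g) S \<in> carrier (BijGroup S)" if "g \<in> carrier G" for g
      using Bij[OF that] by (simp add: BijGroup_def)
    show "restrict (act (g \<otimes>\<^bsub>G\<^esub> h)) S = restrict (act g) S \<otimes>\<^bsub>BijGroup S\<^esub> restrict (act h) S"
      if "g \<in> carrier G" "h \<in> carrier G" for g h
      using that Bij closed mult by (auto simp: BijGroup_def compose_def fun_eq_iff)
  qed
  then show ?thesis
    by (simp add: group_action_def group_hom_def group_hom_axioms_def group_BijGroup assms(1))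
qed

lemma orbit_restrict: "x \<in> S \<Longrightarrow> orbit G (\<lambda>g. restrict (act g) S) x = orbit G act x"
  by (auto simp: orbit_def)

lemma action_closed:
  assumes "group_action G S (\<lambda>g. restrict (act g) S)" "g \<in> carrier G" "x \<in> S"
  shows "act g x \<in> S"
  using group_action.element_image[OF assms(1,2,3), of "act g x"] assms(3) by simp

lemma orbit_self:
  assumes "group_action G S (\<lambda>g. restrict (act g) S)" "x \<in> S"
  shows "x \<in> orbit G act x"
  using group_action.orbit_refl[OF assms] assms(2) by (simp add: orbit_restrict)

lemma orbit_eq_iff:
  assumes A: "group_action G S (\<lambda>g. restrict (act g) S)" and x: "x \<in> S" and y: "y \<in> S"
  shows "orbit G act x = orbit G act y \<longleftrightarrow> (\<exists>g\<in>carrier G. act g x = y)"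
proof
  assume "orbit G act x = orbit G act y"
  then have "y \<in> orbit G act x" using orbit_self[OF A y] by simp
  then show "\<exists>g\<in>carrier G. act g x = y" by (auto simp: orbit_def)
next
  interpret group_action G S "\<lambda>g. restrict (act g) S" by fact
  assume "\<exists>g\<in>carrier G. act g x = y"
  then have "y \<in> orbit G act x \<inter> orbit G act y"
    using orbit_self[OF A y] by (auto simp: orbit_def)
  moreover have "orbit G act x \<in> orbits G S (\<lambda>g. restrict (act g) S)"
    "orbit G act y \<in> orbits G S (\<lambda>g. restrict (act g) S)"
    unfolding orbits_def using orbit_restrict[OF x, of G act] orbit_restrict[OF y, of G act] x y
    by blast+
  ultimately show "orbit G act x = orbit G act y"
    using disjoint_union by blast
qed

lemma orbits_equivariant_bij:
  assumes f: "bij_betw f S T"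
    and closed: "\<And>g x. g \<in> carrier G \<Longrightarrow> x \<in> S \<Longrightarrow> act g x \<in> S"
    and eqv: "\<And>g x. g \<in> carrier G \<Longrightarrow> x \<in> S \<Longrightarrow> f (act g x) = act' g (f x)"
  shows "bij_betw ((`) f) (orbits G S act) (orbits G T act')"
proof -
  have orb: "f ` orbit G act x = orbit G act' (f x)" if "x \<in> S" for x
    using eqv that by (force simp: orbit_def)
  have "inj_on ((`) f) (Pow S)"
    using f by (simp add: bij_betw_def inj_on_image_Pow)
  moreover have "orbits G S act \<subseteq> Pow S"
    using closed by (auto simp: orbits_def orbit_def)
  ultimately have "inj_on ((`) f) (orbits G S act)"
    by (rule inj_on_subset)
  moreover have "(`) f ` orbits G S act = orbits G T act'"
  proof -
    have "(`) f ` orbits G S act = (\<lambda>x. f ` orbit G act x) ` S"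
      by (auto simp: orbits_def)
    also have "\<dots> = (\<lambda>x. orbit G act' (f x)) ` S"
      by (rule image_cong) (simp_all add: orb)
    also have "\<dots> = orbit G act' ` (f ` S)" by auto
    also have "\<dots> = orbits G T act'"
      using f by (auto simp: bij_betw_def orbits_def)
    finally show ?thesis .
  qed
  ultimately show ?thesis by (simp add: bij_betw_def)
qed

text \<open>
An orbit \<open>Q\<close> in \<open>S\<close> lies over a single orbit in \<open>T\<close>, hence over a single representative
\<open>\<omega>\<close>, and the points of \<open>Q\<close> over \<open>\<omega>\<close> form one orbit of the stabiliser of \<open>\<omega>\<close>:
if \<open>c x = \<omega> = c (g x)\<close> then \<open>g\<close> fixes \<open>\<omega>\<close>.
\<close>

lemma orbits_fibration:
  assumes S: "group_action G S (\<lambda>g. restrict (act g) S)"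
    and T: "group_action G T (\<lambda>g. restrict (act' g) T)"
    and c: "\<And>x. x \<in> S \<Longrightarrow> c x \<in> T"
    and eqv: "\<And>g x. g \<in> carrier G \<Longrightarrow> x \<in> S \<Longrightarrow> c (act g x) = act' g (c x)"
    and R: "\<And>Q. Q \<in> orbits G T act' \<Longrightarrow> \<exists>!\<omega>. \<omega> \<in> Q \<inter> R" "R \<subseteq> T"
  shows "\<exists>\<Psi>. bij_betw \<Psi> (orbits G S act)
      (SIGMA \<omega>:R. orbits (G\<lparr>carrier := stabilizer G act' \<omega>\<rparr>) {x \<in> S. c x = \<omega>} act) \<and>
    (\<forall>\<omega>\<in>R. \<forall>x\<in>{x \<in> S. c x = \<omega>}.
      \<Psi> (orbit G act x) = (\<omega>, orbit (G\<lparr>carrier := stabilizer G act' \<omega>\<rparr>) act x))"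
proof -
  \<comment> \<open>\<open>c ` Q\<close> is the orbit below \<open>Q\<close>; it meets \<open>R\<close> in one point.\<close>
  define \<Psi> where "\<Psi> Q = (let \<omega> = (THE \<omega>. \<omega> \<in> c ` Q \<inter> R) in (\<omega>, {y \<in> Q. c y = \<omega>}))" for Q
  have image: "c ` orbit G act x = orbit G act' (c x)" if "x \<in> S" for x
    using eqv that by (force simp: orbit_def)
  have fibre: "orbit (G\<lparr>carrier := stabilizer G act' \<omega>\<rparr>) act x = {y \<in> orbit G act x. c y = \<omega>}"
    if "x \<in> S" "c x = \<omega>" for x \<omega>
    using eqv that by (force simp: orbit_def stabilizer_def)
  have val: "\<Psi> (orbit G act x) = (\<omega>, orbit (G\<lparr>carrier := stabilizer G act' \<omega>\<rparr>) act x)"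
    if x: "x \<in> S" and "c x = \<omega>" and "\<omega> \<in> R" for x \<omega>
  proof -
    have "c ` orbit G act x \<in> orbits G T act'"
      using c[OF x] by (auto simp: image[OF x] orbits_def)
    then have "\<exists>!\<omega>. \<omega> \<in> c ` orbit G act x \<inter> R" by (rule R(1))
    moreover have "\<omega> \<in> c ` orbit G act x \<inter> R"
      using that orbit_self[OF S x] by auto
    ultimately have "(THE \<omega>. \<omega> \<in> c ` orbit G act x \<inter> R) = \<omega>" by (rule the1_equality)
    then show ?thesis using that by (simp add: \<Psi>_def fibre)
  qed
  have rep: "\<exists>x\<in>S. c x \<in> R \<and> Q = orbit G act x" if Q: "Q \<in> orbits G S act" for Q
  proof -
    obtain x where x: "x \<in> S" "Q = orbit G act x" using Q by (auto simp: orbits_def)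
    have "orbit G act' (c x) \<in> orbits G T act'" using c[OF x(1)] by (auto simp: orbits_def)
    from ex1_implies_ex[OF R(1)[OF this]] obtain \<omega> where "\<omega> \<in> c ` Q" "\<omega> \<in> R"
      using image[OF x(1)] x(2) by auto
    then obtain g where g: "g \<in> carrier G" "c (act g x) \<in> R"
      using x by (auto simp: orbit_def)
    have y: "act g x \<in> S" by (rule action_closed[OF S g(1) x(1)])
    moreover have "Q = orbit G act (act g x)"
      unfolding x(2) orbit_eq_iff[OF S x(1) y] using g(1) by blast
    ultimately show ?thesis using g(2) by (intro bexI[of _ "act g x"] conjI)
  qed
  have "inj_on \<Psi> (orbits G S act)"
  proof (rule inj_onI)
    fix P Q assume P: "P \<in> orbits G S act" and Q: "Q \<in> orbits G S act" and eq: "\<Psi> P = \<Psi> Q"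
    obtain x where x: "x \<in> S" "c x \<in> R" "P = orbit G act x" using rep[OF P] by auto
    obtain y where y: "y \<in> S" "c y \<in> R" "Q = orbit G act y" using rep[OF Q] by auto
    have "c x = c y"
      "orbit (G\<lparr>carrier := stabilizer G act' (c x)\<rparr>) act x
        = orbit (G\<lparr>carrier := stabilizer G act' (c y)\<rparr>) act y"
      using eq unfolding x(3) y(3) val[OF x(1) refl x(2)] val[OF y(1) refl y(2)] prod.inject by blast+
    then have "{z \<in> orbit G act x. c z = c x} = {z \<in> orbit G act y. c z = c x}"
      using fibre[OF x(1) refl] fibre[OF y(1) refl] by simp
    then have "x \<in> orbit G act y" using orbit_self[OF S x(1)] by blast
    then have "\<exists>g\<in>carrier G. act g y = x" by (auto simp: orbit_def)
    then show "P = Q"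
      using orbit_eq_iff[OF S y(1) x(1)] x(3) y(3) by simp
  qed
  moreover have "\<Psi> ` orbits G S act
      = (SIGMA \<omega>:R. orbits (G\<lparr>carrier := stabilizer G act' \<omega>\<rparr>) {x \<in> S. c x = \<omega>} act)"
  proof (intro subset_antisym subsetI)
    fix p assume "p \<in> \<Psi> ` orbits G S act"
    then obtain x where "x \<in> S" "c x \<in> R" "p = \<Psi> (orbit G act x)" using rep by blast
    then show "p \<in> (SIGMA \<omega>:R. orbits (G\<lparr>carrier := stabilizer G act' \<omega>\<rparr>) {x \<in> S. c x = \<omega>} act)"
      by (auto simp: val orbits_def)
  next
    fix p assume "p \<in> (SIGMA \<omega>:R. orbits (G\<lparr>carrier := stabilizer G act' \<omega>\<rparr>) {x \<in> S. c x = \<omega>} act)"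
    then obtain x where x: "x \<in> S" "c x \<in> R"
      "p = (c x, orbit (G\<lparr>carrier := stabilizer G act' (c x)\<rparr>) act x)"
      by (auto simp: orbits_def)
    then have "p = \<Psi> (orbit G act x)" using val[OF x(1) refl x(2)] by simp
    then show "p \<in> \<Psi> ` orbits G S act" using x(1) by (auto simp: orbits_def)
  qed
  ultimately show ?thesis using val by (intro exI[of _ \<Psi>]) (simp add: bij_betw_def)
qed

section \<open>Automorphisms modulo inner automorphisms\<close>

context group
begin

lemma auto_group_hom: "\<alpha> \<in> auto G \<Longrightarrow> group_hom G G \<alpha>"
  using autoD(1) by unfold_locales

lemma auto_closed: "\<alpha> \<in> auto G \<Longrightarrow> x \<in> carrier G \<Longrightarrow> \<alpha> x \<in> carrier G"
  by (rule group_hom.hom_closed[OF auto_group_hom])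

lemma auto_mult:
  "\<alpha> \<in> auto G \<Longrightarrow> x \<in> carrier G \<Longrightarrow> y \<in> carrier G \<Longrightarrow> \<alpha> (x \<otimes> y) = \<alpha> x \<otimes> \<alpha> y"
  by (rule group_hom.hom_mult[OF auto_group_hom])

lemma auto_one: "\<alpha> \<in> auto G \<Longrightarrow> \<alpha> \<one> = \<one>"
  by (rule group_hom.hom_one[OF auto_group_hom])

lemma auto_m_inv: "\<alpha> \<in> auto G \<Longrightarrow> x \<in> carrier G \<Longrightarrow> \<alpha> (inv x) = inv (\<alpha> x)"
  by (rule group_hom.hom_inv[OF auto_group_hom])

lemma auto_eqI:
  assumes "\<alpha> \<in> auto G" "\<beta> \<in> auto G" "\<And>x. x \<in> carrier G \<Longrightarrow> \<alpha> x = \<beta> x"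
  shows "\<alpha> = \<beta>"
  using assms(3) by (rule extensionalityI[OF autoD(3)[OF assms(1)] autoD(3)[OF assms(2)]])

lemma auto_prod_closed: "\<alpha> \<in> auto G \<Longrightarrow> \<beta> \<in> auto G \<Longrightarrow> \<alpha> \<otimes>\<^bsub>AutoGroup G\<^esub> \<beta> \<in> auto G"
  using group.is_monoid[OF AutoGroup] monoid.m_closed[of "AutoGroup G"] by fastforce

lemma auto_prod_apply:
  "\<alpha> \<in> auto G \<Longrightarrow> \<beta> \<in> auto G \<Longrightarrow> x \<in> carrier G \<Longrightarrow> (\<alpha> \<otimes>\<^bsub>AutoGroup G\<^esub> \<beta>) x = \<alpha> (\<beta> x)"
  by (simp add: mult_AutoGroup compose_def)

lemma auto_one_apply: "x \<in> carrier G \<Longrightarrow> \<one>\<^bsub>AutoGroup G\<^esub> x = x"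
  by (simp add: AutoGroup_def BijGroup_def)

lemma auto_inv_closed: "\<alpha> \<in> auto G \<Longrightarrow> inv\<^bsub>AutoGroup G\<^esub> \<alpha> \<in> auto G"
  using group_axioms by (rule inv_auto)

lemma auto_inv_apply:
  assumes "\<alpha> \<in> auto G" "x \<in> carrier G"
  shows "(inv\<^bsub>AutoGroup G\<^esub> \<alpha>) (\<alpha> x) = x" "\<alpha> ((inv\<^bsub>AutoGroup G\<^esub> \<alpha>) x) = x"
proof -
  interpret A: group "AutoGroup G" by (rule AutoGroup)
  have i: "inv\<^bsub>AutoGroup G\<^esub> \<alpha> \<in> auto G" using assms(1) by (rule auto_inv_closed)
  show "(inv\<^bsub>AutoGroup G\<^esub> \<alpha>) (\<alpha> x) = x"
    using assms by (simp add: auto_prod_apply[OF i assms(1), symmetric] auto_one_apply)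
  show "\<alpha> ((inv\<^bsub>AutoGroup G\<^esub> \<alpha>) x) = x"
    using assms by (simp add: auto_prod_apply[OF assms(1) i, symmetric] auto_one_apply)
qed

lemma auto_inv_prod_apply:
  assumes "\<alpha> \<in> auto G" "\<beta> \<in> auto G" "x \<in> carrier G"
  shows "(inv\<^bsub>AutoGroup G\<^esub> (\<alpha> \<otimes>\<^bsub>AutoGroup G\<^esub> \<beta>)) x
    = (inv\<^bsub>AutoGroup G\<^esub> \<beta>) ((inv\<^bsub>AutoGroup G\<^esub> \<alpha>) x)"
proof -
  interpret A: group "AutoGroup G" by (rule AutoGroup)
  show ?thesis
    using assms A.inv_mult_group[of \<alpha> \<beta>] by (simp add: auto_prod_apply auto_inv_closed)
qed

lemma auto_inv_one_apply: "x \<in> carrier G \<Longrightarrow> (inv\<^bsub>AutoGroup G\<^esub> \<one>\<^bsub>AutoGroup G\<^esub>) x = x"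
proof -
  interpret A: group "AutoGroup G" by (rule AutoGroup)
  show "x \<in> carrier G \<Longrightarrow> (inv\<^bsub>AutoGroup G\<^esub> \<one>\<^bsub>AutoGroup G\<^esub>) x = x"
    by (simp add: auto_one_apply)
qed

lemmas auto_simps = auto_closed auto_mult auto_one auto_m_inv auto_prod_closed auto_prod_apply
  auto_one_apply auto_inv_closed auto_inv_apply

text \<open>
Equations between outer automorphisms become pointwise equations in the group, up to one conjugating
element; computations in \<open>Out\<close> are carried out in this form.
\<close>

lemma mem_out_class_iff:
  assumes "\<beta> \<in> auto G"
  shows "\<alpha> \<in> out_class G \<beta> \<longleftrightarrow>
    \<alpha> \<in> auto G \<and> (\<exists>n\<in>carrier G. \<forall>x\<in>carrier G. \<alpha> x = n \<otimes> \<beta> x \<otimes> inv n)"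
proof -
  note inner = inner_mem_auto[OF group_axioms]
  have "\<alpha> = (\<lambda>x\<in>carrier G. n \<otimes> x \<otimes> inv n) \<otimes>\<^bsub>AutoGroup G\<^esub> \<beta> \<longleftrightarrow>
      \<alpha> \<in> auto G \<and> (\<forall>x\<in>carrier G. \<alpha> x = n \<otimes> \<beta> x \<otimes> inv n)" if n: "n \<in> carrier G" for n
  proof safe
    assume "\<alpha> \<in> auto G" "\<forall>x\<in>carrier G. \<alpha> x = n \<otimes> \<beta> x \<otimes> inv n"
    then show "\<alpha> = (\<lambda>x\<in>carrier G. n \<otimes> x \<otimes> inv n) \<otimes>\<^bsub>AutoGroup G\<^esub> \<beta>"
      using inner[OF n] assms by (intro auto_eqI) (simp_all add: auto_simps)
  qed (use inner[OF n] assms in \<open>simp_all add: auto_simps\<close>)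
  then show ?thesis by (auto simp: out_class_def r_coset_def Inn_def)
qed

lemma out_class_eq_iff:
  assumes "\<alpha> \<in> auto G" "\<beta> \<in> auto G"
  shows "out_class G \<alpha> = out_class G \<beta> \<longleftrightarrow>
    (\<exists>n\<in>carrier G. \<forall>x\<in>carrier G. \<alpha> x = n \<otimes> \<beta> x \<otimes> inv n)"
proof -
  interpret A: group "AutoGroup G" by (rule AutoGroup)
  note sub = subgroup_Inn[OF group_axioms]
  have "out_class G \<alpha> = out_class G \<beta> \<longleftrightarrow> \<alpha> \<in> out_class G \<beta>"
    using assms A.rcos_self[OF _ sub, of \<alpha>] A.repr_independence[of \<alpha> "Inn G" \<beta>, OF _ _ sub]
    unfolding out_class_def by auto
  then show ?thesis using mem_out_class_iff[OF assms(2), of \<alpha>] assms(1) by blast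
qed

lemma out_class_self: "\<alpha> \<in> auto G \<Longrightarrow> \<alpha> \<in> out_class G \<alpha>"
  using group.rcos_self[OF AutoGroup _ subgroup_Inn[OF group_axioms]] by (simp add: out_class_def)

lemma normal_Inn: "Inn G \<lhd> AutoGroup G"
proof -
  interpret A: group "AutoGroup G" by (rule AutoGroup)
  have "\<alpha> \<otimes>\<^bsub>AutoGroup G\<^esub> i \<otimes>\<^bsub>AutoGroup G\<^esub> inv\<^bsub>AutoGroup G\<^esub> \<alpha> \<in> Inn G"
    if \<alpha>: "\<alpha> \<in> auto G" and i: "i \<in> Inn G" for \<alpha> i
  proof -
    obtain n where n: "n \<in> carrier G" and i_eq: "i = (\<lambda>x\<in>carrier G. n \<otimes> x \<otimes> inv n)"
      using i by (auto simp: Inn_def)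
    have "i \<in> auto G" unfolding i_eq by (rule inner_mem_auto[OF group_axioms n])
    then have "\<alpha> \<otimes>\<^bsub>AutoGroup G\<^esub> i \<otimes>\<^bsub>AutoGroup G\<^esub> inv\<^bsub>AutoGroup G\<^esub> \<alpha>
        = (\<lambda>x\<in>carrier G. \<alpha> n \<otimes> x \<otimes> inv (\<alpha> n))"
      using \<alpha> n
      by (intro auto_eqI inner_mem_auto[OF group_axioms]) (simp_all add: auto_simps, simp add: i_eq auto_simps)
    then show ?thesis using auto_closed[OF \<alpha> n] by (auto simp: Inn_def)
  qed
  then show ?thesis
    using subgroup_Inn[OF group_axioms] by (simp add: A.normal_inv_iff)
qed

lemma group_Out: "group (Out G)"
  unfolding Out_def by (rule normal.factorgroup_is_group[OF normal_Inn])

lemma carrier_Out: "carrier (Out G) = out_class G ` auto G"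
  by (auto simp: Out_def carrier_FactGroup out_class_def)

lemma out_class_hom: "group_hom (AutoGroup G) (Out G) (out_class G)"
  using normal.r_coset_hom_Mod[OF normal_Inn] group_Out AutoGroup
  by (simp add: group_hom_def group_hom_axioms_def Out_def out_class_def[abs_def])

lemma out_class_closed: "\<alpha> \<in> auto G \<Longrightarrow> out_class G \<alpha> \<in> carrier (Out G)"
  by (simp add: carrier_Out)

lemma out_class_mult:
  "\<alpha> \<in> auto G \<Longrightarrow> \<beta> \<in> auto G \<Longrightarrow>
    out_class G \<alpha> \<otimes>\<^bsub>Out G\<^esub> out_class G \<beta> = out_class G (\<alpha> \<otimes>\<^bsub>AutoGroup G\<^esub> \<beta>)"
  using group_hom.hom_mult[OF out_class_hom] by simp

lemma out_class_inv:
  "\<alpha> \<in> auto G \<Longrightarrow> inv\<^bsub>Out G\<^esub> (out_class G \<alpha>) = out_class G (inv\<^bsub>AutoGroup G\<^esub> \<alpha>)"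
  using group_hom.hom_inv[OF out_class_hom] by simp

lemma out_class_one: "out_class G \<one>\<^bsub>AutoGroup G\<^esub> = \<one>\<^bsub>Out G\<^esub>"
  by (rule group_hom.hom_one[OF out_class_hom])

lemma centre_closed: "z \<in> centre G \<Longrightarrow> z \<in> carrier G"
  by (simp add: centre_def)

lemma centre_commutes: "z \<in> centre G \<Longrightarrow> x \<in> carrier G \<Longrightarrow> x \<otimes> z = z \<otimes> x"
  by (simp add: centre_def)

lemma centreI:
  assumes "z \<in> carrier G" "\<And>x. x \<in> carrier G \<Longrightarrow> z \<otimes> x = x \<otimes> z"
  shows "z \<in> centre G"
  unfolding centre_def using assms by blast

lemma centre_left_commutes:
  "z \<in> centre G \<Longrightarrow> x \<in> carrier G \<Longrightarrow> y \<in> carrier G \<Longrightarrow> x \<otimes> (z \<otimes> y) = z \<otimes> (x \<otimes> y)"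
  using centre_commutes[of z x] centre_closed[of z] by (simp add: m_assoc[symmetric])

lemma subgroup_centre: "subgroup (centre G) G"
proof
  show "x \<otimes> y \<in> centre G" if x: "x \<in> centre G" and y: "y \<in> centre G" for x y
  proof -
    have "x \<otimes> y \<otimes> u = u \<otimes> (x \<otimes> y)" if u: "u \<in> carrier G" for u
      using centre_commutes[OF y u] centre_left_commutes[OF x u centre_closed[OF y]] x y u
      by (simp add: centre_closed m_assoc)
    with centre_closed[OF x] centre_closed[OF y] show ?thesis by (intro centreI m_closed)
  qed
  show "inv x \<in> centre G" if x: "x \<in> centre G" for x
  proof -
    have "inv x \<otimes> u = u \<otimes> inv x" if u: "u \<in> carrier G" for u
    proof -
      have "inv x \<otimes> u = inv x \<otimes> (u \<otimes> x) \<otimes> inv x"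
        using centre_closed[OF x] u by (simp add: m_assoc)
      also have "\<dots> = u \<otimes> inv x"
        using centre_closed[OF x] u by (simp add: centre_commutes[OF x u] inv_cancel_left)
      finally show ?thesis .
    qed
    with centre_closed[OF x] show ?thesis by (intro centreI inv_closed)
  qed
qed (auto intro: centreI centre_closed)

lemma auto_centre:
  assumes \<alpha>: "\<alpha> \<in> auto G" and z: "z \<in> centre G"
  shows "\<alpha> z \<in> centre G"
proof -
  note c = centre_closed[OF z]
  have "\<alpha> z \<otimes> u = u \<otimes> \<alpha> z" if u: "u \<in> carrier G" for u
  proof -
    let ?v = "(inv\<^bsub>AutoGroup G\<^esub> \<alpha>) u"
    have v: "?v \<in> carrier G" "\<alpha> ?v = u" using \<alpha> u by (simp_all add: auto_simps)
    show ?thesis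
      using centre_commutes[OF z v(1)] auto_mult[OF \<alpha> c v(1)] auto_mult[OF \<alpha> v(1) c] v(2) by simp
  qed
  with auto_closed[OF \<alpha> c] show ?thesis by (rule centreI)
qed

text \<open>
Two lifts of an outer automorphism differ by a conjugation, which is trivial on the centre, so the
arbitrary choice in \<open>centre_act\<close> does not matter.
\<close>

lemma centre_act_eq:
  assumes \<phi>: "\<phi> \<in> auto G" and "out_class G \<phi> = \<omega> h" and z: "z \<in> centre G"
  shows "centre_act \<omega> h z = \<phi> z"
proof -
  have "\<phi> \<in> \<omega> h" using out_class_self[OF \<phi>] assms(2) by simp
  then have "(SOME \<alpha>. \<alpha> \<in> \<omega> h) \<in> out_class G \<phi>"
    unfolding assms(2) by (rule someI[of "\<lambda>\<alpha>. \<alpha> \<in> \<omega> h"])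
  then obtain n where n: "n \<in> carrier G"
    and eq: "\<forall>x\<in>carrier G. (SOME \<alpha>. \<alpha> \<in> \<omega> h) x = n \<otimes> \<phi> x \<otimes> inv n"
    using mem_out_class_iff[OF \<phi>] by blast
  have "(SOME \<alpha>. \<alpha> \<in> \<omega> h) z = n \<otimes> \<phi> z \<otimes> inv n"
    using eq centre_closed[OF z] by simp
  also have "\<dots> = \<phi> z"
    using n centre_commutes[OF auto_centre[OF \<phi> z] n] centre_closed[OF auto_centre[OF \<phi> z]]
    by (simp add: m_assoc)
  finally show ?thesis by (simp add: centre_act_def)
qed

end

section \<open>Factor sets\<close>

text \<open>
The short five lemma: a homomorphism of middle groups compatible with both ends is bijective, so
equivalences may be given by explicit formulas without exhibiting an inverse.
\<close>

lemma ext_relI: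
  assumes E: "is_extension N H E" and E': "is_extension N H E'" and "group N" "group H"
    and \<theta>: "\<theta> \<in> hom (middle E) (middle E')"
    and i: "\<And>n. n \<in> carrier N \<Longrightarrow> \<theta> (incl E n) = incl E' n"
    and p: "\<And>g. g \<in> carrier (middle E) \<Longrightarrow> projn E' (\<theta> g) = projn E g"
  shows "(E, E') \<in> ext_rel N H"
proof -
  interpret N: group N by fact
  interpret H: group H by fact
  interpret G: group "middle E" by (rule is_extensionD(1)[OF E])
  interpret G': group "middle E'" by (rule is_extensionD(1)[OF E'])
  interpret t: group_hom "middle E" "middle E'" \<theta> using \<theta> by unfold_locales
  interpret i: group_hom N "middle E" "incl E" using is_extensionD(2)[OF E] by unfold_locales
  interpret i': group_hom N "middle E'" "incl E'" using is_extensionD(2)[OF E'] by unfold_locales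
  interpret p': group_hom "middle E'" H "projn E'" using is_extensionD(4)[OF E'] by unfold_locales
  have "inj_on \<theta> (carrier (middle E))"
    unfolding t.inj_on_one_iff
  proof (intro allI impI)
    fix x assume x: "x \<in> carrier (middle E)" and "\<theta> x = \<one>\<^bsub>middle E'\<^esub>"
    then have "projn E x = \<one>\<^bsub>H\<^esub>" using p[OF x] by simp
    then obtain n where n: "n \<in> carrier N" "x = incl E n"
      using x is_extensionD(6)[OF E] by blast
    then have "incl E' n = incl E' \<one>\<^bsub>N\<^esub>" using i \<open>\<theta> x = \<one>\<^bsub>middle E'\<^esub>\<close> by simp
    then show "x = \<one>\<^bsub>middle E\<^esub>" using n inj_onD[OF is_extensionD(3)[OF E']] by fastforce
  qed
  moreover have "y \<in> \<theta> ` carrier (middle E)" if y: "y \<in> carrier (middle E')" for y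
  proof -
    have "projn E' y \<in> projn E ` carrier (middle E)"
      using y is_extensionD(5)[OF E] by simp
    then obtain x where x: "x \<in> carrier (middle E)" "projn E x = projn E' y" by auto
    have "y \<otimes>\<^bsub>middle E'\<^esub> inv\<^bsub>middle E'\<^esub> (\<theta> x) \<in> incl E' ` carrier N"
      unfolding is_extensionD(6)[OF E'] using x y by (simp add: p)
    then obtain n where n: "n \<in> carrier N" "incl E' n = y \<otimes>\<^bsub>middle E'\<^esub> inv\<^bsub>middle E'\<^esub> (\<theta> x)"
      by auto
    then have "y = \<theta> (incl E n \<otimes>\<^bsub>middle E\<^esub> x)"
      using x y i by (simp add: G'.m_assoc)
    then show ?thesis by (rule image_eqI) (use n x in simp)
  qed
  ultimately have "\<theta> \<in> iso (middle E) (middle E')"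
    using \<theta> by (auto simp: iso_def bij_betw_def)
  then show ?thesis using E E' i p by (auto simp: ext_rel_def)
qed

text \<open>
Schreier's conditions on \<open>(\<phi>, f)\<close>: normalisation, the failure of \<open>\<phi>\<close> to be multiplicative
is conjugation by \<open>f\<close>, and the cocycle identity of a nonabelian 2-cocycle. The conjugation condition
is written without inverses, the form in which it occurs in the computations.
\<close>

definition factor_set ::
  "('n, 'a) monoid_scheme \<Rightarrow> ('h, 'b) monoid_scheme \<Rightarrow> ('h \<Rightarrow> 'n \<Rightarrow> 'n) \<Rightarrow> ('h \<times> 'h \<Rightarrow> 'n) \<Rightarrow> bool" where
  "factor_set N H \<phi> f \<longleftrightarrow>
     \<phi> \<in> carrier H \<rightarrow> auto N \<and> f \<in> carrier H \<times> carrier H \<rightarrow> carrier N \<and>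
     (\<forall>h\<in>carrier H. f (\<one>\<^bsub>H\<^esub>, h) = \<one>\<^bsub>N\<^esub> \<and> f (h, \<one>\<^bsub>H\<^esub>) = \<one>\<^bsub>N\<^esub>) \<and>
     (\<forall>g\<in>carrier H. \<forall>h\<in>carrier H. \<forall>x\<in>carrier N.
        \<phi> g (\<phi> h x) \<otimes>\<^bsub>N\<^esub> f (g, h) = f (g, h) \<otimes>\<^bsub>N\<^esub> \<phi> (g \<otimes>\<^bsub>H\<^esub> h) x) \<and>
     (\<forall>g\<in>carrier H. \<forall>h\<in>carrier H. \<forall>k\<in>carrier H.
        \<phi> g (f (h, k)) \<otimes>\<^bsub>N\<^esub> f (g, h \<otimes>\<^bsub>H\<^esub> k) = f (g, h) \<otimes>\<^bsub>N\<^esub> f (g \<otimes>\<^bsub>H\<^esub> h, k))"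

lemma crossed_ext_simps:
  "carrier (middle (crossed_ext N H \<phi> f)) = carrier N \<times> carrier H"
  "(a, g) \<otimes>\<^bsub>middle (crossed_ext N H \<phi> f)\<^esub> (b, h) = (a \<otimes>\<^bsub>N\<^esub> \<phi> g b \<otimes>\<^bsub>N\<^esub> f (g, h), g \<otimes>\<^bsub>H\<^esub> h)"
  "\<one>\<^bsub>middle (crossed_ext N H \<phi> f)\<^esub> = (\<one>\<^bsub>N\<^esub>, \<one>\<^bsub>H\<^esub>)"
  "incl (crossed_ext N H \<phi> f) a = (a, \<one>\<^bsub>H\<^esub>)"
  "projn (crossed_ext N H \<phi> f) x = snd x"
  by (simp_all add: crossed_ext_def)

locale group_pair = N: group N + H: group H
  for N :: "('n, 'a) monoid_scheme" (structure) and H :: "('h, 'b) monoid_scheme"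
begin

lemma factor_setD:
  assumes "factor_set N H \<phi> f"
  shows "\<And>h. h \<in> carrier H \<Longrightarrow> \<phi> h \<in> auto N"
    and "\<And>g h. g \<in> carrier H \<Longrightarrow> h \<in> carrier H \<Longrightarrow> f (g, h) \<in> carrier N"
    and "\<And>h. h \<in> carrier H \<Longrightarrow> f (\<one>\<^bsub>H\<^esub>, h) = \<one>" "\<And>h. h \<in> carrier H \<Longrightarrow> f (h, \<one>\<^bsub>H\<^esub>) = \<one>"
    and "\<And>g h x. g \<in> carrier H \<Longrightarrow> h \<in> carrier H \<Longrightarrow> x \<in> carrier N \<Longrightarrow>
      \<phi> g (\<phi> h x) \<otimes> f (g, h) = f (g, h) \<otimes> \<phi> (g \<otimes>\<^bsub>H\<^esub> h) x"
    and "\<And>g h k. g \<in> carrier H \<Longrightarrow> h \<in> carrier H \<Longrightarrow> k \<in> carrier H \<Longrightarrow>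
      \<phi> g (f (h, k)) \<otimes> f (g, h \<otimes>\<^bsub>H\<^esub> k) = f (g, h) \<otimes> f (g \<otimes>\<^bsub>H\<^esub> h, k)"
    and "\<And>x. x \<in> carrier N \<Longrightarrow> \<phi> \<one>\<^bsub>H\<^esub> x = x"
proof -
  show \<phi>: "\<phi> h \<in> auto N" if "h \<in> carrier H" for h
    using assms that by (auto simp: factor_set_def)
  show "f (g, h) \<in> carrier N" if "g \<in> carrier H" "h \<in> carrier H" for g h
    using assms that by (auto simp: factor_set_def)
  show one: "f (\<one>\<^bsub>H\<^esub>, h) = \<one>" "f (h, \<one>\<^bsub>H\<^esub>) = \<one>" if "h \<in> carrier H" for h
    using assms that by (auto simp: factor_set_def)
  show comp: "\<phi> g (\<phi> h x) \<otimes> f (g, h) = f (g, h) \<otimes> \<phi> (g \<otimes>\<^bsub>H\<^esub> h) x"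
    if "g \<in> carrier H" "h \<in> carrier H" "x \<in> carrier N" for g h x
    using assms that by (simp add: factor_set_def)
  show "\<phi> g (f (h, k)) \<otimes> f (g, h \<otimes>\<^bsub>H\<^esub> k) = f (g, h) \<otimes> f (g \<otimes>\<^bsub>H\<^esub> h, k)"
    if "g \<in> carrier H" "h \<in> carrier H" "k \<in> carrier H" for g h k
    using assms that by (simp add: factor_set_def)
  show "\<phi> \<one>\<^bsub>H\<^esub> x = x" if x: "x \<in> carrier N" for x
  proof -
    have "\<phi> \<one>\<^bsub>H\<^esub> (\<phi> \<one>\<^bsub>H\<^esub> x) = \<phi> \<one>\<^bsub>H\<^esub> x"
      using comp[of "\<one>\<^bsub>H\<^esub>" "\<one>\<^bsub>H\<^esub>" x] \<phi>[of "\<one>\<^bsub>H\<^esub>"] x by (simp add: one N.auto_closed)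
    then show ?thesis
      using autoD(2)[OF \<phi>[OF H.one_closed]] N.auto_closed[OF \<phi>[OF H.one_closed] x] x
      by (auto simp: bij_betw_def inj_on_def)
  qed
qed

lemma factor_set_extension:
  assumes fs: "factor_set N H \<phi> f"
  shows "is_extension N H (crossed_ext N H \<phi> f)"
proof -
  let ?E = "crossed_ext N H \<phi> f"
  note fsD = factor_setD[OF fs]
  have grp: "group (middle ?E)"
  proof (rule groupI)
    fix x y z assume xyz: "x \<in> carrier (middle ?E)" "y \<in> carrier (middle ?E)" "z \<in> carrier (middle ?E)"
    obtain a g where x: "x = (a, g)" by (cases x)
    obtain b h where y: "y = (b, h)" by (cases y)
    obtain c k where z: "z = (c, k)" by (cases z)
    have mem: "a \<in> carrier N" "b \<in> carrier N" "c \<in> carrier N"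
      "g \<in> carrier H" "h \<in> carrier H" "k \<in> carrier H"
      using xyz by (simp_all add: x y z crossed_ext_simps)
    note cl = mem fsD(1,2) N.auto_closed
    have "a \<otimes> \<phi> g (b \<otimes> \<phi> h c \<otimes> f (h, k)) \<otimes> f (g, h \<otimes>\<^bsub>H\<^esub> k)
        = a \<otimes> \<phi> g b \<otimes> \<phi> g (\<phi> h c) \<otimes> (\<phi> g (f (h, k)) \<otimes> f (g, h \<otimes>\<^bsub>H\<^esub> k))"
      by (simp add: cl N.auto_mult N.m_assoc)
    also have "\<dots> = a \<otimes> \<phi> g b \<otimes> (\<phi> g (\<phi> h c) \<otimes> f (g, h)) \<otimes> f (g \<otimes>\<^bsub>H\<^esub> h, k)"
      by (simp add: cl fsD(6) N.m_assoc)
    also have "\<dots> = a \<otimes> \<phi> g b \<otimes> f (g, h) \<otimes> \<phi> (g \<otimes>\<^bsub>H\<^esub> h) c \<otimes> f (g \<otimes>\<^bsub>H\<^esub> h, k)"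
      by (simp add: cl fsD(5) N.m_assoc)
    finally show "x \<otimes>\<^bsub>middle ?E\<^esub> y \<otimes>\<^bsub>middle ?E\<^esub> z = x \<otimes>\<^bsub>middle ?E\<^esub> (y \<otimes>\<^bsub>middle ?E\<^esub> z)"
      by (simp add: x y z crossed_ext_simps cl H.m_assoc)
  next
    fix x assume "x \<in> carrier (middle ?E)"
    then obtain a g where x: "x = (a, g)" "a \<in> carrier N" "g \<in> carrier H"
      by (auto simp: crossed_ext_simps)
    note cl = x(2,3) fsD(1,2) N.auto_closed
    show "\<exists>y\<in>carrier (middle ?E). y \<otimes>\<^bsub>middle ?E\<^esub> x = \<one>\<^bsub>middle ?E\<^esub>"
    proof
      let ?y = "(inv (\<phi> (inv\<^bsub>H\<^esub> g) a \<otimes> f (inv\<^bsub>H\<^esub> g, g)), inv\<^bsub>H\<^esub> g)"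
      show "?y \<in> carrier (middle ?E)" by (simp add: crossed_ext_simps cl)
      show "?y \<otimes>\<^bsub>middle ?E\<^esub> x = \<one>\<^bsub>middle ?E\<^esub>"
        by (simp add: x(1) crossed_ext_simps cl N.m_assoc)
    qed
  qed (auto simp: crossed_ext_simps fsD(1,2,3,7) N.auto_closed)
  have "incl ?E \<in> mon N (middle ?E)"
    by (auto simp: mon_def hom_def inj_on_def crossed_ext_simps fsD(3,7))
  moreover have "projn ?E \<in> epi (middle ?E) H"
    by (force simp: epi_def hom_def crossed_ext_simps image_iff)
  moreover have "incl ?E ` carrier N = kernel (middle ?E) H (projn ?E)"
    by (auto simp: kernel_def crossed_ext_simps image_iff)
  ultimately show ?thesis using grp by (simp add: is_extension_def)
qed

text \<open>
The neutrality of \<open>(\<one>, \<one>)\<close> gives the normalisation. Associativity for the elements \<open>(\<one>, g)\<close>,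
\<open>(\<one>, h)\<close>, \<open>(c, k)\<close> contains both other conditions, as the cases \<open>k = \<one>\<close> and
\<open>c = \<one>\<close>.
\<close>

lemma extension_factor_set:
  assumes E: "is_extension N H (crossed_ext N H \<phi> f)"
    and \<phi>: "\<phi> \<in> carrier H \<rightarrow> auto N" and f: "f \<in> carrier H \<times> carrier H \<rightarrow> carrier N"
  shows "factor_set N H \<phi> f"
proof -
  let ?G = "middle (crossed_ext N H \<phi> f)"
  interpret G: group ?G by (rule is_extensionD(1)[OF E])
  have cl: "\<phi> h \<in> auto N" "f (g, h) \<in> carrier N" if "g \<in> carrier H" "h \<in> carrier H" for g h
    using \<phi> f that by auto
  have "f (\<one>\<^bsub>H\<^esub>, h) = \<one> \<and> f (h, \<one>\<^bsub>H\<^esub>) = \<one>" if h: "h \<in> carrier H" for h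
    using G.l_one[of "(\<one>, h)"] G.r_one[of "(\<one>, h)"] h
    by (simp add: crossed_ext_simps cl N.auto_one)
  note one = conjunct1[OF this] conjunct2[OF this]
  have assoc: "\<phi> g (\<phi> h c \<otimes> f (h, k)) \<otimes> f (g, h \<otimes>\<^bsub>H\<^esub> k)
      = f (g, h) \<otimes> \<phi> (g \<otimes>\<^bsub>H\<^esub> h) c \<otimes> f (g \<otimes>\<^bsub>H\<^esub> h, k)"
    if "g \<in> carrier H" "h \<in> carrier H" "k \<in> carrier H" "c \<in> carrier N" for g h k c
    using G.m_assoc[of "(\<one>, g)" "(\<one>, h)" "(c, k)"] that
    by (simp add: crossed_ext_simps cl N.auto_one N.auto_closed)
  have comp: "\<phi> g (\<phi> h x) \<otimes> f (g, h) = f (g, h) \<otimes> \<phi> (g \<otimes>\<^bsub>H\<^esub> h) x"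
    if "g \<in> carrier H" "h \<in> carrier H" "x \<in> carrier N" for g h x
    using assoc[of g h "\<one>\<^bsub>H\<^esub>" x] that by (simp add: cl one N.auto_closed)
  have coc: "\<phi> g (f (h, k)) \<otimes> f (g, h \<otimes>\<^bsub>H\<^esub> k) = f (g, h) \<otimes> f (g \<otimes>\<^bsub>H\<^esub> h, k)"
    if "g \<in> carrier H" "h \<in> carrier H" "k \<in> carrier H" for g h k
    using assoc[of g h k \<one>] that by (simp add: cl N.auto_one)
  show ?thesis unfolding factor_set_def by (intro conjI ballI \<phi> f one comp coc)
qed

lemma conj_aut_crossed:
  assumes fs: "factor_set N H \<phi> f" and h: "h \<in> carrier H"
  shows "conj_aut N (crossed_ext N H \<phi> f) (\<one>, h) = \<phi> h"
proof -
  let ?E = "crossed_ext N H \<phi> f"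
  note fsD = factor_setD[OF fs] and E = factor_set_extension[OF fs]
  interpret G: group "middle ?E" by (rule is_extensionD(1)[OF E])
  have g: "(\<one>, h) \<in> carrier (middle ?E)" using h by (simp add: crossed_ext_simps)
  show ?thesis
  proof (rule N.auto_eqI[OF conj_aut_auto[OF N.group_axioms H.group_axioms E g] fsD(1)[OF h]])
    fix x assume x: "x \<in> carrier N"
    have "incl ?E (\<phi> h x) \<otimes>\<^bsub>middle ?E\<^esub> (\<one>, h) = (\<one>, h) \<otimes>\<^bsub>middle ?E\<^esub> incl ?E x"
      using h x by (simp add: crossed_ext_simps fsD N.auto_simps)
    then have "incl ?E (\<phi> h x)
        = (\<one>, h) \<otimes>\<^bsub>middle ?E\<^esub> incl ?E x \<otimes>\<^bsub>middle ?E\<^esub> inv\<^bsub>middle ?E\<^esub> (\<one>, h)"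
      using h x by (intro G.inv_solve_right[THEN iffD2]) (simp_all add: crossed_ext_simps fsD N.auto_closed)
    then show "conj_aut N ?E (\<one>, h) x = \<phi> h x"
      using x h fsD(1) by (intro conj_aut_eqI[OF E]) (simp_all add: N.auto_closed)
  qed
qed

lemma coupling_crossed:
  assumes fs: "factor_set N H \<phi> f" and h: "h \<in> carrier H"
  shows "coupling N H (crossed_ext N H \<phi> f) h = out_class N (\<phi> h)"
  using coupling_section[OF N.group_axioms H.group_axioms factor_set_extension[OF fs], of "(\<one>, h)"] h
  by (simp add: conj_aut_crossed[OF fs h] crossed_ext_simps)

text \<open>
An equivalence is the identity on \<open>N\<close> and on \<open>H\<close>, so it has the form
\<open>(a, g) \<mapsto> (a \<cdot> m g, g)\<close>; it moves the standard section \<open>g \<mapsto> (\<one>, g)\<close> by \<open>m\<close>.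
Being multiplicative on the products \<open>(\<one>, g) (x, \<one>)\<close> and \<open>(\<one>, g) (\<one>, h)\<close>
is the pair of conditions on \<open>m\<close>, and multiplicativity on all other products follows.
\<close>

lemma crossed_rel_iff:
  assumes fs: "factor_set N H \<phi> f" and fs': "factor_set N H \<phi>' f'"
  shows "(crossed_ext N H \<phi> f, crossed_ext N H \<phi>' f') \<in> ext_rel N H \<longleftrightarrow>
    (\<exists>m\<in>carrier H \<rightarrow> carrier N.
      (\<forall>g\<in>carrier H. \<forall>x\<in>carrier N. \<phi> g x \<otimes> m g = m g \<otimes> \<phi>' g x) \<and>
      (\<forall>g\<in>carrier H. \<forall>h\<in>carrier H.
        f (g, h) \<otimes> m (g \<otimes>\<^bsub>H\<^esub> h) = m g \<otimes> \<phi>' g (m h) \<otimes> f' (g, h)))" (is "?L \<longleftrightarrow> ?R")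
proof
  let ?E = "crossed_ext N H \<phi> f" and ?E' = "crossed_ext N H \<phi>' f'"
  note fsD = factor_setD[OF fs] and fsD' = factor_setD[OF fs']
  note E = factor_set_extension[OF fs] and E' = factor_set_extension[OF fs']
  {
    assume ?L
    then obtain \<theta> where \<theta>: "\<theta> \<in> iso (middle ?E) (middle ?E')"
      and i: "\<And>n. n \<in> carrier N \<Longrightarrow> \<theta> (n, \<one>\<^bsub>H\<^esub>) = (n, \<one>\<^bsub>H\<^esub>)"
      and p: "\<And>x. x \<in> carrier N \<times> carrier H \<Longrightarrow> snd (\<theta> x) = snd x"
      by (auto simp: ext_rel_def crossed_ext_simps)
    have closed: "\<theta> x \<in> carrier N \<times> carrier H" if "x \<in> carrier N \<times> carrier H" for x
      using \<theta> that by (auto simp: iso_def hom_def crossed_ext_simps)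
    have mult: "\<theta> (x \<otimes>\<^bsub>middle ?E\<^esub> y) = \<theta> x \<otimes>\<^bsub>middle ?E'\<^esub> \<theta> y"
      if "x \<in> carrier N \<times> carrier H" "y \<in> carrier N \<times> carrier H" for x y
      using \<theta> that by (auto simp: iso_def hom_def crossed_ext_simps(1))
    define m where "m h = fst (\<theta> (\<one>, h))" for h
    have m: "m h \<in> carrier N" "\<theta> (\<one>, h) = (m h, h)" if "h \<in> carrier H" for h
      using closed[of "(\<one>, h)"] p[of "(\<one>, h)"] that
      by (auto simp: m_def prod_eq_iff mem_Times_iff)
    have \<theta>_eq: "\<theta> (a, g) = (a \<otimes> m g, g)" if "a \<in> carrier N" "g \<in> carrier H" for a g
      using mult[of "(a, \<one>\<^bsub>H\<^esub>)" "(\<one>, g)"] that m(1)[OF that(2)]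
      by (simp add: crossed_ext_simps fsD fsD' m(2) i)
    have m1: "m \<one>\<^bsub>H\<^esub> = \<one>" by (simp add: m_def i)
    have "\<phi> g x \<otimes> m g = m g \<otimes> \<phi>' g x" if "g \<in> carrier H" "x \<in> carrier N" for g x
      using mult[of "(\<one>, g)" "(x, \<one>\<^bsub>H\<^esub>)"] that m(1)[OF that(1)]
      by (simp add: crossed_ext_simps fsD fsD' m(2) m1 i \<theta>_eq N.auto_closed)
    moreover have "f (g, h) \<otimes> m (g \<otimes>\<^bsub>H\<^esub> h) = m g \<otimes> \<phi>' g (m h) \<otimes> f' (g, h)"
      if "g \<in> carrier H" "h \<in> carrier H" for g h
      using mult[of "(\<one>, g)" "(\<one>, h)"] that m(1)[OF that(1)] m(1)[OF that(2)]
      by (simp add: crossed_ext_simps fsD fsD' m(2) \<theta>_eq N.auto_one)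
    ultimately show ?R using m(1) by (intro bexI[of _ m]) auto
  next
    assume ?R
    then obtain m where mH: "m \<in> carrier H \<rightarrow> carrier N"
      and mx: "\<And>g x. g \<in> carrier H \<Longrightarrow> x \<in> carrier N \<Longrightarrow> \<phi> g x \<otimes> m g = m g \<otimes> \<phi>' g x"
      and mf: "\<And>g h. g \<in> carrier H \<Longrightarrow> h \<in> carrier H \<Longrightarrow>
        f (g, h) \<otimes> m (g \<otimes>\<^bsub>H\<^esub> h) = m g \<otimes> \<phi>' g (m h) \<otimes> f' (g, h)"
      by blast
    have m: "m g \<in> carrier N" if "g \<in> carrier H" for g using mH that by auto
    have m1: "m \<one>\<^bsub>H\<^esub> = \<one>"
      using mf[of "\<one>\<^bsub>H\<^esub>" "\<one>\<^bsub>H\<^esub>"] m[of "\<one>\<^bsub>H\<^esub>"] by (simp add: fsD fsD')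
    define \<theta> where "\<theta> = (\<lambda>(a, g). (a \<otimes> m g, g))"
    have "\<theta> \<in> hom (middle ?E) (middle ?E')"
    proof (rule homI)
      fix x y assume "x \<in> carrier (middle ?E)" "y \<in> carrier (middle ?E)"
      then obtain a g b h where x: "x = (a, g)" and y: "y = (b, h)"
        and mem: "a \<in> carrier N" "g \<in> carrier H" "b \<in> carrier N" "h \<in> carrier H"
        by (auto simp: crossed_ext_simps)
      note cl = mem m fsD(1,2) fsD'(1,2) N.auto_closed
      have "a \<otimes> \<phi> g b \<otimes> f (g, h) \<otimes> m (g \<otimes>\<^bsub>H\<^esub> h)
          = a \<otimes> (\<phi> g b \<otimes> m g) \<otimes> \<phi>' g (m h) \<otimes> f' (g, h)"
        using mf[of g h] by (simp add: cl N.m_assoc)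
      also have "\<dots> = a \<otimes> m g \<otimes> \<phi>' g (b \<otimes> m h) \<otimes> f' (g, h)"
        by (simp add: cl mx N.auto_mult N.m_assoc)
      finally show "\<theta> (x \<otimes>\<^bsub>middle ?E\<^esub> y) = \<theta> x \<otimes>\<^bsub>middle ?E'\<^esub> \<theta> y"
        by (simp add: x y \<theta>_def crossed_ext_simps)
    qed (auto simp: \<theta>_def crossed_ext_simps m)
    then show ?L
      by (rule ext_relI[OF E E' N.group_axioms H.group_axioms])
        (auto simp: \<theta>_def crossed_ext_simps m1)
  }
qed

text \<open>
The lift \<open>\<phi>\<close> of the coupling can be prescribed: any element over \<open>h\<close> acts on \<open>N\<close> by
\<open>\<phi> h\<close> up to an inner automorphism, and multiplying it by a suitable element of \<open>N\<close> removes the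
inner automorphism. The section \<open>s\<close> so obtained yields the factor set \<open>f\<close> through
\<open>s g \<cdot> s h = f (g, h) \<cdot> s (g h)\<close>, and \<open>(a, g) \<mapsto> a \<cdot> s g\<close> is the equivalence.
Prescribing \<open>\<phi>\<close> is what later allows two extensions with the same coupling to be compared by a
cocycle.
\<close>

lemma extension_crossed:
  assumes E: "is_extension N H E" and \<phi>: "\<And>h. h \<in> carrier H \<Longrightarrow> \<phi> h \<in> auto N"
    and \<phi>1: "\<And>x. x \<in> carrier N \<Longrightarrow> \<phi> \<one>\<^bsub>H\<^esub> x = x"
    and lift: "\<And>h. h \<in> carrier H \<Longrightarrow> out_class N (\<phi> h) = coupling N H E h"
  obtains f where "factor_set N H \<phi> f" "(crossed_ext N H \<phi> f, E) \<in> ext_rel N H"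
proof -
  let ?G = "middle E"
  interpret G: group ?G by (rule is_extensionD(1)[OF E])
  interpret i: group_hom N ?G "incl E" using is_extensionD(2)[OF E] by unfold_locales
  interpret p: group_hom ?G H "projn E" using is_extensionD(4)[OF E] by unfold_locales
  note conj = incl_conj_aut[OF N.group_axioms H.group_axioms E]
  have incl_eqD: "x = y" if "x \<in> carrier N" "y \<in> carrier N" "incl E x = incl E y" for x y
    using is_extensionD(3)[OF E] that by (auto simp: inj_on_def)
  have p_incl: "projn E (incl E x) = \<one>\<^bsub>H\<^esub>" if "x \<in> carrier N" for x
    using is_extensionD(6)[OF E] that by blast
  have "\<exists>s\<in>carrier ?G. projn E s = h \<and> (\<forall>x\<in>carrier N. incl E (\<phi> h x) \<otimes>\<^bsub>?G\<^esub> s = s \<otimes>\<^bsub>?G\<^esub> incl E x)"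
    if h: "h \<in> carrier H" for h
  proof -
    obtain g where g: "g \<in> carrier ?G" "projn E g = h"
      using h is_extensionD(5)[OF E] by (metis imageE)
    have "out_class N (\<phi> h) = out_class N (conj_aut N E g)"
      using coupling_section[OF N.group_axioms H.group_axioms E g(1)] lift[OF h] g(2) by simp
    then obtain n where n: "n \<in> carrier N"
      and \<phi>n: "\<And>x. x \<in> carrier N \<Longrightarrow> \<phi> h x = n \<otimes> conj_aut N E g x \<otimes> inv n"
      using N.out_class_eq_iff[OF \<phi>[OF h] conj_aut_auto[OF N.group_axioms H.group_axioms E g(1)]]
      by blast
    have "incl E (\<phi> h x) \<otimes>\<^bsub>?G\<^esub> (incl E n \<otimes>\<^bsub>?G\<^esub> g) = incl E n \<otimes>\<^bsub>?G\<^esub> g \<otimes>\<^bsub>?G\<^esub> incl E x"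
      if x: "x \<in> carrier N" for x
      using n g(1) x by (simp add: \<phi>n conj G.m_assoc G.inv_cancel_left)
    then show ?thesis
      using n g p_incl by (intro bexI[of _ "incl E n \<otimes>\<^bsub>?G\<^esub> g"]) auto
  qed
  then obtain s0 where s0: "\<And>h. h \<in> carrier H \<Longrightarrow> s0 h \<in> carrier ?G \<and> projn E (s0 h) = h \<and>
      (\<forall>x\<in>carrier N. incl E (\<phi> h x) \<otimes>\<^bsub>?G\<^esub> s0 h = s0 h \<otimes>\<^bsub>?G\<^esub> incl E x)"
    by metis
  \<comment> \<open>Resetting the value at \<open>\<one>\<close> keeps the section compatible with \<open>\<phi>\<close>, which is trivial there.\<close>
  define s where "s h = (if h = \<one>\<^bsub>H\<^esub> then \<one>\<^bsub>?G\<^esub> else s0 h)" for h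
  have s: "s h \<in> carrier ?G" "projn E (s h) = h" if "h \<in> carrier H" for h
    using s0[OF that] by (simp_all add: s_def)
  have s\<phi>: "incl E (\<phi> h x) \<otimes>\<^bsub>?G\<^esub> s h = s h \<otimes>\<^bsub>?G\<^esub> incl E x" if "h \<in> carrier H" "x \<in> carrier N" for h x
    using s0[OF that(1)] \<phi>1 that by (simp add: s_def)
  have s1: "s \<one>\<^bsub>H\<^esub> = \<one>\<^bsub>?G\<^esub>" by (simp add: s_def)
  have "\<exists>n\<in>carrier N. incl E n \<otimes>\<^bsub>?G\<^esub> s (g \<otimes>\<^bsub>H\<^esub> h) = s g \<otimes>\<^bsub>?G\<^esub> s h"
    if "g \<in> carrier H" "h \<in> carrier H" for g h
  proof -
    have "s g \<otimes>\<^bsub>?G\<^esub> s h \<otimes>\<^bsub>?G\<^esub> inv\<^bsub>?G\<^esub> (s (g \<otimes>\<^bsub>H\<^esub> h)) \<in> incl E ` carrier N"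
      unfolding is_extensionD(6)[OF E] using that by (simp add: s)
    then obtain n where "n \<in> carrier N"
      "incl E n = s g \<otimes>\<^bsub>?G\<^esub> s h \<otimes>\<^bsub>?G\<^esub> inv\<^bsub>?G\<^esub> (s (g \<otimes>\<^bsub>H\<^esub> h))" by auto
    then show ?thesis using that by (intro bexI[of _ n]) (simp_all add: s G.m_assoc)
  qed
  then obtain f0 where f0: "\<And>g h. g \<in> carrier H \<Longrightarrow> h \<in> carrier H \<Longrightarrow>
      f0 g h \<in> carrier N \<and> incl E (f0 g h) \<otimes>\<^bsub>?G\<^esub> s (g \<otimes>\<^bsub>H\<^esub> h) = s g \<otimes>\<^bsub>?G\<^esub> s h"
    by metis
  define f where "f = case_prod f0"
  have f: "f (g, h) \<in> carrier N"
    and fs: "incl E (f (g, h)) \<otimes>\<^bsub>?G\<^esub> s (g \<otimes>\<^bsub>H\<^esub> h) = s g \<otimes>\<^bsub>?G\<^esub> s h"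
    if "g \<in> carrier H" "h \<in> carrier H" for g h
    using f0[OF that] by (simp_all add: f_def)
  \<comment> \<open>The identities for \<open>f\<close> are checked in the middle group, after multiplication by a value of \<open>s\<close>.\<close>
  have eqI: "x = y" if "x \<in> carrier N" "y \<in> carrier N" "h \<in> carrier H"
    "incl E x \<otimes>\<^bsub>?G\<^esub> s h = incl E y \<otimes>\<^bsub>?G\<^esub> s h" for x y h
    using that by (intro incl_eqD) (simp_all add: s)
  note cl = \<phi> f s N.auto_closed
  have "factor_set N H \<phi> f"
    unfolding factor_set_def
  proof (intro conjI ballI)
    show "\<phi> \<in> carrier H \<rightarrow> auto N" "f \<in> carrier H \<times> carrier H \<rightarrow> carrier N"
      using \<phi> f by auto
    fix h assume h: "h \<in> carrier H"
    show "f (\<one>\<^bsub>H\<^esub>, h) = \<one>"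
      using h fs[of "\<one>\<^bsub>H\<^esub>" h] by (intro eqI[of _ _ h]) (simp_all add: cl s1)
    show "f (h, \<one>\<^bsub>H\<^esub>) = \<one>"
      using h fs[of h "\<one>\<^bsub>H\<^esub>"] by (intro eqI[of _ _ h]) (simp_all add: cl s1)
  next
    fix g h x assume mem: "g \<in> carrier H" "h \<in> carrier H" "x \<in> carrier N"
    have "incl E (\<phi> g (\<phi> h x) \<otimes> f (g, h)) \<otimes>\<^bsub>?G\<^esub> s (g \<otimes>\<^bsub>H\<^esub> h)
        = (incl E (\<phi> g (\<phi> h x)) \<otimes>\<^bsub>?G\<^esub> s g) \<otimes>\<^bsub>?G\<^esub> s h"
      using mem by (simp add: cl fs G.m_assoc)
    also have "\<dots> = s g \<otimes>\<^bsub>?G\<^esub> (incl E (\<phi> h x) \<otimes>\<^bsub>?G\<^esub> s h)"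
      using mem s\<phi>[of g "\<phi> h x"] by (simp add: cl G.m_assoc)
    also have "\<dots> = (incl E (f (g, h)) \<otimes>\<^bsub>?G\<^esub> s (g \<otimes>\<^bsub>H\<^esub> h)) \<otimes>\<^bsub>?G\<^esub> incl E x"
      using mem by (simp add: cl s\<phi> fs G.m_assoc)
    also have "\<dots> = incl E (f (g, h) \<otimes> \<phi> (g \<otimes>\<^bsub>H\<^esub> h) x) \<otimes>\<^bsub>?G\<^esub> s (g \<otimes>\<^bsub>H\<^esub> h)"
      using mem by (simp add: cl s\<phi> G.m_assoc)
    finally show "\<phi> g (\<phi> h x) \<otimes> f (g, h) = f (g, h) \<otimes> \<phi> (g \<otimes>\<^bsub>H\<^esub> h) x"
      using mem by (intro eqI[of _ _ "g \<otimes>\<^bsub>H\<^esub> h"]) (simp_all add: cl)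
  next
    fix g h k assume mem: "g \<in> carrier H" "h \<in> carrier H" "k \<in> carrier H"
    let ?ghk = "g \<otimes>\<^bsub>H\<^esub> (h \<otimes>\<^bsub>H\<^esub> k)"
    have "incl E (\<phi> g (f (h, k)) \<otimes> f (g, h \<otimes>\<^bsub>H\<^esub> k)) \<otimes>\<^bsub>?G\<^esub> s ?ghk
        = (incl E (\<phi> g (f (h, k))) \<otimes>\<^bsub>?G\<^esub> s g) \<otimes>\<^bsub>?G\<^esub> s (h \<otimes>\<^bsub>H\<^esub> k)"
      using mem by (simp add: cl fs G.m_assoc)
    also have "\<dots> = s g \<otimes>\<^bsub>?G\<^esub> (incl E (f (h, k)) \<otimes>\<^bsub>?G\<^esub> s (h \<otimes>\<^bsub>H\<^esub> k))"
      using mem by (simp add: cl s\<phi> G.m_assoc)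
    also have "\<dots> = (incl E (f (g, h)) \<otimes>\<^bsub>?G\<^esub> s (g \<otimes>\<^bsub>H\<^esub> h)) \<otimes>\<^bsub>?G\<^esub> s k"
      using mem by (simp add: cl fs G.m_assoc)
    also have "\<dots> = incl E (f (g, h)) \<otimes>\<^bsub>?G\<^esub> (incl E (f (g \<otimes>\<^bsub>H\<^esub> h, k)) \<otimes>\<^bsub>?G\<^esub> s (g \<otimes>\<^bsub>H\<^esub> h \<otimes>\<^bsub>H\<^esub> k))"
      unfolding fs[OF H.m_closed[OF mem(1,2)] mem(3)] using mem by (simp add: cl G.m_assoc)
    also have "\<dots> = incl E (f (g, h) \<otimes> f (g \<otimes>\<^bsub>H\<^esub> h, k)) \<otimes>\<^bsub>?G\<^esub> s ?ghk"
      using mem by (simp add: cl G.m_assoc H.m_assoc)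
    finally show "\<phi> g (f (h, k)) \<otimes> f (g, h \<otimes>\<^bsub>H\<^esub> k) = f (g, h) \<otimes> f (g \<otimes>\<^bsub>H\<^esub> h, k)"
      using mem by (intro eqI[of _ _ ?ghk]) (simp_all add: cl)
  qed
  moreover from this have "(crossed_ext N H \<phi> f, E) \<in> ext_rel N H"
  proof (rule ext_relI[OF factor_set_extension E N.group_axioms H.group_axioms])
    let ?\<theta> = "\<lambda>(a, g). incl E a \<otimes>\<^bsub>?G\<^esub> s g"
    show "?\<theta> \<in> hom (middle (crossed_ext N H \<phi> f)) ?G"
    proof (rule homI)
      fix x y
      assume "x \<in> carrier (middle (crossed_ext N H \<phi> f))" "y \<in> carrier (middle (crossed_ext N H \<phi> f))"
      then obtain a g b h where xy: "x = (a, g)" "y = (b, h)"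
        and mem: "a \<in> carrier N" "g \<in> carrier H" "b \<in> carrier N" "h \<in> carrier H"
        by (auto simp: crossed_ext_simps)
      have "incl E (a \<otimes> \<phi> g b \<otimes> f (g, h)) \<otimes>\<^bsub>?G\<^esub> s (g \<otimes>\<^bsub>H\<^esub> h)
          = incl E a \<otimes>\<^bsub>?G\<^esub> (incl E (\<phi> g b) \<otimes>\<^bsub>?G\<^esub> s g) \<otimes>\<^bsub>?G\<^esub> s h"
        using mem by (simp add: cl fs G.m_assoc)
      also have "\<dots> = incl E a \<otimes>\<^bsub>?G\<^esub> s g \<otimes>\<^bsub>?G\<^esub> (incl E b \<otimes>\<^bsub>?G\<^esub> s h)"
        using mem s\<phi>[of g b] by (simp add: cl G.m_assoc)
      finally show "?\<theta> (x \<otimes>\<^bsub>middle (crossed_ext N H \<phi> f)\<^esub> y) = ?\<theta> x \<otimes>\<^bsub>?G\<^esub> ?\<theta> y"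
        by (simp add: xy crossed_ext_simps)
    qed (auto simp: crossed_ext_simps cl)
  qed (auto simp: crossed_ext_simps cl s1 p_incl)
  ultimately show thesis by (rule that)
qed

end

section \<open>The action of the pairs of automorphisms\<close>

text \<open>
The effect of \<open>(\<alpha>, \<beta>)\<close> on the first component of a factor set; its effect on the second one is
\<open>act_cocycle\<close>.
\<close>

definition act_lift :: "('n, 'a) monoid_scheme \<Rightarrow> ('h, 'b) monoid_scheme \<Rightarrow>
    ('n \<Rightarrow> 'n) \<times> ('h \<Rightarrow> 'h) \<Rightarrow> ('h \<Rightarrow> 'n \<Rightarrow> 'n) \<Rightarrow> 'h \<Rightarrow> 'n \<Rightarrow> 'n" where
  "act_lift N H k \<phi> = (\<lambda>h. fst k \<otimes>\<^bsub>AutoGroup N\<^esub> \<phi> ((inv\<^bsub>AutoGroup H\<^esub> (snd k)) h)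
     \<otimes>\<^bsub>AutoGroup N\<^esub> inv\<^bsub>AutoGroup N\<^esub> (fst k))"

text \<open>
The choice of representative does not matter, as equivalent extensions have the same coupling.
\<close>

definition class_coupling :: "('n, 'a) monoid_scheme \<Rightarrow> ('h, 'b) monoid_scheme \<Rightarrow>
    ('n, 'h, 'n \<times> 'h) extension set \<Rightarrow> 'h \<Rightarrow> ('n \<Rightarrow> 'n) set" where
  "class_coupling N H X = coupling N H (SOME E. E \<in> X)"

context group_pair
begin

lemma carrier_K: "carrier (K N H) = auto N \<times> auto H"
  by (simp add: DirProd_def)

lemma group_K: "group (K N H)"
  by (rule DirProd_group[OF N.AutoGroup H.AutoGroup])

lemma mult_K: "k \<otimes>\<^bsub>K N H\<^esub> l = (fst k \<otimes>\<^bsub>AutoGroup N\<^esub> fst l, snd k \<otimes>\<^bsub>AutoGroup H\<^esub> snd l)"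
  by (simp add: DirProd_def case_prod_beta)

lemma one_K: "\<one>\<^bsub>K N H\<^esub> = (\<one>\<^bsub>AutoGroup N\<^esub>, \<one>\<^bsub>AutoGroup H\<^esub>)"
  by (simp add: DirProd_def)

text \<open>
Given \<open>\<theta>\<close> restricting to \<open>\<alpha>\<close> on \<open>N\<close>, elements of the middle group have the same image
in \<open>H\<close> if and only if their images under \<open>\<theta>\<close> do, since \<open>\<theta>\<close> maps the copy of
\<open>N\<close> onto the copy of \<open>N\<close>. So \<open>\<theta>\<close> induces an automorphism \<open>\<beta>\<close> of
\<open>H\<close>, and the same \<open>\<theta>\<close> is an equivalence after acting by \<open>(\<alpha>, \<beta>)\<close>.
\<close>

lemma virt_rel_iff:
  "(E, E') \<in> virt_rel N H \<longleftrightarrow> is_extension N H E \<and> is_extension N H E' \<and>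
    (\<exists>k\<in>carrier (K N H). (act_ext N H k E, E') \<in> ext_rel N H)"
proof (cases "is_extension N H E \<and> is_extension N H E'")
  case True
  then have E: "is_extension N H E" and E': "is_extension N H E'" by auto
  interpret G: group "middle E" by (rule is_extensionD(1)[OF E])
  interpret G': group "middle E'" by (rule is_extensionD(1)[OF E'])
  interpret i: group_hom N "middle E" "incl E" using is_extensionD(2)[OF E] by unfold_locales
  interpret i': group_hom N "middle E'" "incl E'" using is_extensionD(2)[OF E'] by unfold_locales
  interpret p: group_hom "middle E" H "projn E" using is_extensionD(4)[OF E] by unfold_locales
  interpret p': group_hom "middle E'" H "projn E'" using is_extensionD(4)[OF E'] by unfold_locales
  have "(\<exists>\<theta>\<in>iso (middle E) (middle E'). \<exists>\<alpha>\<in>auto N. \<forall>n\<in>carrier N. \<theta> (incl E n) = incl E' (\<alpha> n))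
    \<longleftrightarrow> (\<exists>k\<in>carrier (K N H). (act_ext N H k E, E') \<in> ext_rel N H)" (is "?L \<longleftrightarrow> ?R")
  proof
    assume ?L
    then obtain \<theta> \<alpha> where \<theta>: "\<theta> \<in> iso (middle E) (middle E')" and \<alpha>: "\<alpha> \<in> auto N"
      and \<theta>i: "\<And>n. n \<in> carrier N \<Longrightarrow> \<theta> (incl E n) = incl E' (\<alpha> n)" by blast
    interpret t: group_hom "middle E" "middle E'" \<theta>
      using \<theta> by unfold_locales (simp add: iso_def)
    have bij: "bij_betw \<theta> (carrier (middle E)) (carrier (middle E'))"
      using \<theta> by (simp add: iso_def)
    have ker: "projn E' (\<theta> g) = \<one>\<^bsub>H\<^esub> \<longleftrightarrow> projn E g = \<one>\<^bsub>H\<^esub>" if g: "g \<in> carrier (middle E)" for g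
    proof
      assume "projn E g = \<one>\<^bsub>H\<^esub>"
      then obtain n where n: "n \<in> carrier N" "g = incl E n" using g is_extensionD(6)[OF E] by blast
      then have "\<theta> g \<in> incl E' ` carrier N" using \<theta>i N.auto_closed[OF \<alpha>] by auto
      then show "projn E' (\<theta> g) = \<one>\<^bsub>H\<^esub>" using is_extensionD(6)[OF E'] by blast
    next
      assume "projn E' (\<theta> g) = \<one>\<^bsub>H\<^esub>"
      then obtain n where n: "n \<in> carrier N" "\<theta> g = incl E' n"
        using g t.hom_closed is_extensionD(6)[OF E'] by blast
      let ?m = "(inv\<^bsub>AutoGroup N\<^esub> \<alpha>) n"
      have m: "?m \<in> carrier N" "\<theta> (incl E ?m) = \<theta> g"
        using n \<theta>i \<alpha> by (simp_all add: N.auto_simps)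
      then have "g = incl E ?m"
        using bij g by (auto simp: bij_betw_def inj_on_def)
      then show "projn E g = \<one>\<^bsub>H\<^esub>" using m(1) is_extensionD(6)[OF E] by blast
    qed
    have eq_iff: "projn E' (\<theta> g) = projn E' (\<theta> g') \<longleftrightarrow> projn E g = projn E g'"
      if "g \<in> carrier (middle E)" "g' \<in> carrier (middle E)" for g g'
    proof -
      have "projn E' (\<theta> (g \<otimes>\<^bsub>middle E\<^esub> inv\<^bsub>middle E\<^esub> g')) = \<one>\<^bsub>H\<^esub>
          \<longleftrightarrow> projn E (g \<otimes>\<^bsub>middle E\<^esub> inv\<^bsub>middle E\<^esub> g') = \<one>\<^bsub>H\<^esub>"
        using that by (intro ker) simp
      then show ?thesis using that by (simp add: H.inv_solve_right')
    qed
    define s where "s = inv_into (carrier (middle E)) (projn E)"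
    have s: "s h \<in> carrier (middle E)" "projn E (s h) = h" if "h \<in> carrier H" for h
      using that is_extensionD(5)[OF E] by (auto simp: s_def inv_into_into f_inv_into_f)
    define \<beta> where "\<beta> = (\<lambda>h\<in>carrier H. projn E' (\<theta> (s h)))"
    have \<beta>_eq: "\<beta> (projn E g) = projn E' (\<theta> g)" if "g \<in> carrier (middle E)" for g
      using that s[of "projn E g"] by (simp add: \<beta>_def eq_iff)
    have "\<beta> \<in> hom H H"
    proof (rule homI)
      show "\<beta> (g \<otimes>\<^bsub>H\<^esub> h) = \<beta> g \<otimes>\<^bsub>H\<^esub> \<beta> h" if "g \<in> carrier H" "h \<in> carrier H" for g h
        using \<beta>_eq[of "s g \<otimes>\<^bsub>middle E\<^esub> s h"] \<beta>_eq[of "s g"] \<beta>_eq[of "s h"] that by (simp add: s)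
    qed (simp add: \<beta>_def s)
    moreover have "inj_on \<beta> (carrier H)"
      by (rule inj_onI) (metis \<beta>_eq eq_iff s)
    moreover have "carrier H \<subseteq> \<beta> ` carrier H"
    proof
      fix h assume "h \<in> carrier H"
      then obtain y where y: "y \<in> carrier (middle E')" "projn E' y = h"
        using is_extensionD(5)[OF E'] by (metis imageE)
      then obtain x where x: "x \<in> carrier (middle E)" "\<theta> x = y"
        using bij_betw_imp_surj_on[OF bij] by (metis imageE)
      show "h \<in> \<beta> ` carrier H"
        by (rule image_eqI[of _ _ "projn E x"]) (use x y \<beta>_eq in auto)
    qed
    ultimately have \<beta>: "\<beta> \<in> auto H"
      by (auto simp: auto_def Bij_def bij_betw_def hom_def) (simp add: \<beta>_def)
    have k: "(\<alpha>, \<beta>) \<in> carrier (K N H)" using \<alpha> \<beta> by (simp add: carrier_K)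
    have "(act_ext N H (\<alpha>, \<beta>) E, E') \<in> ext_rel N H"
    proof (rule ext_relI[OF act_ext_is_extension[OF N.group_axioms H.group_axioms k E] E'
        N.group_axioms H.group_axioms])
      show "\<theta> \<in> hom (middle (act_ext N H (\<alpha>, \<beta>) E)) (middle E')"
        using t.homh by (simp add: act_ext_def)
    qed (use \<alpha> in \<open>simp_all add: act_ext_def \<theta>i N.auto_simps \<beta>_eq\<close>)
    then show ?R using k by blast
  next
    assume ?R
    then obtain \<alpha> \<beta> where \<alpha>: "\<alpha> \<in> auto N" and r: "(act_ext N H (\<alpha>, \<beta>) E, E') \<in> ext_rel N H"
      by (auto simp: carrier_K)
    obtain \<theta> where \<theta>: "\<theta> \<in> iso (middle E) (middle E')"
      and \<theta>i: "\<And>n. n \<in> carrier N \<Longrightarrow> \<theta> (incl E ((inv\<^bsub>AutoGroup N\<^esub> \<alpha>) n)) = incl E' n"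
      using r by (auto simp: ext_rel_def act_ext_def)
    have "\<theta> (incl E n) = incl E' (\<alpha> n)" if "n \<in> carrier N" for n
      using \<theta>i[of "\<alpha> n"] \<alpha> that by (simp add: N.auto_simps)
    then show ?L using \<theta> \<alpha> by blast
  qed
  then show ?thesis using E E' by (simp add: virt_rel_def)
qed (auto simp: virt_rel_def)

lemma ext_class_eq_iff:
  "is_extension N H E \<Longrightarrow> is_extension N H E' \<Longrightarrow>
    ext_class N H E = ext_class N H E' \<longleftrightarrow> (E, E') \<in> ext_rel N H"
  unfolding ext_class_def by (simp add: eq_equiv_class_iff[OF equiv_ext_rel])

lemma ext_class_eqI: "(E, E') \<in> ext_rel N H \<Longrightarrow> ext_class N H E = ext_class N H E'"
  using ext_class_eq_iff[of E E'] by (auto simp: ext_rel_def)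

lemma Ex_all_eq: "Ex_all N H = ext_class N H ` {E. is_extension N H E}"
  by (auto simp: Ex_all_def quotient_def ext_class_def)

lemma mem_ext_class_iff: "E' \<in> ext_class N H E \<longleftrightarrow> (E, E') \<in> ext_rel N H"
  by (simp add: ext_class_def)

lemma ext_class_self: "is_extension N H E \<Longrightarrow> E \<in> ext_class N H E"
  by (simp add: mem_ext_class_iff ext_rel_refl)

lemmas act_ext_extension = act_ext_is_extension[OF N.group_axioms H.group_axioms]
  and act_ext_class = act_Ex_class[OF N.group_axioms H.group_axioms]

lemma ext_rel_identityI:
  assumes "is_extension N H E" "is_extension N H E'" "middle E = middle E'"
    and "\<And>n. n \<in> carrier N \<Longrightarrow> incl E n = incl E' n"
    and "\<And>g. g \<in> carrier (middle E) \<Longrightarrow> projn E' g = projn E g"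
  shows "(E, E') \<in> ext_rel N H"
  using assms(3-) by (intro ext_relI[OF assms(1,2) N.group_axioms H.group_axioms, of id])
    (auto simp: hom_def)

lemma group_action_Ex:
  "group_action (K N H) (Ex_all N H) (\<lambda>k. restrict (act_Ex N H k) (Ex_all N H))"
proof (rule group_action_restrictI[OF group_K])
  fix k X assume k: "k \<in> carrier (K N H)" and "X \<in> Ex_all N H"
  then show "act_Ex N H k X \<in> Ex_all N H"
    by (auto simp: Ex_all_eq act_ext_class act_ext_extension)
next
  fix X assume "X \<in> Ex_all N H"
  then obtain E where E: "is_extension N H E" "X = ext_class N H E" by (auto simp: Ex_all_eq)
  have one: "\<one>\<^bsub>K N H\<^esub> \<in> carrier (K N H)" by (rule monoid.one_closed[OF group.is_monoid[OF group_K]])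
  have p: "projn E g \<in> carrier H" if "g \<in> carrier (middle E)" for g
    using is_extensionD(5)[OF E(1)] that by blast
  have "(act_ext N H \<one>\<^bsub>K N H\<^esub> E, E) \<in> ext_rel N H"
    by (rule ext_rel_identityI[OF act_ext_extension[OF one E(1)] E(1)])
      (simp_all add: act_ext_def one_K N.auto_inv_one_apply H.auto_one_apply p)
  then show "act_Ex N H \<one>\<^bsub>K N H\<^esub> X = X"
    using E one by (simp add: act_ext_class ext_class_eqI)
next
  fix k l X assume k: "k \<in> carrier (K N H)" and l: "l \<in> carrier (K N H)" and "X \<in> Ex_all N H"
  then obtain E where E: "is_extension N H E" "X = ext_class N H E" by (auto simp: Ex_all_eq)
  have kl: "k \<otimes>\<^bsub>K N H\<^esub> l \<in> carrier (K N H)"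
    by (rule monoid.m_closed[OF group.is_monoid[OF group_K] k l])
  have auto: "fst k \<in> auto N" "fst l \<in> auto N" "snd k \<in> auto H" "snd l \<in> auto H"
    using k l by (auto simp: carrier_K)
  have p: "projn E g \<in> carrier H" if "g \<in> carrier (middle E)" for g
    using is_extensionD(5)[OF E(1)] that by blast
  have "(act_ext N H (k \<otimes>\<^bsub>K N H\<^esub> l) E, act_ext N H k (act_ext N H l E)) \<in> ext_rel N H"
    by (rule ext_rel_identityI[OF act_ext_extension[OF kl E(1)]
          act_ext_extension[OF k act_ext_extension[OF l E(1)]]])
      (simp_all add: act_ext_def mult_K N.auto_inv_prod_apply auto H.auto_prod_apply p)
  then show "act_Ex N H (k \<otimes>\<^bsub>K N H\<^esub> l) X = act_Ex N H k (act_Ex N H l X)"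
    using E k l kl by (simp add: act_ext_class act_ext_extension ext_class_eqI)
qed

lemma Gr_bij_orbits:
  "\<exists>\<Phi>. bij_betw \<Phi> (Gr N H) (orbits (K N H) (Ex_all N H) (act_Ex N H)) \<and>
    (\<forall>C\<in>Gr N H. \<forall>E\<in>C. \<Phi> C = orbit (K N H) (act_Ex N H) (ext_class N H E))"
proof -
  define F where "F E = orbit (K N H) (act_Ex N H) (ext_class N H E)"
    for E :: "('n, 'h, 'n \<times> 'h) extension"
  have F_eq: "F E = F E' \<longleftrightarrow> (\<exists>k\<in>carrier (K N H). (act_ext N H k E, E') \<in> ext_rel N H)"
    if "is_extension N H E" "is_extension N H E'"
    for E E'
    unfolding F_def using that orbit_eq_iff[OF group_action_Ex, of "ext_class N H E" "ext_class N H E'"]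
    by (auto simp: Ex_all_eq act_ext_class ext_class_eq_iff act_ext_extension)
  have "virt_rel N H = {(E, E'). E \<in> {E. is_extension N H E} \<and> E' \<in> {E. is_extension N H E} \<and>
      F E = F E'}" (is "_ = ?r")
  proof (rule Set.set_eqI)
    fix p :: "('n, 'h, 'n \<times> 'h) extension \<times> ('n, 'h, 'n \<times> 'h) extension"
    obtain E E' where "p = (E, E')" by (cases p)
    then show "p \<in> virt_rel N H \<longleftrightarrow> p \<in> ?r"
      using F_eq[of E E'] by (simp add: virt_rel_iff cong: conj_cong)
  qed
  from bij_betw_quotient_kernel[OF this]
  show ?thesis by (simp add: F_def Gr_def orbits_def Ex_all_eq Setcompr_eq_image image_image)
qed

lemma coupling_at_one:
  assumes E: "is_extension N H E"
  shows "coupling N H E \<one>\<^bsub>H\<^esub> = out_class N \<one>\<^bsub>AutoGroup N\<^esub>"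
proof -
  interpret G: group "middle E" by (rule is_extensionD(1)[OF E])
  interpret A: group "AutoGroup N" by (rule N.AutoGroup)
  interpret i: group_hom N "middle E" "incl E" using is_extensionD(2)[OF E] by unfold_locales
  interpret p: group_hom "middle E" H "projn E" using is_extensionD(4)[OF E] by unfold_locales
  have "\<one>\<^bsub>AutoGroup N\<^esub> \<in> auto N" using A.one_closed by simp
  then have "conj_aut N E \<one>\<^bsub>middle E\<^esub> = \<one>\<^bsub>AutoGroup N\<^esub>"
    using conj_aut_auto[OF N.group_axioms H.group_axioms E G.one_closed]
    by (intro N.auto_eqI) (simp_all add: N.auto_one_apply conj_aut_eqI[OF E])
  then show ?thesis
    using coupling_section[OF N.group_axioms H.group_axioms E G.one_closed] by simp
qed

text \<open>
Some lift of the coupling has to be chosen that is the identity at \<open>\<one>\<close>; this is possible as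
the coupling is trivial there.
\<close>

lemma extension_factor_set_exists:
  assumes E: "is_extension N H E"
  obtains \<phi> f where "factor_set N H \<phi> f" "(crossed_ext N H \<phi> f, E) \<in> ext_rel N H"
proof -
  interpret A: group "AutoGroup N" by (rule N.AutoGroup)
  define s where "s = inv_into (carrier (middle E)) (projn E)"
  have s: "s h \<in> carrier (middle E)" if "h \<in> carrier H" for h
    using that is_extensionD(5)[OF E] by (auto simp: s_def inv_into_into)
  define \<phi> where "\<phi> h = (if h = \<one>\<^bsub>H\<^esub> then \<one>\<^bsub>AutoGroup N\<^esub> else conj_aut N E (s h))" for h
  have "\<phi> h \<in> auto N" if "h \<in> carrier H" for h
    using conj_aut_auto[OF N.group_axioms H.group_axioms E s[OF that]] A.one_closed
    by (simp add: \<phi>_def)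
  moreover have "\<phi> \<one>\<^bsub>H\<^esub> x = x" if "x \<in> carrier N" for x
    using that by (simp add: \<phi>_def N.auto_one_apply)
  moreover have "out_class N (\<phi> h) = coupling N H E h" if "h \<in> carrier H" for h
    using that coupling_at_one[OF E] by (simp add: \<phi>_def coupling_def s_def)
  ultimately show thesis using that by (rule extension_crossed[OF E])
qed

lemma factor_set_out_mult:
  assumes fs: "factor_set N H \<phi> f" and gh: "g \<in> carrier H" "h \<in> carrier H"
  shows "out_class N (\<phi> g) \<otimes>\<^bsub>Out N\<^esub> out_class N (\<phi> h) = out_class N (\<phi> (g \<otimes>\<^bsub>H\<^esub> h))"
proof -
  note fsD = factor_setD[OF fs]
  have "\<phi> g (\<phi> h x) = f (g, h) \<otimes> \<phi> (g \<otimes>\<^bsub>H\<^esub> h) x \<otimes> inv (f (g, h))" if "x \<in> carrier N" for x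
    using fsD(5)[OF gh that] fsD(1,2) gh that by (intro N.inv_solve_right[THEN iffD2]) (simp_all add: N.auto_closed)
  then have "out_class N (\<phi> g \<otimes>\<^bsub>AutoGroup N\<^esub> \<phi> h) = out_class N (\<phi> (g \<otimes>\<^bsub>H\<^esub> h))"
    using fsD(1,2) gh
    by (intro N.out_class_eq_iff[THEN iffD2] bexI[of _ "f (g, h)"]) (simp_all add: N.auto_simps)
  then show ?thesis using fsD(1) gh by (simp add: N.out_class_mult)
qed

lemma coupling_Hom_Out:
  assumes E: "is_extension N H E"
  shows "coupling N H E \<in> Hom_Out N H"
proof -
  obtain \<phi> f where fs: "factor_set N H \<phi> f" and r: "(crossed_ext N H \<phi> f, E) \<in> ext_rel N H"
    by (rule extension_factor_set_exists[OF E])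
  have c: "coupling N H E h = out_class N (\<phi> h)" if "h \<in> carrier H" for h
    using coupling_ext_rel[OF N.group_axioms H.group_axioms r] coupling_crossed[OF fs that] by simp
  have "coupling N H E \<in> hom H (Out N)"
    using factor_setD(1)[OF fs]
    by (intro homI) (simp_all add: c N.out_class_closed factor_set_out_mult[OF fs])
  then show ?thesis by (simp add: Hom_Out_def coupling_def)
qed

lemma auto_act_lift:
  assumes "k \<in> carrier (K N H)" and "\<And>h. h \<in> carrier H \<Longrightarrow> \<phi> h \<in> auto N" and "h \<in> carrier H"
  shows "act_lift N H k \<phi> h \<in> auto N"
  using assms by (auto simp: act_lift_def carrier_K N.auto_simps H.auto_simps)

lemma act_lift_apply:
  assumes "k \<in> carrier (K N H)" and "\<And>h. h \<in> carrier H \<Longrightarrow> \<phi> h \<in> auto N" and "h \<in> carrier H"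
    and "x \<in> carrier N"
  shows "act_lift N H k \<phi> h x
    = fst k (\<phi> ((inv\<^bsub>AutoGroup H\<^esub> (snd k)) h) ((inv\<^bsub>AutoGroup N\<^esub> (fst k)) x))"
  using assms by (auto simp: act_lift_def carrier_K N.auto_simps H.auto_simps)

lemma act_factor_set:
  assumes k: "k \<in> carrier (K N H)" and fs: "factor_set N H \<phi> f"
  shows "factor_set N H (act_lift N H k \<phi>) (act_cocycle H k f)"
proof -
  note fsD = factor_setD[OF fs]
  obtain \<alpha> \<beta> where k_eq: "k = (\<alpha>, \<beta>)" and \<alpha>: "\<alpha> \<in> auto N" and "\<beta> \<in> auto H"
    using k by (auto simp: carrier_K)
  then have \<beta>: "inv\<^bsub>AutoGroup H\<^esub> \<beta> \<in> auto H" by (simp add: H.auto_inv_closed)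
  note cl = \<alpha> \<beta> fsD(1,2) N.auto_closed H.auto_closed N.auto_inv_closed
  have lift: "act_lift N H k \<phi> h x
      = \<alpha> (\<phi> ((inv\<^bsub>AutoGroup H\<^esub> \<beta>) h) ((inv\<^bsub>AutoGroup N\<^esub> \<alpha>) x))"
    if "h \<in> carrier H" "x \<in> carrier N" for h x
    using act_lift_apply[OF k fsD(1) that] by (simp add: k_eq)
  have coc: "act_cocycle H k f (g, h)
      = \<alpha> (f ((inv\<^bsub>AutoGroup H\<^esub> \<beta>) g, (inv\<^bsub>AutoGroup H\<^esub> \<beta>) h))"
    if "g \<in> carrier H" "h \<in> carrier H" for g h
    using that by (simp add: act_cocycle_def k_eq)
  show ?thesis
    unfolding factor_set_def
  proof (intro conjI ballI)
    show "act_lift N H k \<phi> \<in> carrier H \<rightarrow> auto N"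
      using auto_act_lift[OF k fsD(1)] by auto
    show "act_cocycle H k f \<in> carrier H \<times> carrier H \<rightarrow> carrier N"
      by (auto simp: coc cl)
    fix h assume h: "h \<in> carrier H"
    then show "act_cocycle H k f (\<one>\<^bsub>H\<^esub>, h) = \<one>" "act_cocycle H k f (h, \<one>\<^bsub>H\<^esub>) = \<one>"
      by (simp_all add: coc cl H.auto_one N.auto_one fsD(3,4))
  next
    fix g h x assume mem: "g \<in> carrier H" "h \<in> carrier H" "x \<in> carrier N"
    then show "act_lift N H k \<phi> g (act_lift N H k \<phi> h x) \<otimes> act_cocycle H k f (g, h)
        = act_cocycle H k f (g, h) \<otimes> act_lift N H k \<phi> (g \<otimes>\<^bsub>H\<^esub> h) x"
      by (simp add: lift coc cl N.auto_inv_apply H.auto_mult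
          N.auto_mult[OF \<alpha>, symmetric] fsD(5))
  next
    fix g h l assume mem: "g \<in> carrier H" "h \<in> carrier H" "l \<in> carrier H"
    then show "act_lift N H k \<phi> g (act_cocycle H k f (h, l)) \<otimes> act_cocycle H k f (g, h \<otimes>\<^bsub>H\<^esub> l)
        = act_cocycle H k f (g, h) \<otimes> act_cocycle H k f (g \<otimes>\<^bsub>H\<^esub> h, l)"
      by (simp add: lift coc cl N.auto_inv_apply H.auto_mult
          N.auto_mult[OF \<alpha>, symmetric] fsD(6))
  qed
qed

text \<open>
The equivalence is \<open>(a, g) \<mapsto> (\<alpha> a, \<beta> g)\<close>.
\<close>

lemma act_crossed_ext:
  assumes k: "k \<in> carrier (K N H)" and fs: "factor_set N H \<phi> f"
  shows "(act_ext N H k (crossed_ext N H \<phi> f),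
    crossed_ext N H (act_lift N H k \<phi>) (act_cocycle H k f)) \<in> ext_rel N H"
proof -
  note fsD = factor_setD[OF fs]
  obtain \<alpha> \<beta> where k_eq: "k = (\<alpha>, \<beta>)" and \<alpha>: "\<alpha> \<in> auto N" and \<beta>: "\<beta> \<in> auto H"
    using k by (auto simp: carrier_K)
  note cl = \<alpha> \<beta> fsD(1,2) N.auto_closed H.auto_closed
  have lift: "act_lift N H k \<phi> (\<beta> h) (\<alpha> x) = \<alpha> (\<phi> h x)" if "h \<in> carrier H" "x \<in> carrier N" for h x
    using act_lift_apply[OF k fsD(1), where h = "\<beta> h" and x = "\<alpha> x"] that
    by (simp add: k_eq cl N.auto_inv_apply H.auto_inv_apply)
  have coc: "act_cocycle H k f (\<beta> g, \<beta> h) = \<alpha> (f (g, h))" if "g \<in> carrier H" "h \<in> carrier H" for g h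
    using that by (simp add: act_cocycle_def k_eq cl H.auto_inv_apply)
  let ?E = "act_ext N H k (crossed_ext N H \<phi> f)"
  let ?E' = "crossed_ext N H (act_lift N H k \<phi>) (act_cocycle H k f)"
  show ?thesis
  proof (rule ext_relI[OF act_ext_extension[OF k factor_set_extension[OF fs]]
        factor_set_extension[OF act_factor_set[OF k fs]] N.group_axioms H.group_axioms])
    let ?\<theta> = "\<lambda>(a, g). (\<alpha> a, \<beta> g)"
    show "?\<theta> \<in> hom (middle ?E) (middle ?E')"
    proof (rule homI)
      fix x y assume "x \<in> carrier (middle ?E)" "y \<in> carrier (middle ?E)"
      then obtain a g b h where "x = (a, g)" "y = (b, h)"
        "a \<in> carrier N" "g \<in> carrier H" "b \<in> carrier N" "h \<in> carrier H"
        by (auto simp: act_ext_def crossed_ext_simps)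
      then show "?\<theta> (x \<otimes>\<^bsub>middle ?E\<^esub> y) = ?\<theta> x \<otimes>\<^bsub>middle ?E'\<^esub> ?\<theta> y"
        by (simp add: act_ext_def crossed_ext_simps lift coc cl N.auto_mult H.auto_mult)
    qed (auto simp: act_ext_def crossed_ext_simps cl)
  qed (use \<alpha> \<beta> in \<open>auto simp: act_ext_def crossed_ext_simps k_eq N.auto_inv_apply N.auto_inv_closed H.auto_one\<close>)
qed

lemma coupling_act_ext:
  assumes k: "k \<in> carrier (K N H)" and E: "is_extension N H E"
  shows "coupling N H (act_ext N H k E) = act_Hom N H k (coupling N H E)"
proof (rule extensionalityI[of _ "carrier H"])
  interpret A: group "AutoGroup N" by (rule N.AutoGroup)
  obtain \<phi> f where fs: "factor_set N H \<phi> f" and r: "(crossed_ext N H \<phi> f, E) \<in> ext_rel N H"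
    by (rule extension_factor_set_exists[OF E])
  have \<alpha>: "fst k \<in> auto N" and \<beta>: "snd k \<in> auto H" using k by (auto simp: carrier_K)
  fix h assume h: "h \<in> carrier H"
  have \<beta>h: "(inv\<^bsub>AutoGroup H\<^esub> (snd k)) h \<in> carrier H" using \<beta> h by (simp add: H.auto_simps)
  note couple = coupling_ext_rel[OF N.group_axioms H.group_axioms]
  have "coupling N H (act_ext N H k E) h = out_class N (act_lift N H k \<phi> h)"
    using couple[OF act_ext_rel[OF N.group_axioms H.group_axioms k r]]
      couple[OF act_crossed_ext[OF k fs]] coupling_crossed[OF act_factor_set[OF k fs] h] by simp
  also have "\<dots> = out_class N (fst k) \<otimes>\<^bsub>Out N\<^esub> out_class N (\<phi> ((inv\<^bsub>AutoGroup H\<^esub> (snd k)) h))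
      \<otimes>\<^bsub>Out N\<^esub> inv\<^bsub>Out N\<^esub> (out_class N (fst k))"
    using \<alpha> factor_setD(1)[OF fs \<beta>h]
    by (simp add: act_lift_def N.out_class_mult N.out_class_inv N.auto_inv_closed N.auto_prod_closed)
  also have "out_class N (\<phi> ((inv\<^bsub>AutoGroup H\<^esub> (snd k)) h))
      = coupling N H E ((inv\<^bsub>AutoGroup H\<^esub> (snd k)) h)"
    using couple[OF r] coupling_crossed[OF fs \<beta>h] by simp
  finally show "coupling N H (act_ext N H k E) h = act_Hom N H k (coupling N H E) h"
    using h by (simp add: act_Hom_def)
qed (simp_all add: coupling_def act_Hom_def)

lemma group_action_Hom:
  "group_action (K N H) (Hom_Out N H) (\<lambda>k. restrict (act_Hom N H k) (Hom_Out N H))"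
proof (rule group_action_restrictI[OF group_K])
  interpret O: group "Out N" by (rule N.group_Out)
  have cl: "\<omega> h \<in> carrier (Out N)" and mult: "\<omega> (g \<otimes>\<^bsub>H\<^esub> h) = \<omega> g \<otimes>\<^bsub>Out N\<^esub> \<omega> h"
    if "\<omega> \<in> Hom_Out N H" "h \<in> carrier H" "g \<in> carrier H" for \<omega> g h
    using that by (auto simp: Hom_Out_def hom_def)
  have ext: "\<omega> \<in> extensional (carrier H)" if "\<omega> \<in> Hom_Out N H" for \<omega>
    using that by (simp add: Hom_Out_def)
  {
    fix k \<omega> assume k: "k \<in> carrier (K N H)" and \<omega>: "\<omega> \<in> Hom_Out N H"
    have auto: "fst k \<in> auto N" "snd k \<in> auto H" using k by (auto simp: carrier_K)
    have "act_Hom N H k \<omega> \<in> hom H (Out N)"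
    proof (rule homI)
      fix g h assume "g \<in> carrier H" "h \<in> carrier H"
      then show "act_Hom N H k \<omega> (g \<otimes>\<^bsub>H\<^esub> h) = act_Hom N H k \<omega> g \<otimes>\<^bsub>Out N\<^esub> act_Hom N H k \<omega> h"
        using auto by (simp add: act_Hom_def H.auto_simps mult[OF \<omega>] cl[OF \<omega>]
            N.out_class_closed O.m_assoc O.inv_cancel_left)
    qed (use auto in \<open>simp add: act_Hom_def H.auto_simps cl[OF \<omega>] N.out_class_closed\<close>)
    then show "act_Hom N H k \<omega> \<in> Hom_Out N H" by (simp add: Hom_Out_def act_Hom_def)
  next
    fix \<omega> assume \<omega>: "\<omega> \<in> Hom_Out N H"
    show "act_Hom N H \<one>\<^bsub>K N H\<^esub> \<omega> = \<omega>"
      by (rule extensionalityI[OF _ ext[OF \<omega>]])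
        (simp_all add: act_Hom_def one_K H.auto_inv_one_apply N.out_class_one cl[OF \<omega>])
  next
    fix k l \<omega> assume k: "k \<in> carrier (K N H)" and l: "l \<in> carrier (K N H)" and \<omega>: "\<omega> \<in> Hom_Out N H"
    have auto: "fst k \<in> auto N" "snd k \<in> auto H" "fst l \<in> auto N" "snd l \<in> auto H"
      using k l by (auto simp: carrier_K)
    show "act_Hom N H (k \<otimes>\<^bsub>K N H\<^esub> l) \<omega> = act_Hom N H k (act_Hom N H l \<omega>)"
      by (rule extensionalityI[of _ "carrier H"])
        (use auto in \<open>simp_all add: act_Hom_def mult_K H.auto_inv_prod_apply H.auto_simps
          N.out_class_mult[symmetric] N.out_class_closed cl[OF \<omega>] O.inv_mult_group O.m_assoc\<close>)
  }
qed

lemma class_coupling_eq: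
  assumes "is_extension N H E"
  shows "class_coupling N H (ext_class N H E) = coupling N H E"
proof -
  have "(SOME E'. E' \<in> ext_class N H E) \<in> ext_class N H E"
    using ext_class_self[OF assms] by (rule someI)
  then show ?thesis
    using coupling_ext_rel[OF N.group_axioms H.group_axioms] unfolding class_coupling_def mem_ext_class_iff
    by metis
qed

lemma Ex_of_eq: "Ex_of N H \<omega> = {X \<in> Ex_all N H. class_coupling N H X = \<omega>}"
  by (auto simp: Ex_of_def Ex_all_eq class_coupling_eq)

text \<open>
The coupling fibres the \<open>K\<close>-set of extension classes over \<open>Hom(H, Out N)\<close>, with fibres
\<open>Ex_of N H \<omega>\<close>.
\<close>

lemma Ex_all_bij_coproduct:
  assumes R: "orbit_representatives N H R"
  shows "\<exists>\<Psi>. bij_betw \<Psi> (orbits (K N H) (Ex_all N H) (act_Ex N H))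
      (SIGMA \<omega>:R. orbits (K_of N H \<omega>) (Ex_of N H \<omega>) (act_Ex N H)) \<and>
    (\<forall>\<omega>\<in>R. \<forall>X\<in>Ex_of N H \<omega>.
      \<Psi> (orbit (K N H) (act_Ex N H) X) = (\<omega>, orbit (K_of N H \<omega>) (act_Ex N H) X))"
  unfolding Ex_of_eq K_of_def
proof (rule orbits_fibration[OF group_action_Ex group_action_Hom])
  show "class_coupling N H X \<in> Hom_Out N H" if "X \<in> Ex_all N H" for X
    using that by (auto simp: Ex_all_eq class_coupling_eq coupling_Hom_Out)
  show "class_coupling N H (act_Ex N H k X) = act_Hom N H k (class_coupling N H X)"
    if "k \<in> carrier (K N H)" "X \<in> Ex_all N H" for k X
    using that by (auto simp: Ex_all_eq act_ext_class act_ext_extension class_coupling_eq coupling_act_ext)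
qed (use R in \<open>auto simp: orbit_representatives_def\<close>)

end

section \<open>Second cohomology of the centre\<close>

locale group_pair_coupling = group_pair N H
  for N :: "('n, 'a) monoid_scheme" (structure) and H :: "('h, 'b) monoid_scheme" +
  fixes \<omega> :: "'h \<Rightarrow> ('n \<Rightarrow> 'n) set"
  assumes \<omega>: "\<omega> \<in> Hom_Out N H"
begin

abbreviation "coboundaries \<equiv> coboundary N H \<omega> ` (carrier H \<rightarrow> centre N)"

abbreviation "cohom_class \<tau> \<equiv> coboundaries #>\<^bsub>cocycle_group N H \<omega>\<^esub> \<tau>"

definition normalised :: "('h \<times> 'h \<Rightarrow> 'n) \<Rightarrow> bool" where
  "normalised \<tau> \<longleftrightarrow> (\<forall>g\<in>carrier H. \<tau> (\<one>\<^bsub>H\<^esub>, g) = \<one> \<and> \<tau> (g, \<one>\<^bsub>H\<^esub>) = \<one>)"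

definition lifts :: "('h \<Rightarrow> 'n \<Rightarrow> 'n) \<Rightarrow> bool" where
  "lifts \<phi> \<longleftrightarrow> (\<forall>h\<in>carrier H. \<phi> h \<in> auto N \<and> out_class N (\<phi> h) = \<omega> h)"

lemma liftsD:
  assumes "lifts \<phi>" "h \<in> carrier H"
  shows "\<phi> h \<in> auto N" "out_class N (\<phi> h) = \<omega> h"
  using assms by (auto simp: lifts_def)

lemma coupling_lift:
  assumes "h \<in> carrier H"
  obtains \<phi> where "\<phi> \<in> auto N" "out_class N \<phi> = \<omega> h"
proof -
  have "\<omega> h \<in> out_class N ` auto N"
    using \<omega> assms by (auto simp: Hom_Out_def hom_def N.carrier_Out)
  then show thesis using that by auto
qed

lemma coupling_mult: "g \<in> carrier H \<Longrightarrow> h \<in> carrier H \<Longrightarrow> \<omega> (g \<otimes>\<^bsub>H\<^esub> h) = \<omega> g \<otimes>\<^bsub>Out N\<^esub> \<omega> h"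
  using \<omega> by (simp add: Hom_Out_def hom_def)

lemma coupling_one: "\<omega> \<one>\<^bsub>H\<^esub> = out_class N \<one>\<^bsub>AutoGroup N\<^esub>"
proof -
  have "group_hom H (Out N) \<omega>"
    using \<omega> N.group_Out H.group_axioms by (simp add: Hom_Out_def group_hom_def group_hom_axioms_def)
  then show ?thesis by (simp add: group_hom.hom_one N.out_class_one)
qed

lemma centre_act_lift:
  "lifts \<phi> \<Longrightarrow> h \<in> carrier H \<Longrightarrow> z \<in> centre N \<Longrightarrow> centre_act \<omega> h z = \<phi> h z"
  by (rule N.centre_act_eq) (simp_all add: lifts_def)

lemma centre_act_closed: "h \<in> carrier H \<Longrightarrow> z \<in> centre N \<Longrightarrow> centre_act \<omega> h z \<in> centre N"
  by (rule coupling_lift[of h]) (simp_all add: N.centre_act_eq N.auto_centre)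

lemma centre_one_closed: "\<one> \<in> centre N"
  and centre_m_closed: "x \<in> centre N \<Longrightarrow> y \<in> centre N \<Longrightarrow> x \<otimes> y \<in> centre N"
  and centre_inv_closed: "x \<in> centre N \<Longrightarrow> inv x \<in> centre N"
  using N.subgroup_centre by (auto intro: subgroup.one_closed subgroup.m_closed subgroup.m_inv_closed)

lemmas centre_intros = centre_one_closed centre_m_closed centre_inv_closed centre_act_closed

lemma centre_comm:
  "x \<in> centre N \<Longrightarrow> y \<in> centre N \<Longrightarrow> x \<otimes> y = y \<otimes> x"
  "x \<in> centre N \<Longrightarrow> y \<in> centre N \<Longrightarrow> z \<in> centre N \<Longrightarrow> x \<otimes> (y \<otimes> z) = y \<otimes> (x \<otimes> z)"
  by (simp_all add: N.centre_commutes N.centre_closed N.centre_left_commutes)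

lemmas centre_ac = N.m_assoc centre_comm

lemma centre_act_mult:
  assumes "h \<in> carrier H" "y \<in> centre N" "z \<in> centre N"
  shows "centre_act \<omega> h (y \<otimes> z) = centre_act \<omega> h y \<otimes> centre_act \<omega> h z"
  by (rule coupling_lift[OF assms(1)])
    (use assms in \<open>simp add: N.centre_act_eq centre_m_closed N.auto_mult N.centre_closed\<close>)

lemma centre_act_inv:
  assumes "h \<in> carrier H" "z \<in> centre N"
  shows "centre_act \<omega> h (inv z) = inv (centre_act \<omega> h z)"
  by (rule coupling_lift[OF assms(1)])
    (use assms in \<open>simp add: N.centre_act_eq centre_inv_closed N.auto_m_inv N.centre_closed\<close>)

lemma centre_act_unit: "h \<in> carrier H \<Longrightarrow> centre_act \<omega> h \<one> = \<one>"
  by (rule coupling_lift[of h]) (simp_all add: N.centre_act_eq centre_one_closed N.auto_one)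

lemma centre_act_one: "z \<in> centre N \<Longrightarrow> centre_act \<omega> \<one>\<^bsub>H\<^esub> z = z"
  using group.is_monoid[OF N.AutoGroup] monoid.one_closed[of "AutoGroup N"]
  by (simp add: N.centre_act_eq[of "\<one>\<^bsub>AutoGroup N\<^esub>"] coupling_one N.auto_one_apply N.centre_closed)

lemma centre_act_comp:
  assumes gh: "g \<in> carrier H" "h \<in> carrier H" and z: "z \<in> centre N"
  shows "centre_act \<omega> (g \<otimes>\<^bsub>H\<^esub> h) z = centre_act \<omega> g (centre_act \<omega> h z)"
proof -
  obtain \<phi> where \<phi>: "\<phi> \<in> auto N" "out_class N \<phi> = \<omega> g" by (rule coupling_lift[OF gh(1)])
  obtain \<psi> where \<psi>: "\<psi> \<in> auto N" "out_class N \<psi> = \<omega> h" by (rule coupling_lift[OF gh(2)])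
  have "out_class N (\<phi> \<otimes>\<^bsub>AutoGroup N\<^esub> \<psi>) = \<omega> (g \<otimes>\<^bsub>H\<^esub> h)"
    using \<phi> \<psi> by (simp add: coupling_mult[OF gh] N.out_class_mult[symmetric])
  from N.centre_act_eq[where \<omega> = \<omega> and h = "g \<otimes>\<^bsub>H\<^esub> h", OF N.auto_prod_closed[OF \<phi>(1) \<psi>(1)] this z]
  show ?thesis
    using \<phi> \<psi> z by (simp add: N.auto_prod_apply N.centre_act_eq[of \<phi>] N.centre_act_eq[of \<psi>]
        N.auto_centre N.centre_closed)
qed

lemma cocyclesD:
  assumes "\<tau> \<in> cocycles N H \<omega>"
  shows "\<And>g h. g \<in> carrier H \<Longrightarrow> h \<in> carrier H \<Longrightarrow> \<tau> (g, h) \<in> centre N"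
    and "\<And>g h k. g \<in> carrier H \<Longrightarrow> h \<in> carrier H \<Longrightarrow> k \<in> carrier H \<Longrightarrow>
      centre_act \<omega> g (\<tau> (h, k)) \<otimes> \<tau> (g, h \<otimes>\<^bsub>H\<^esub> k) = \<tau> (g, h) \<otimes> \<tau> (g \<otimes>\<^bsub>H\<^esub> h, k)"
    and "\<tau> \<in> extensional (carrier H \<times> carrier H)"
  using assms by (auto simp: cocycles_def PiE_def)

lemma cocyclesI:
  assumes "\<And>g h. g \<in> carrier H \<Longrightarrow> h \<in> carrier H \<Longrightarrow> \<tau> (g, h) \<in> centre N"
    and "\<And>g h k. g \<in> carrier H \<Longrightarrow> h \<in> carrier H \<Longrightarrow> k \<in> carrier H \<Longrightarrow>
      centre_act \<omega> g (\<tau> (h, k)) \<otimes> \<tau> (g, h \<otimes>\<^bsub>H\<^esub> k) = \<tau> (g, h) \<otimes> \<tau> (g \<otimes>\<^bsub>H\<^esub> h, k)"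
    and "\<tau> \<in> extensional (carrier H \<times> carrier H)"
  shows "\<tau> \<in> cocycles N H \<omega>"
  using assms by (auto simp: cocycles_def PiE_def)

lemma carrier_cocycle_group: "carrier (cocycle_group N H \<omega>) = cocycles N H \<omega>"
  by (simp add: cocycle_group_def)

lemma mult_cocycle_group:
  "\<sigma> \<otimes>\<^bsub>cocycle_group N H \<omega>\<^esub> \<tau> = (\<lambda>x\<in>carrier H \<times> carrier H. \<sigma> x \<otimes> \<tau> x)"
  by (simp add: cocycle_group_def)

lemma one_cocycle_group: "\<one>\<^bsub>cocycle_group N H \<omega>\<^esub> = (\<lambda>x\<in>carrier H \<times> carrier H. \<one>)"
  by (simp add: cocycle_group_def)

lemma pair_extensionalityI:
  assumes "\<sigma> \<in> extensional (carrier H \<times> carrier H)" "\<tau> \<in> extensional (carrier H \<times> carrier H)"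
    and "\<And>g h. g \<in> carrier H \<Longrightarrow> h \<in> carrier H \<Longrightarrow> \<sigma> (g, h) = \<tau> (g, h)"
  shows "\<sigma> = \<tau>"
  using assms by (intro extensionalityI[of \<sigma> "carrier H \<times> carrier H" \<tau>]) auto

lemma comm_group_cocycles: "comm_group (cocycle_group N H \<omega>)"
proof (rule comm_groupI)
  fix \<sigma> \<tau> assume s: "\<sigma> \<in> carrier (cocycle_group N H \<omega>)" and t: "\<tau> \<in> carrier (cocycle_group N H \<omega>)"
  note sD = cocyclesD[OF s[unfolded carrier_cocycle_group]]
  note tD = cocyclesD[OF t[unfolded carrier_cocycle_group]]
  show "\<sigma> \<otimes>\<^bsub>cocycle_group N H \<omega>\<^esub> \<tau> \<in> carrier (cocycle_group N H \<omega>)"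
    unfolding carrier_cocycle_group mult_cocycle_group
  proof (rule cocyclesI)
    fix g h k assume ghk: "g \<in> carrier H" "h \<in> carrier H" "k \<in> carrier H"
    note c = centre_act_closed centre_m_closed sD(1) tD(1) N.centre_closed
    have "centre_act \<omega> g (\<sigma> (h, k) \<otimes> \<tau> (h, k)) \<otimes> (\<sigma> (g, h \<otimes>\<^bsub>H\<^esub> k) \<otimes> \<tau> (g, h \<otimes>\<^bsub>H\<^esub> k))
        = (centre_act \<omega> g (\<sigma> (h, k)) \<otimes> \<sigma> (g, h \<otimes>\<^bsub>H\<^esub> k))
          \<otimes> (centre_act \<omega> g (\<tau> (h, k)) \<otimes> \<tau> (g, h \<otimes>\<^bsub>H\<^esub> k))"
      using ghk by (simp add: c centre_act_mult centre_ac)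
    also have "\<dots> = (\<sigma> (g, h) \<otimes> \<sigma> (g \<otimes>\<^bsub>H\<^esub> h, k)) \<otimes> (\<tau> (g, h) \<otimes> \<tau> (g \<otimes>\<^bsub>H\<^esub> h, k))"
      using ghk by (simp only: sD(2) tD(2))
    also have "\<dots> = \<sigma> (g, h) \<otimes> \<tau> (g, h) \<otimes> (\<sigma> (g \<otimes>\<^bsub>H\<^esub> h, k) \<otimes> \<tau> (g \<otimes>\<^bsub>H\<^esub> h, k))"
      using ghk by (simp add: c centre_ac)
    finally show "centre_act \<omega> g ((\<lambda>x\<in>carrier H \<times> carrier H. \<sigma> x \<otimes> \<tau> x) (h, k))
        \<otimes> (\<lambda>x\<in>carrier H \<times> carrier H. \<sigma> x \<otimes> \<tau> x) (g, h \<otimes>\<^bsub>H\<^esub> k)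
        = (\<lambda>x\<in>carrier H \<times> carrier H. \<sigma> x \<otimes> \<tau> x) (g, h)
        \<otimes> (\<lambda>x\<in>carrier H \<times> carrier H. \<sigma> x \<otimes> \<tau> x) (g \<otimes>\<^bsub>H\<^esub> h, k)"
      using ghk by simp
  qed (simp_all add: sD(1) tD(1) centre_m_closed)
  show "\<sigma> \<otimes>\<^bsub>cocycle_group N H \<omega>\<^esub> \<tau> = \<tau> \<otimes>\<^bsub>cocycle_group N H \<omega>\<^esub> \<sigma>"
    unfolding mult_cocycle_group
    by (rule pair_extensionalityI) (simp_all add: sD(1) tD(1) centre_comm(1))
  show "\<one>\<^bsub>cocycle_group N H \<omega>\<^esub> \<otimes>\<^bsub>cocycle_group N H \<omega>\<^esub> \<sigma> = \<sigma>"
    unfolding mult_cocycle_group one_cocycle_group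
    by (rule pair_extensionalityI) (simp_all add: sD N.centre_closed)
  have "(\<lambda>x\<in>carrier H \<times> carrier H. inv (\<sigma> x)) \<in> cocycles N H \<omega>"
  proof (rule cocyclesI)
    fix g h k assume ghk: "g \<in> carrier H" "h \<in> carrier H" "k \<in> carrier H"
    note c = centre_act_closed centre_inv_closed sD(1) N.centre_closed
    have "centre_act \<omega> g (inv (\<sigma> (h, k))) \<otimes> inv (\<sigma> (g, h \<otimes>\<^bsub>H\<^esub> k))
        = inv (centre_act \<omega> g (\<sigma> (h, k)) \<otimes> \<sigma> (g, h \<otimes>\<^bsub>H\<^esub> k))"
      using ghk by (simp add: c centre_act_inv N.inv_mult_group centre_comm)
    also have "\<dots> = inv (\<sigma> (g, h) \<otimes> \<sigma> (g \<otimes>\<^bsub>H\<^esub> h, k))" using ghk by (simp only: sD(2))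
    also have "\<dots> = inv (\<sigma> (g, h)) \<otimes> inv (\<sigma> (g \<otimes>\<^bsub>H\<^esub> h, k))"
      using ghk by (simp add: c N.inv_mult_group centre_comm)
    finally show "centre_act \<omega> g ((\<lambda>x\<in>carrier H \<times> carrier H. inv (\<sigma> x)) (h, k))
        \<otimes> (\<lambda>x\<in>carrier H \<times> carrier H. inv (\<sigma> x)) (g, h \<otimes>\<^bsub>H\<^esub> k)
        = (\<lambda>x\<in>carrier H \<times> carrier H. inv (\<sigma> x)) (g, h)
        \<otimes> (\<lambda>x\<in>carrier H \<times> carrier H. inv (\<sigma> x)) (g \<otimes>\<^bsub>H\<^esub> h, k)"
      using ghk by simp
  qed (simp_all add: sD(1) centre_inv_closed)
  moreover have "(\<lambda>x\<in>carrier H \<times> carrier H. inv (\<sigma> x)) \<otimes>\<^bsub>cocycle_group N H \<omega>\<^esub> \<sigma> = \<one>\<^bsub>cocycle_group N H \<omega>\<^esub>"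
    unfolding mult_cocycle_group one_cocycle_group
    by (rule pair_extensionalityI) (simp_all add: sD N.centre_closed)
  ultimately show "\<exists>\<tau>\<in>carrier (cocycle_group N H \<omega>). \<tau> \<otimes>\<^bsub>cocycle_group N H \<omega>\<^esub> \<sigma> = \<one>\<^bsub>cocycle_group N H \<omega>\<^esub>"
    unfolding carrier_cocycle_group by blast
next
  fix \<rho> \<sigma> \<tau>
  assume "\<rho> \<in> carrier (cocycle_group N H \<omega>)" "\<sigma> \<in> carrier (cocycle_group N H \<omega>)"
    "\<tau> \<in> carrier (cocycle_group N H \<omega>)"
  then show "\<rho> \<otimes>\<^bsub>cocycle_group N H \<omega>\<^esub> \<sigma> \<otimes>\<^bsub>cocycle_group N H \<omega>\<^esub> \<tau>
      = \<rho> \<otimes>\<^bsub>cocycle_group N H \<omega>\<^esub> (\<sigma> \<otimes>\<^bsub>cocycle_group N H \<omega>\<^esub> \<tau>)"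
    unfolding mult_cocycle_group carrier_cocycle_group
    by (intro pair_extensionalityI) (simp_all add: cocyclesD(1) N.centre_closed N.m_assoc)
next
  show "\<one>\<^bsub>cocycle_group N H \<omega>\<^esub> \<in> carrier (cocycle_group N H \<omega>)"
    unfolding carrier_cocycle_group one_cocycle_group
    by (rule cocyclesI) (simp_all add: centre_one_closed centre_act_unit)
qed

lemma coboundary_apply:
  "g \<in> carrier H \<Longrightarrow> h \<in> carrier H \<Longrightarrow>
    coboundary N H \<omega> \<sigma> (g, h) = centre_act \<omega> g (\<sigma> h) \<otimes> inv (\<sigma> (g \<otimes>\<^bsub>H\<^esub> h)) \<otimes> \<sigma> g"
  by (simp add: coboundary_def)

lemma coboundary_extensional: "coboundary N H \<omega> \<sigma> \<in> extensional (carrier H \<times> carrier H)"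
  by (simp add: coboundary_def)

text \<open>
After expanding, both sides of the cocycle identity consist of the same four central factors, together
with a cancelling pair.
\<close>

lemma coboundary_cocycle:
  assumes "\<sigma> \<in> carrier H \<rightarrow> centre N"
  shows "coboundary N H \<omega> \<sigma> \<in> cocycles N H \<omega>"
proof (rule cocyclesI[OF _ _ coboundary_extensional])
  have s: "\<sigma> h \<in> centre N" if "h \<in> carrier H" for h using assms that by auto
  note c = centre_intros s N.centre_closed
  show "coboundary N H \<omega> \<sigma> (g, h) \<in> centre N" if "g \<in> carrier H" "h \<in> carrier H" for g h
    using that by (simp add: coboundary_apply c)
  have cancel: "(a \<otimes> inv b \<otimes> c) \<otimes> (b \<otimes> inv d \<otimes> e) = (c \<otimes> inv f \<otimes> e) \<otimes> (a \<otimes> inv d \<otimes> f)"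
    if z: "a \<in> centre N" "b \<in> centre N" "c \<in> centre N" "d \<in> centre N" "e \<in> centre N" "f \<in> centre N"
    for a b c d e f
  proof -
    note zc = z z[THEN N.centre_closed] centre_inv_closed
    have swap: "(a \<otimes> b' \<otimes> c) \<otimes> (b \<otimes> inv d \<otimes> e) = (b \<otimes> b') \<otimes> (a \<otimes> inv d \<otimes> c \<otimes> e)"
      "(c \<otimes> f' \<otimes> e) \<otimes> (a \<otimes> inv d \<otimes> f) = (f \<otimes> f') \<otimes> (a \<otimes> inv d \<otimes> c \<otimes> e)"
      if "b' \<in> centre N" "f' \<in> centre N" for b' f'
      using that by (simp_all add: zc N.centre_closed centre_m_closed centre_ac)
    have "(a \<otimes> inv b \<otimes> c) \<otimes> (b \<otimes> inv d \<otimes> e) = (b \<otimes> inv b) \<otimes> (a \<otimes> inv d \<otimes> c \<otimes> e)"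
      by (rule swap(1)[of _ \<one>]) (simp_all add: zc centre_one_closed)
    also have "\<dots> = (f \<otimes> inv f) \<otimes> (a \<otimes> inv d \<otimes> c \<otimes> e)" by (simp add: zc)
    also have "\<dots> = (c \<otimes> inv f \<otimes> e) \<otimes> (a \<otimes> inv d \<otimes> f)"
      by (rule swap(2)[of \<one>, symmetric]) (simp_all add: zc centre_one_closed)
    finally show ?thesis .
  qed
  fix g h k assume ghk: "g \<in> carrier H" "h \<in> carrier H" "k \<in> carrier H"
  then show "centre_act \<omega> g (coboundary N H \<omega> \<sigma> (h, k)) \<otimes> coboundary N H \<omega> \<sigma> (g, h \<otimes>\<^bsub>H\<^esub> k)
      = coboundary N H \<omega> \<sigma> (g, h) \<otimes> coboundary N H \<omega> \<sigma> (g \<otimes>\<^bsub>H\<^esub> h, k)"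
    by (simp add: coboundary_apply centre_act_mult centre_act_inv centre_intros s cancel
        centre_act_comp[symmetric] H.m_assoc)
qed

lemma coboundary_mult:
  assumes "\<sigma> \<in> carrier H \<rightarrow> centre N" "\<rho> \<in> carrier H \<rightarrow> centre N"
  shows "coboundary N H \<omega> (\<lambda>h. \<sigma> h \<otimes> \<rho> h)
    = coboundary N H \<omega> \<sigma> \<otimes>\<^bsub>cocycle_group N H \<omega>\<^esub> coboundary N H \<omega> \<rho>"
proof (rule pair_extensionalityI[OF coboundary_extensional])
  have s: "\<sigma> h \<in> centre N" "\<rho> h \<in> centre N" if "h \<in> carrier H" for h using assms that by auto
  fix g h assume "g \<in> carrier H" "h \<in> carrier H"
  then show "coboundary N H \<omega> (\<lambda>h. \<sigma> h \<otimes> \<rho> h) (g, h)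
      = (coboundary N H \<omega> \<sigma> \<otimes>\<^bsub>cocycle_group N H \<omega>\<^esub> coboundary N H \<omega> \<rho>) (g, h)"
    by (simp add: coboundary_apply mult_cocycle_group centre_act_mult N.inv_mult_group s
        centre_intros N.centre_closed centre_ac)
qed (simp add: mult_cocycle_group)

lemma subgroup_coboundaries: "subgroup coboundaries (cocycle_group N H \<omega>)"
proof -
  interpret C: comm_group "cocycle_group N H \<omega>" by (rule comm_group_cocycles)
  have one: "coboundary N H \<omega> (\<lambda>h. \<one>) = \<one>\<^bsub>cocycle_group N H \<omega>\<^esub>"
    by (rule pair_extensionalityI[OF coboundary_extensional])
      (simp_all add: one_cocycle_group coboundary_apply centre_act_unit)
  show ?thesis
  proof (rule C.subgroupI)
    show "coboundaries \<subseteq> carrier (cocycle_group N H \<omega>)"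
      by (auto simp: carrier_cocycle_group coboundary_cocycle)
    show "coboundaries \<noteq> {}" using centre_one_closed by auto
  next
    fix a assume "a \<in> coboundaries"
    then obtain \<sigma> where \<sigma>: "\<sigma> \<in> carrier H \<rightarrow> centre N" "a = coboundary N H \<omega> \<sigma>" by auto
    have inv: "(\<lambda>h. inv (\<sigma> h)) \<in> carrier H \<rightarrow> centre N" using \<sigma>(1) by (auto intro!: centre_inv_closed)
    have "coboundary N H \<omega> (\<lambda>h. inv (\<sigma> h)) \<otimes>\<^bsub>cocycle_group N H \<omega>\<^esub> a = coboundary N H \<omega> (\<lambda>h. inv (\<sigma> h) \<otimes> \<sigma> h)"
      by (simp add: coboundary_mult[OF inv \<sigma>(1)] \<sigma>(2))
    also have "\<dots> = coboundary N H \<omega> (\<lambda>h. \<one>)"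
      unfolding coboundary_def
      by (rule restrict_ext) (use \<sigma>(1) in \<open>auto simp: N.centre_closed Pi_iff\<close>)
    also have "\<dots> = \<one>\<^bsub>cocycle_group N H \<omega>\<^esub>" by (rule one)
    finally have "inv\<^bsub>cocycle_group N H \<omega>\<^esub> a = coboundary N H \<omega> (\<lambda>h. inv (\<sigma> h))"
      using \<sigma> inv by (intro C.inv_equality) (simp_all add: carrier_cocycle_group coboundary_cocycle)
    then show "inv\<^bsub>cocycle_group N H \<omega>\<^esub> a \<in> coboundaries" using inv by simp
  next
    fix a b assume "a \<in> coboundaries" "b \<in> coboundaries"
    then obtain \<sigma> \<rho> where \<sigma>: "\<sigma> \<in> carrier H \<rightarrow> centre N" "a = coboundary N H \<omega> \<sigma>"
      and \<rho>: "\<rho> \<in> carrier H \<rightarrow> centre N" "b = coboundary N H \<omega> \<rho>" by auto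
    have "(\<lambda>h. \<sigma> h \<otimes> \<rho> h) \<in> carrier H \<rightarrow> centre N"
      using \<sigma>(1) \<rho>(1) by (auto intro!: centre_m_closed)
    then show "a \<otimes>\<^bsub>cocycle_group N H \<omega>\<^esub> b \<in> coboundaries"
      unfolding \<sigma>(2) \<rho>(2) coboundary_mult[OF \<sigma>(1) \<rho>(1), symmetric] by (rule imageI)
  qed
qed

lemma normal_coboundaries: "coboundaries \<lhd> cocycle_group N H \<omega>"
  by (rule comm_group.subgroup_imp_normal[OF comm_group_cocycles subgroup_coboundaries])

lemma group_H2: "group (H2 N H \<omega>)"
  unfolding H2_def by (rule normal.factorgroup_is_group[OF normal_coboundaries])

lemma carrier_H2: "carrier (H2 N H \<omega>) = cohom_class ` cocycles N H \<omega>"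
  by (simp add: H2_def carrier_FactGroup carrier_cocycle_group)

lemma coho_mult:
  assumes "\<sigma> \<in> cocycles N H \<omega>" "\<tau> \<in> cocycles N H \<omega>"
  shows "cohom_class \<sigma> \<otimes>\<^bsub>H2 N H \<omega>\<^esub> cohom_class \<tau> = cohom_class (\<sigma> \<otimes>\<^bsub>cocycle_group N H \<omega>\<^esub> \<tau>)"
  using assms normal.rcos_sum[OF normal_coboundaries]
  by (simp add: H2_def carrier_cocycle_group)

lemma coho_one: "cohom_class \<one>\<^bsub>cocycle_group N H \<omega>\<^esub> = \<one>\<^bsub>H2 N H \<omega>\<^esub>"
proof -
  interpret C: comm_group "cocycle_group N H \<omega>" by (rule comm_group_cocycles)
  show ?thesis using C.coset_mult_one subgroup.subset[OF subgroup_coboundaries] by (simp add: H2_def)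
qed

lemma coho_self: "\<tau> \<in> cocycles N H \<omega> \<Longrightarrow> \<tau> \<in> cohom_class \<tau>"
  using group.rcos_self[OF comm_group.axioms(2)[OF comm_group_cocycles] _ subgroup_coboundaries]
  by (simp add: carrier_cocycle_group)

lemma mem_coho:
  assumes "\<tau> \<in> cocycles N H \<omega>" "\<tau>' \<in> cohom_class \<tau>"
  shows "\<tau>' \<in> cocycles N H \<omega>" "cohom_class \<tau>' = cohom_class \<tau>"
proof -
  interpret C: comm_group "cocycle_group N H \<omega>" by (rule comm_group_cocycles)
  show "cohom_class \<tau>' = cohom_class \<tau>"
    using C.repr_independence[OF assms(2) _ subgroup_coboundaries] assms(1)
    by (simp add: carrier_cocycle_group)
  show "\<tau>' \<in> cocycles N H \<omega>"
    using subgroup.elemrcos_carrier[OF subgroup_coboundaries C.group_axioms _ assms(2)] assms(1)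
    by (simp add: carrier_cocycle_group)
qed

lemma coho_eq_iff:
  assumes "\<tau> \<in> cocycles N H \<omega>" "\<tau>' \<in> cocycles N H \<omega>"
  shows "cohom_class \<tau> = cohom_class \<tau>' \<longleftrightarrow> (\<exists>\<sigma>\<in>carrier H \<rightarrow> centre N.
    \<forall>g\<in>carrier H. \<forall>h\<in>carrier H. \<tau> (g, h) = coboundary N H \<omega> \<sigma> (g, h) \<otimes> \<tau>' (g, h))"
proof -
  have "cohom_class \<tau> = cohom_class \<tau>' \<longleftrightarrow> \<tau> \<in> cohom_class \<tau>'"
    using coho_self[OF assms(1)] mem_coho(2)[OF assms(2), of \<tau>] by auto
  also have "\<dots> \<longleftrightarrow> (\<exists>\<sigma>\<in>carrier H \<rightarrow> centre N. \<tau> = coboundary N H \<omega> \<sigma> \<otimes>\<^bsub>cocycle_group N H \<omega>\<^esub> \<tau>')"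
    by (auto simp: r_coset_def)
  also have "\<dots> \<longleftrightarrow> (\<exists>\<sigma>\<in>carrier H \<rightarrow> centre N.
    \<forall>g\<in>carrier H. \<forall>h\<in>carrier H. \<tau> (g, h) = coboundary N H \<omega> \<sigma> (g, h) \<otimes> \<tau>' (g, h))"
  proof (rule bex_cong[OF refl])
    fix \<sigma>
    show "\<tau> = coboundary N H \<omega> \<sigma> \<otimes>\<^bsub>cocycle_group N H \<omega>\<^esub> \<tau>' \<longleftrightarrow>
      (\<forall>g\<in>carrier H. \<forall>h\<in>carrier H. \<tau> (g, h) = coboundary N H \<omega> \<sigma> (g, h) \<otimes> \<tau>' (g, h))" (is "?A \<longleftrightarrow> ?B")
    proof
      assume ?A
      show ?B
      proof (intro ballI)
        fix g h assume gh: "g \<in> carrier H" "h \<in> carrier H"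
        show "\<tau> (g, h) = coboundary N H \<omega> \<sigma> (g, h) \<otimes> \<tau>' (g, h)"
          by (subst \<open>?A\<close>) (simp add: mult_cocycle_group gh)
      qed
    next
      assume ?B
      then show ?A
        by (intro pair_extensionalityI[OF cocyclesD(3)[OF assms(1)]]) (simp_all add: mult_cocycle_group)
    qed
  qed
  finally show ?thesis .
qed

text \<open>
The cocycle identity forces \<open>\<tau> (\<one>, h) = z\<close> and \<open>\<tau> (h, \<one>) = h \<cdot> z\<close> for
\<open>z = \<tau> (\<one>, \<one>)\<close>, and the coboundary of the constant function \<open>z\<^sup>-\<^sup>1\<close> has the inverse
values at these places.
\<close>

lemma H2_normalised:
  assumes "c \<in> carrier (H2 N H \<omega>)"
  obtains \<tau> where "\<tau> \<in> cocycles N H \<omega>" "normalised \<tau>" "c = cohom_class \<tau>"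
proof -
  interpret C: comm_group "cocycle_group N H \<omega>" by (rule comm_group_cocycles)
  obtain \<tau> where \<tau>: "\<tau> \<in> cocycles N H \<omega>" "c = cohom_class \<tau>" using assms by (auto simp: carrier_H2)
  note tD = cocyclesD[OF \<tau>(1)]
  let ?z = "\<tau> (\<one>\<^bsub>H\<^esub>, \<one>\<^bsub>H\<^esub>)"
  have z: "?z \<in> centre N" by (simp add: tD(1))
  have left: "\<tau> (\<one>\<^bsub>H\<^esub>, h) = ?z" if "h \<in> carrier H" for h
    using tD(2)[of "\<one>\<^bsub>H\<^esub>" "\<one>\<^bsub>H\<^esub>" h] that
    by (simp add: centre_act_one tD(1) N.centre_closed)
  have right: "\<tau> (h, \<one>\<^bsub>H\<^esub>) = centre_act \<omega> h ?z" if "h \<in> carrier H" for h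
    using tD(2)[of h "\<one>\<^bsub>H\<^esub>" "\<one>\<^bsub>H\<^esub>"] that
    by (simp add: centre_act_closed tD(1) N.centre_closed)
  define \<sigma> where "\<sigma> = (\<lambda>h :: 'h. inv ?z)"
  have \<sigma>: "\<sigma> \<in> carrier H \<rightarrow> centre N" using z by (simp add: \<sigma>_def centre_inv_closed)
  define \<tau>' where "\<tau>' = coboundary N H \<omega> \<sigma> \<otimes>\<^bsub>cocycle_group N H \<omega>\<^esub> \<tau>"
  have \<tau>': "\<tau>' (g, h) = inv (centre_act \<omega> g ?z) \<otimes> \<tau> (g, h)"
    if "g \<in> carrier H" "h \<in> carrier H" for g h
    using that z by (simp add: \<tau>'_def mult_cocycle_group coboundary_apply \<sigma>_def centre_act_inv
        centre_intros N.centre_closed N.m_assoc)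
  have "\<tau>' \<in> cohom_class \<tau>" using \<sigma> by (auto simp: r_coset_def \<tau>'_def)
  moreover have "normalised \<tau>'"
    unfolding normalised_def
  proof (intro ballI conjI)
    fix g assume g: "g \<in> carrier H"
    show "\<tau>' (\<one>\<^bsub>H\<^esub>, g) = \<one>"
      unfolding \<tau>'[OF H.one_closed g] left[OF g] using z by (simp add: centre_act_one N.centre_closed)
    show "\<tau>' (g, \<one>\<^bsub>H\<^esub>) = \<one>"
      unfolding \<tau>'[OF g H.one_closed] right[OF g]
      using z g by (simp add: centre_act_closed N.centre_closed)
  qed
  ultimately show thesis using that mem_coho[OF \<tau>(1)] \<tau>(2) by metis
qed

lemma K_ofD:
  assumes "k \<in> carrier (K_of N H \<omega>)"
  shows "k \<in> carrier (K N H)" "act_Hom N H k \<omega> = \<omega>" "fst k \<in> auto N" "snd k \<in> auto H"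
  using assms by (auto simp: K_of_def stabilizer_def carrier_K)

lemma act_lift_lifts:
  assumes k: "k \<in> carrier (K_of N H \<omega>)" and \<phi>: "lifts \<phi>"
  shows "lifts (act_lift N H k \<phi>)"
  unfolding lifts_def
proof (intro ballI conjI)
  note kD = K_ofD[OF k]
  fix h assume h: "h \<in> carrier H"
  have \<beta>h: "(inv\<^bsub>AutoGroup H\<^esub> (snd k)) h \<in> carrier H" using kD(4) h by (simp add: H.auto_simps)
  show "act_lift N H k \<phi> h \<in> auto N"
    using kD(3) liftsD[OF \<phi> \<beta>h] by (simp add: act_lift_def N.auto_simps)
  have "out_class N (act_lift N H k \<phi> h) = act_Hom N H k \<omega> h"
    using kD(3) liftsD[OF \<phi> \<beta>h] h
    by (simp add: act_lift_def act_Hom_def N.out_class_mult[symmetric] N.out_class_inv N.auto_simps)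
  then show "out_class N (act_lift N H k \<phi> h) = \<omega> h" by (simp add: kD(2))
qed

text \<open>
This is where the stabiliser of \<open>\<omega>\<close> enters: \<open>\<alpha> \<phi> (\<beta>\<^sup>-\<^sup>1 h) \<alpha>\<^sup>-\<^sup>1\<close> is again a lift of
\<open>\<omega> h\<close>, so it may be used to compute the action on the centre.
\<close>

lemma centre_act_equivariant:
  assumes k: "k \<in> carrier (K_of N H \<omega>)" and h: "h \<in> carrier H" and z: "z \<in> centre N"
  shows "centre_act \<omega> h (fst k z) = fst k (centre_act \<omega> ((inv\<^bsub>AutoGroup H\<^esub> (snd k)) h) z)"
proof -
  note kD = K_ofD[OF k]
  have "\<exists>\<phi>. \<forall>h\<in>carrier H. \<phi> h \<in> auto N \<and> out_class N (\<phi> h) = \<omega> h"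
    by (rule bchoice) (use coupling_lift in blast)
  then obtain \<phi> where \<phi>: "lifts \<phi>" by (auto simp: lifts_def)
  have \<beta>h: "(inv\<^bsub>AutoGroup H\<^esub> (snd k)) h \<in> carrier H" using kD(4) h by (simp add: H.auto_simps)
  have "centre_act \<omega> h (fst k z) = act_lift N H k \<phi> h (fst k z)"
    by (rule centre_act_lift[OF act_lift_lifts[OF k \<phi>] h N.auto_centre[OF kD(3) z]])
  also have "\<dots> = fst k (\<phi> ((inv\<^bsub>AutoGroup H\<^esub> (snd k)) h) z)"
    using kD(3) liftsD(1)[OF \<phi> \<beta>h] z by (simp add: act_lift_def N.auto_simps N.centre_closed)
  finally show ?thesis by (simp add: centre_act_lift[OF \<phi> \<beta>h z])
qed

lemma act_cocycle_apply:
  "g \<in> carrier H \<Longrightarrow> h \<in> carrier H \<Longrightarrow> act_cocycle H k \<tau> (g, h)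
    = fst k (\<tau> ((inv\<^bsub>AutoGroup H\<^esub> (snd k)) g, (inv\<^bsub>AutoGroup H\<^esub> (snd k)) h))"
  by (simp add: act_cocycle_def)

lemma act_cocycle_extensional: "act_cocycle H k \<tau> \<in> extensional (carrier H \<times> carrier H)"
  by (simp add: act_cocycle_def)

lemma act_cocycle_closed:
  assumes k: "k \<in> carrier (K_of N H \<omega>)" and \<tau>: "\<tau> \<in> cocycles N H \<omega>"
  shows "act_cocycle H k \<tau> \<in> cocycles N H \<omega>"
proof (rule cocyclesI[OF _ _ act_cocycle_extensional])
  note kD = K_ofD[OF k] and tD = cocyclesD[OF \<tau>]
  have \<beta>: "inv\<^bsub>AutoGroup H\<^esub> (snd k) \<in> auto H" using kD(4) by (rule H.auto_inv_closed)
  note c = tD(1) H.auto_closed[OF \<beta>] N.auto_centre[OF kD(3)] N.centre_closed centre_act_closed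
  show "act_cocycle H k \<tau> (g, h) \<in> centre N" if "g \<in> carrier H" "h \<in> carrier H" for g h
    using that by (simp add: act_cocycle_apply c)
  show "centre_act \<omega> g (act_cocycle H k \<tau> (h, l)) \<otimes> act_cocycle H k \<tau> (g, h \<otimes>\<^bsub>H\<^esub> l)
      = act_cocycle H k \<tau> (g, h) \<otimes> act_cocycle H k \<tau> (g \<otimes>\<^bsub>H\<^esub> h, l)"
    if "g \<in> carrier H" "h \<in> carrier H" "l \<in> carrier H" for g h l
    using that by (simp add: act_cocycle_apply c centre_act_equivariant[OF k] H.auto_mult[OF \<beta>]
        N.auto_mult[OF kD(3), symmetric] tD(2))
qed

lemma act_cocycle_normalised:
  assumes k: "k \<in> carrier (K_of N H \<omega>)" and "normalised \<tau>"
  shows "normalised (act_cocycle H k \<tau>)"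
proof -
  note kD = K_ofD[OF k]
  have \<beta>: "inv\<^bsub>AutoGroup H\<^esub> (snd k) \<in> auto H" using kD(4) by (rule H.auto_inv_closed)
  show ?thesis
    using assms(2) by (simp add: normalised_def act_cocycle_apply H.auto_one[OF \<beta>]
        H.auto_closed[OF \<beta>] N.auto_one[OF kD(3)])
qed

lemma act_cocycle_coboundary:
  assumes k: "k \<in> carrier (K_of N H \<omega>)" and \<sigma>: "\<sigma> \<in> carrier H \<rightarrow> centre N"
  shows "act_cocycle H k (coboundary N H \<omega> \<sigma>)
    = coboundary N H \<omega> (\<lambda>h. fst k (\<sigma> ((inv\<^bsub>AutoGroup H\<^esub> (snd k)) h)))"
proof (rule pair_extensionalityI[OF act_cocycle_extensional coboundary_extensional])
  note kD = K_ofD[OF k]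
  have \<beta>: "inv\<^bsub>AutoGroup H\<^esub> (snd k) \<in> auto H" using kD(4) by (rule H.auto_inv_closed)
  have s: "\<sigma> h \<in> centre N" if "h \<in> carrier H" for h using \<sigma> that by auto
  note c = s H.auto_closed[OF \<beta>] N.auto_closed[OF kD(3)] N.auto_centre[OF kD(3)] centre_intros
    N.centre_closed
  fix g h assume "g \<in> carrier H" "h \<in> carrier H"
  then show "act_cocycle H k (coboundary N H \<omega> \<sigma>) (g, h)
    = coboundary N H \<omega> (\<lambda>h. fst k (\<sigma> ((inv\<^bsub>AutoGroup H\<^esub> (snd k)) h))) (g, h)"
    by (simp add: act_cocycle_apply coboundary_apply c centre_act_equivariant[OF k]
        H.auto_mult[OF \<beta>] N.auto_mult[OF kD(3)] N.auto_m_inv[OF kD(3)])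
qed

lemma act_cocycle_mult:
  assumes k: "k \<in> carrier (K_of N H \<omega>)"
    and "\<sigma> \<in> cocycles N H \<omega>" "\<tau> \<in> cocycles N H \<omega>"
  shows "act_cocycle H k (\<sigma> \<otimes>\<^bsub>cocycle_group N H \<omega>\<^esub> \<tau>)
    = act_cocycle H k \<sigma> \<otimes>\<^bsub>cocycle_group N H \<omega>\<^esub> act_cocycle H k \<tau>"
proof (rule pair_extensionalityI[OF act_cocycle_extensional])
  note kD = K_ofD[OF k]
  have \<beta>: "inv\<^bsub>AutoGroup H\<^esub> (snd k) \<in> auto H" using kD(4) by (rule H.auto_inv_closed)
  fix g h assume "g \<in> carrier H" "h \<in> carrier H"
  then show "act_cocycle H k (\<sigma> \<otimes>\<^bsub>cocycle_group N H \<omega>\<^esub> \<tau>) (g, h)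
    = (act_cocycle H k \<sigma> \<otimes>\<^bsub>cocycle_group N H \<omega>\<^esub> act_cocycle H k \<tau>) (g, h)"
    using assms(2,3) by (simp add: act_cocycle_apply mult_cocycle_group H.auto_closed[OF \<beta>]
        cocyclesD(1) N.centre_closed N.auto_mult[OF kD(3)])
qed (simp add: mult_cocycle_group)

text \<open>
The image of a coset is a coset because \<open>act_cocycle H k\<close> is multiplicative and permutes the
coboundaries; a coboundary is hit because \<open>\<alpha>\<close> and \<open>\<beta>\<close> can be undone on the cochain.
\<close>

lemma act_H2_coho:
  assumes k: "k \<in> carrier (K_of N H \<omega>)" and \<tau>: "\<tau> \<in> cocycles N H \<omega>"
  shows "act_H2 H k (cohom_class \<tau>) = cohom_class (act_cocycle H k \<tau>)"
proof -
  note kD = K_ofD[OF k]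
  have \<beta>: "inv\<^bsub>AutoGroup H\<^esub> (snd k) \<in> auto H" using kD(4) by (rule H.auto_inv_closed)
  have "act_cocycle H k ` coboundaries = coboundaries"
  proof (intro subset_antisym subsetI)
    fix a assume "a \<in> act_cocycle H k ` coboundaries"
    then obtain \<sigma> where \<sigma>: "\<sigma> \<in> carrier H \<rightarrow> centre N" "a = act_cocycle H k (coboundary N H \<omega> \<sigma>)"
      by auto
    have "(\<lambda>h. fst k (\<sigma> ((inv\<^bsub>AutoGroup H\<^esub> (snd k)) h))) \<in> carrier H \<rightarrow> centre N"
      using \<sigma>(1) H.auto_closed[OF \<beta>] N.auto_centre[OF kD(3)] by auto
    then show "a \<in> coboundaries"
      unfolding \<sigma>(2) act_cocycle_coboundary[OF k \<sigma>(1)] by (rule imageI)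
  next
    fix a assume "a \<in> coboundaries"
    then obtain \<sigma> where \<sigma>: "\<sigma> \<in> carrier H \<rightarrow> centre N" "a = coboundary N H \<omega> \<sigma>" by auto
    let ?\<rho> = "\<lambda>h. (inv\<^bsub>AutoGroup N\<^esub> (fst k)) (\<sigma> (snd k h))"
    have \<rho>: "?\<rho> \<in> carrier H \<rightarrow> centre N"
      using \<sigma>(1) H.auto_closed[OF kD(4)] N.auto_centre[OF N.auto_inv_closed[OF kD(3)]] by auto
    have "coboundary N H \<omega> (\<lambda>h. fst k (?\<rho> ((inv\<^bsub>AutoGroup H\<^esub> (snd k)) h))) = a"
    proof (rule pair_extensionalityI[OF coboundary_extensional])
      have eq: "fst k (?\<rho> ((inv\<^bsub>AutoGroup H\<^esub> (snd k)) h)) = \<sigma> h" if "h \<in> carrier H" for h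
        using that \<sigma>(1) kD(3,4) by (auto simp: H.auto_inv_apply N.auto_inv_apply N.centre_closed Pi_iff)
      show "coboundary N H \<omega> (\<lambda>h. fst k (?\<rho> ((inv\<^bsub>AutoGroup H\<^esub> (snd k)) h))) (g, h) = a (g, h)"
        if "g \<in> carrier H" "h \<in> carrier H" for g h
        using that by (simp add: \<sigma>(2) coboundary_apply eq)
    qed (simp add: \<sigma>(2) coboundary_extensional)
    then show "a \<in> act_cocycle H k ` coboundaries"
      using act_cocycle_coboundary[OF k \<rho>] \<rho> by (metis imageI)
  qed
  note coboundaries = this
  have coset: "cohom_class \<rho> = (\<lambda>b. b \<otimes>\<^bsub>cocycle_group N H \<omega>\<^esub> \<rho>) ` coboundaries" for \<rho>
    by (auto simp: r_coset_def)
  have "act_cocycle H k ` cohom_class \<tau>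
      = (\<lambda>b. act_cocycle H k (b \<otimes>\<^bsub>cocycle_group N H \<omega>\<^esub> \<tau>)) ` coboundaries"
    unfolding coset by (rule image_image)
  also have "\<dots> = (\<lambda>b. act_cocycle H k b \<otimes>\<^bsub>cocycle_group N H \<omega>\<^esub> act_cocycle H k \<tau>) ` coboundaries"
    by (rule image_cong[OF refl]) (use \<tau> coboundary_cocycle in \<open>auto intro: act_cocycle_mult[OF k]\<close>)
  also have "\<dots> = (\<lambda>b. b \<otimes>\<^bsub>cocycle_group N H \<omega>\<^esub> act_cocycle H k \<tau>) ` (act_cocycle H k ` coboundaries)"
    by (rule image_image[symmetric])
  finally show ?thesis unfolding coboundaries coset[symmetric] act_H2_def .
qed

lemma act_H2_closed:
  assumes k: "k \<in> carrier (K_of N H \<omega>)" and c: "c \<in> carrier (H2 N H \<omega>)"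
  shows "act_H2 H k c \<in> carrier (H2 N H \<omega>)"
  using c act_cocycle_closed[OF k] by (auto simp: carrier_H2 act_H2_coho[OF k])

end

section \<open>The torsor of extensions with a given coupling\<close>

context group_pair_coupling
begin

text \<open>
Central values can be moved to the front, so the conditions on \<open>f\<close> and on \<open>\<tau>\<close> separate.
\<close>

lemma twist_factor_set:
  assumes fs: "factor_set N H \<phi> f" and \<phi>: "lifts \<phi>"
    and \<tau>: "\<tau> \<in> cocycles N H \<omega>" "normalised \<tau>"
  shows "factor_set N H \<phi> (\<lambda>x. \<tau> x \<otimes> f x)"
  unfolding factor_set_def
proof (intro conjI ballI)
  note fsD = factor_setD[OF fs] and tD = cocyclesD[OF \<tau>(1)]
  note c = fsD(1,2) tD(1) N.centre_closed N.auto_closed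
  show "\<phi> \<in> carrier H \<rightarrow> auto N" "(\<lambda>x. \<tau> x \<otimes> f x) \<in> carrier H \<times> carrier H \<rightarrow> carrier N"
    by (auto simp: c)
  show "\<tau> (\<one>\<^bsub>H\<^esub>, h) \<otimes> f (\<one>\<^bsub>H\<^esub>, h) = \<one>" "\<tau> (h, \<one>\<^bsub>H\<^esub>) \<otimes> f (h, \<one>\<^bsub>H\<^esub>) = \<one>"
    if "h \<in> carrier H" for h
    using that \<tau>(2) by (simp_all add: normalised_def fsD(3,4))
  fix g h assume gh: "g \<in> carrier H" "h \<in> carrier H"
  show "\<phi> g (\<phi> h x) \<otimes> (\<tau> (g, h) \<otimes> f (g, h)) = \<tau> (g, h) \<otimes> f (g, h) \<otimes> \<phi> (g \<otimes>\<^bsub>H\<^esub> h) x"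
    if "x \<in> carrier N" for x
    using gh that N.centre_left_commutes[OF tD(1)[OF gh], of "\<phi> g (\<phi> h x)" "f (g, h)"]
    by (simp add: c N.m_assoc fsD(5))
  fix k assume k: "k \<in> carrier H"
  have "\<phi> g (\<tau> (h, k) \<otimes> f (h, k)) \<otimes> (\<tau> (g, h \<otimes>\<^bsub>H\<^esub> k) \<otimes> f (g, h \<otimes>\<^bsub>H\<^esub> k))
      = centre_act \<omega> g (\<tau> (h, k)) \<otimes> (\<phi> g (f (h, k)) \<otimes> (\<tau> (g, h \<otimes>\<^bsub>H\<^esub> k) \<otimes> f (g, h \<otimes>\<^bsub>H\<^esub> k)))"
    using gh k by (simp add: centre_act_lift[OF \<phi>] c N.auto_mult N.m_assoc)
  also have "\<dots> = (centre_act \<omega> g (\<tau> (h, k)) \<otimes> \<tau> (g, h \<otimes>\<^bsub>H\<^esub> k))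
      \<otimes> (\<phi> g (f (h, k)) \<otimes> f (g, h \<otimes>\<^bsub>H\<^esub> k))"
    using gh k by (simp add: c centre_act_closed N.m_assoc
        N.centre_left_commutes[of "\<tau> (g, h \<otimes>\<^bsub>H\<^esub> k)" "\<phi> g (f (h, k))"])
  also have "\<dots> = (\<tau> (g, h) \<otimes> \<tau> (g \<otimes>\<^bsub>H\<^esub> h, k)) \<otimes> (f (g, h) \<otimes> f (g \<otimes>\<^bsub>H\<^esub> h, k))"
    by (simp only: tD(2)[OF gh k] fsD(6)[OF gh k])
  also have "\<dots> = \<tau> (g, h) \<otimes> f (g, h) \<otimes> (\<tau> (g \<otimes>\<^bsub>H\<^esub> h, k) \<otimes> f (g \<otimes>\<^bsub>H\<^esub> h, k))"
    using gh k by (simp add: c N.m_assoc N.centre_left_commutes[of "\<tau> (g \<otimes>\<^bsub>H\<^esub> h, k)" "f (g, h)"])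
  finally show "\<phi> g (\<tau> (h, k) \<otimes> f (h, k)) \<otimes> (\<tau> (g, h \<otimes>\<^bsub>H\<^esub> k) \<otimes> f (g, h \<otimes>\<^bsub>H\<^esub> k))
    = \<tau> (g, h) \<otimes> f (g, h) \<otimes> (\<tau> (g \<otimes>\<^bsub>H\<^esub> h, k) \<otimes> f (g \<otimes>\<^bsub>H\<^esub> h, k))" .
qed

text \<open>
With the same \<open>\<phi>\<close> on both sides, the first condition of \<open>crossed_rel_iff\<close> says that \<open>m g\<close>
commutes with the image of \<open>\<phi> g\<close>, which is all of \<open>N\<close>; so \<open>m\<close> is a central cochain. Then
\<open>f\<close> cancels from the second condition, and what remains says that \<open>\<tau>\<close> and \<open>\<tau>'\<close> differ by
the coboundary of \<open>m\<close>.
\<close>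

lemma twist_rel_iff:
  assumes fs: "factor_set N H \<phi> f" and \<phi>: "lifts \<phi>"
    and \<tau>: "\<tau> \<in> cocycles N H \<omega>" "normalised \<tau>"
    and \<tau>': "\<tau>' \<in> cocycles N H \<omega>" "normalised \<tau>'"
  shows "(crossed_ext N H \<phi> (\<lambda>x. \<tau> x \<otimes> f x), crossed_ext N H \<phi> (\<lambda>x. \<tau>' x \<otimes> f x)) \<in> ext_rel N H
    \<longleftrightarrow> cohom_class \<tau> = cohom_class \<tau>'"
proof -
  note fsD = factor_setD[OF fs]
  let ?comm = "\<lambda>m. \<forall>g\<in>carrier H. \<forall>x\<in>carrier N. \<phi> g x \<otimes> m g = m g \<otimes> \<phi> g x"
  have comm_iff: "m \<in> carrier H \<rightarrow> carrier N \<and> ?comm m \<longleftrightarrow> m \<in> carrier H \<rightarrow> centre N" for m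
  proof
    assume m: "m \<in> carrier H \<rightarrow> carrier N \<and> ?comm m"
    have "m g \<in> centre N" if g: "g \<in> carrier H" for g
    proof (rule N.centreI)
      show "m g \<in> carrier N" using m g by auto
      fix x assume x: "x \<in> carrier N"
      let ?y = "(inv\<^bsub>AutoGroup N\<^esub> (\<phi> g)) x"
      have "?y \<in> carrier N" "\<phi> g ?y = x" using fsD(1)[OF g] x by (simp_all add: N.auto_simps)
      then show "m g \<otimes> x = x \<otimes> m g" using m g by metis
    qed
    then show "m \<in> carrier H \<rightarrow> centre N" by auto
  next
    assume m: "m \<in> carrier H \<rightarrow> centre N"
    then have "\<phi> g x \<otimes> m g = m g \<otimes> \<phi> g x" if "g \<in> carrier H" "x \<in> carrier N" for g x
      using that fsD(1) by (intro N.centre_commutes) (auto simp: N.auto_closed)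
    then show "m \<in> carrier H \<rightarrow> carrier N \<and> ?comm m" using m N.centre_closed by blast
  qed
  have cancel: "t \<otimes> y \<otimes> q = r \<otimes> p \<otimes> (t' \<otimes> y) \<longleftrightarrow> t = p \<otimes> inv q \<otimes> r \<otimes> t'"
    if z: "t \<in> centre N" "t' \<in> centre N" "p \<in> centre N" "q \<in> centre N" "r \<in> centre N"
      and y: "y \<in> carrier N" for t t' p q r y
  proof -
    note c = z z[THEN N.centre_closed] centre_m_closed centre_inv_closed N.centre_closed
    have "t \<otimes> y \<otimes> q = r \<otimes> p \<otimes> (t' \<otimes> y) \<longleftrightarrow> (t \<otimes> q) \<otimes> y = (r \<otimes> p \<otimes> t') \<otimes> y"
      using y by (simp add: c N.m_assoc N.centre_commutes[of q y])
    also have "\<dots> \<longleftrightarrow> t \<otimes> q = r \<otimes> p \<otimes> t'" using y by (simp add: c)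
    also have "\<dots> \<longleftrightarrow> t = r \<otimes> p \<otimes> t' \<otimes> inv q" by (subst N.inv_solve_right) (auto simp: c)
    also have "r \<otimes> p \<otimes> t' \<otimes> inv q = p \<otimes> inv q \<otimes> r \<otimes> t'" by (simp add: c centre_ac)
    finally show ?thesis .
  qed
  have eq: "\<tau> (g, h) \<otimes> f (g, h) \<otimes> m (g \<otimes>\<^bsub>H\<^esub> h) = m g \<otimes> \<phi> g (m h) \<otimes> (\<tau>' (g, h) \<otimes> f (g, h))
      \<longleftrightarrow> \<tau> (g, h) = coboundary N H \<omega> m (g, h) \<otimes> \<tau>' (g, h)"
    if m: "m \<in> carrier H \<rightarrow> centre N" and gh: "g \<in> carrier H" "h \<in> carrier H" for m g h
  proof -
    have mz: "m g \<in> centre N" "m h \<in> centre N" "m (g \<otimes>\<^bsub>H\<^esub> h) \<in> centre N" using m gh by auto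
    show ?thesis
      unfolding coboundary_apply[OF gh] centre_act_lift[OF \<phi> gh(1) mz(2)]
      by (rule cancel) (use gh mz cocyclesD(1)[OF \<tau>(1)] cocyclesD(1)[OF \<tau>'(1)] fsD(1,2) in
          \<open>simp_all add: N.auto_centre\<close>)
  qed
  have "(crossed_ext N H \<phi> (\<lambda>x. \<tau> x \<otimes> f x), crossed_ext N H \<phi> (\<lambda>x. \<tau>' x \<otimes> f x)) \<in> ext_rel N H
    \<longleftrightarrow> (\<exists>m. (m \<in> carrier H \<rightarrow> carrier N \<and> ?comm m) \<and>
      (\<forall>g\<in>carrier H. \<forall>h\<in>carrier H. \<tau> (g, h) \<otimes> f (g, h) \<otimes> m (g \<otimes>\<^bsub>H\<^esub> h)
        = m g \<otimes> \<phi> g (m h) \<otimes> (\<tau>' (g, h) \<otimes> f (g, h))))"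
    unfolding crossed_rel_iff[OF twist_factor_set[OF fs \<phi> \<tau>] twist_factor_set[OF fs \<phi> \<tau>']] by blast
  also have "\<dots> \<longleftrightarrow> (\<exists>m. m \<in> carrier H \<rightarrow> centre N \<and>
      (\<forall>g\<in>carrier H. \<forall>h\<in>carrier H. \<tau> (g, h) = coboundary N H \<omega> m (g, h) \<otimes> \<tau>' (g, h)))"
    unfolding comm_iff using eq by (intro ex_cong1 conj_cong refl ball_cong) auto
  also have "\<dots> \<longleftrightarrow> cohom_class \<tau> = cohom_class \<tau>'"
    unfolding coho_eq_iff[OF \<tau>(1) \<tau>'(1)] by blast
  finally show ?thesis .
qed

lemma crossed_ext_cong:
  assumes "factor_set N H \<phi> f" "factor_set N H \<phi> f'"
    and "\<And>g h. g \<in> carrier H \<Longrightarrow> h \<in> carrier H \<Longrightarrow> f (g, h) = f' (g, h)"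
  shows "(crossed_ext N H \<phi> f, crossed_ext N H \<phi> f') \<in> ext_rel N H"
  unfolding crossed_rel_iff[OF assms(1,2)]
  using factor_setD(1,2)[OF assms(2)]
  by (intro bexI[of _ "\<lambda>h. \<one>"]) (simp_all add: assms(3) N.auto_one N.auto_closed)

lemma lifts_rel:
  assumes "factor_set N H \<phi> f" "factor_set N H \<phi>' f'"
    and "(crossed_ext N H \<phi> f, crossed_ext N H \<phi>' f') \<in> ext_rel N H" "lifts \<phi>"
  shows "lifts \<phi>'"
  unfolding lifts_def
proof (intro ballI conjI)
  fix h assume h: "h \<in> carrier H"
  show "\<phi>' h \<in> auto N" by (rule factor_setD(1)[OF assms(2) h])
  show "out_class N (\<phi>' h) = \<omega> h"
    using coupling_ext_rel[OF N.group_axioms H.group_axioms assms(3)] liftsD(2)[OF assms(4) h]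
    by (simp add: coupling_crossed[OF assms(1) h, symmetric] coupling_crossed[OF assms(2) h, symmetric])
qed

lemma crossed_mem_Ex_of:
  assumes "factor_set N H \<phi> f" "lifts \<phi>"
  shows "ext_class N H (crossed_ext N H \<phi> f) \<in> Ex_of N H \<omega>"
proof -
  have "coupling N H (crossed_ext N H \<phi> f) = \<omega>"
    by (rule extensionalityI[of _ "carrier H"])
      (use \<omega> in \<open>simp_all add: coupling_crossed[OF assms(1)] liftsD[OF assms(2)] Hom_Out_def\<close>,
        simp add: coupling_def)
  then show ?thesis using factor_set_extension[OF assms(1)] by (auto simp: Ex_of_def)
qed

lemma Ex_of_crossed:
  assumes "X \<in> Ex_of N H \<omega>" "lifts \<phi>" "\<And>x. x \<in> carrier N \<Longrightarrow> \<phi> \<one>\<^bsub>H\<^esub> x = x"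
  obtains f where "factor_set N H \<phi> f" "X = ext_class N H (crossed_ext N H \<phi> f)"
proof -
  obtain E where E: "is_extension N H E" "coupling N H E = \<omega>" "X = ext_class N H E"
    using assms(1) by (auto simp: Ex_of_def)
  obtain f where "factor_set N H \<phi> f" "(crossed_ext N H \<phi> f, E) \<in> ext_rel N H"
    using extension_crossed[OF E(1), of \<phi>] liftsD[OF assms(2)] assms(3) E(2) by metis
  then show thesis using that ext_class_eqI E(3) by metis
qed

lemma Ex_of_crossed_exists:
  assumes "X \<in> Ex_of N H \<omega>"
  obtains \<phi> f where "lifts \<phi>" "factor_set N H \<phi> f" "X = ext_class N H (crossed_ext N H \<phi> f)"
proof -
  obtain E where E: "is_extension N H E" "coupling N H E = \<omega>" "X = ext_class N H E"
    using assms by (auto simp: Ex_of_def)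
  obtain \<phi> f where fs: "factor_set N H \<phi> f" and r: "(crossed_ext N H \<phi> f, E) \<in> ext_rel N H"
    by (rule extension_factor_set_exists[OF E(1)])
  have "lifts \<phi>"
    using coupling_ext_rel[OF N.group_axioms H.group_axioms r] E(2) factor_setD(1)[OF fs]
    by (simp add: lifts_def coupling_crossed[OF fs, symmetric])
  then show thesis using that fs ext_class_eqI[OF r] E(3) by simp
qed

text \<open>
\<open>shift\<close> is a union over all presentations of the extension class and of the cohomology class. All
members coincide: a change of section \<open>m\<close> between two presentations remains one after twisting by the
same central cocycle, and cohomologous twists of one presentation are equivalent.
\<close>

lemma shift_crossed:
  assumes fs: "factor_set N H \<phi> f" and \<phi>: "lifts \<phi>"
    and \<tau>: "\<tau> \<in> cocycles N H \<omega>" "normalised \<tau>"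
  shows "shift N H (cohom_class \<tau>) (ext_class N H (crossed_ext N H \<phi> f))
    = ext_class N H (crossed_ext N H \<phi> (\<lambda>x. \<tau> x \<otimes> f x))"
proof -
  let ?X = "ext_class N H (crossed_ext N H \<phi> f)"
  have same: "ext_class N H (crossed_ext N H \<phi>' (\<lambda>x. \<tau>' x \<otimes> f' x))
      = ext_class N H (crossed_ext N H \<phi> (\<lambda>x. \<tau> x \<otimes> f x))"
    if mem: "\<phi>' \<in> carrier H \<rightarrow> auto N" "f' \<in> carrier H \<times> carrier H \<rightarrow> carrier N"
      "crossed_ext N H \<phi>' f' \<in> ?X" and \<tau>'_mem: "\<tau>' \<in> cohom_class \<tau>"
      and norm: "\<forall>g\<in>carrier H. \<tau>' (\<one>\<^bsub>H\<^esub>, g) = \<one> \<and> \<tau>' (g, \<one>\<^bsub>H\<^esub>) = \<one>"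
    for \<phi>' f' \<tau>'
  proof -
    have r: "(crossed_ext N H \<phi> f, crossed_ext N H \<phi>' f') \<in> ext_rel N H"
      using mem(3) by (simp add: mem_ext_class_iff)
    then have "is_extension N H (crossed_ext N H \<phi>' f')" by (auto simp: ext_rel_def)
    then have fs': "factor_set N H \<phi>' f'" using mem(1,2) by (rule extension_factor_set)
    have \<phi>': "lifts \<phi>'" by (rule lifts_rel[OF fs fs' r \<phi>])
    have \<tau>': "\<tau>' \<in> cocycles N H \<omega>" "normalised \<tau>'" "cohom_class \<tau>' = cohom_class \<tau>"
      using mem_coho[OF \<tau>(1) \<tau>'_mem] norm by (simp_all add: normalised_def)
    note tD = cocyclesD[OF \<tau>'(1)] and fsD = factor_setD[OF fs] and fsD' = factor_setD[OF fs']
    obtain m where m: "m \<in> carrier H \<rightarrow> carrier N"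
      "\<And>g x. g \<in> carrier H \<Longrightarrow> x \<in> carrier N \<Longrightarrow> \<phi> g x \<otimes> m g = m g \<otimes> \<phi>' g x"
      "\<And>g h. g \<in> carrier H \<Longrightarrow> h \<in> carrier H \<Longrightarrow>
        f (g, h) \<otimes> m (g \<otimes>\<^bsub>H\<^esub> h) = m g \<otimes> \<phi>' g (m h) \<otimes> f' (g, h)"
      using r unfolding crossed_rel_iff[OF fs fs'] by blast
    have mc: "m g \<in> carrier N" if "g \<in> carrier H" for g using m(1) that by auto
    have "\<tau>' (g, h) \<otimes> f (g, h) \<otimes> m (g \<otimes>\<^bsub>H\<^esub> h) = m g \<otimes> \<phi>' g (m h) \<otimes> (\<tau>' (g, h) \<otimes> f' (g, h))"
      if gh: "g \<in> carrier H" "h \<in> carrier H" for g h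
    proof -
      note c = gh mc fsD(1,2) fsD'(1,2) tD(1) N.centre_closed N.auto_closed
      have "\<tau>' (g, h) \<otimes> f (g, h) \<otimes> m (g \<otimes>\<^bsub>H\<^esub> h) = \<tau>' (g, h) \<otimes> (m g \<otimes> \<phi>' g (m h) \<otimes> f' (g, h))"
        using m(3)[OF gh] by (simp add: c N.m_assoc)
      also have "\<dots> = m g \<otimes> \<phi>' g (m h) \<otimes> (\<tau>' (g, h) \<otimes> f' (g, h))"
        using N.centre_left_commutes[OF tD(1)[OF gh], of "m g \<otimes> \<phi>' g (m h)" "f' (g, h)"]
        by (simp add: c)
      finally show ?thesis .
    qed
    then have "(crossed_ext N H \<phi> (\<lambda>x. \<tau>' x \<otimes> f x), crossed_ext N H \<phi>' (\<lambda>x. \<tau>' x \<otimes> f' x)) \<in> ext_rel N H"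
      unfolding crossed_rel_iff[OF twist_factor_set[OF fs \<phi> \<tau>'(1,2)] twist_factor_set[OF fs' \<phi>' \<tau>'(1,2)]]
      using m(1,2) by blast
    then show ?thesis
      using twist_rel_iff[OF fs \<phi> \<tau> \<tau>'(1,2)] \<tau>'(3) ext_class_eqI by metis
  qed
  have "crossed_ext N H \<phi> f \<in> ?X" by (rule ext_class_self[OF factor_set_extension[OF fs]])
  then have "\<exists>\<phi>' f' \<tau>'. ext_class N H (crossed_ext N H \<phi> (\<lambda>x. \<tau> x \<otimes> f x))
      = ext_class N H (crossed_ext N H \<phi>' (\<lambda>x. \<tau>' x \<otimes> f' x)) \<and>
     \<phi>' \<in> carrier H \<rightarrow> auto N \<and> f' \<in> carrier H \<times> carrier H \<rightarrow> carrier N \<and>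
     crossed_ext N H \<phi>' f' \<in> ?X \<and>
     \<tau>' \<in> cohom_class \<tau> \<and> (\<forall>g\<in>carrier H. \<tau>' (\<one>\<^bsub>H\<^esub>, g) = \<one> \<and> \<tau>' (g, \<one>\<^bsub>H\<^esub>) = \<one>)"
    using factor_setD(1,2)[OF fs] coho_self[OF \<tau>(1)] \<tau>(2)[unfolded normalised_def]
    by (intro exI[of _ \<phi>] exI[of _ f] exI[of _ \<tau>]) auto
  with same show ?thesis unfolding shift_def by blast
qed

lemma shift_closed:
  assumes c: "c \<in> carrier (H2 N H \<omega>)" and X: "X \<in> Ex_of N H \<omega>"
  shows "shift N H c X \<in> Ex_of N H \<omega>"
proof -
  obtain \<tau> where \<tau>: "\<tau> \<in> cocycles N H \<omega>" "normalised \<tau>" "c = cohom_class \<tau>"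
    by (rule H2_normalised[OF c])
  obtain \<phi> f where f: "lifts \<phi>" "factor_set N H \<phi> f" "X = ext_class N H (crossed_ext N H \<phi> f)"
    by (rule Ex_of_crossed_exists[OF X])
  show ?thesis
    unfolding \<tau>(3) f(3) shift_crossed[OF f(2,1) \<tau>(1,2)]
    by (rule crossed_mem_Ex_of[OF twist_factor_set[OF f(2,1) \<tau>(1,2)] f(1)])
qed

lemma group_action_shift:
  "group_action (H2 N H \<omega>) (Ex_of N H \<omega>) (\<lambda>c. restrict (shift N H c) (Ex_of N H \<omega>))"
proof (rule group_action_restrictI[OF group_H2 shift_closed])
  interpret C: comm_group "cocycle_group N H \<omega>" by (rule comm_group_cocycles)
  fix X assume "X \<in> Ex_of N H \<omega>"
  then obtain \<phi> f where f: "lifts \<phi>" "factor_set N H \<phi> f" "X = ext_class N H (crossed_ext N H \<phi> f)"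
    by (rule Ex_of_crossed_exists)
  note fsD = factor_setD[OF f(2)]
  {
    have \<tau>: "\<one>\<^bsub>cocycle_group N H \<omega>\<^esub> \<in> cocycles N H \<omega>" "normalised \<one>\<^bsub>cocycle_group N H \<omega>\<^esub>"
      using C.one_closed by (simp_all add: carrier_cocycle_group normalised_def one_cocycle_group)
    have "shift N H \<one>\<^bsub>H2 N H \<omega>\<^esub> X
        = ext_class N H (crossed_ext N H \<phi> (\<lambda>x. \<one>\<^bsub>cocycle_group N H \<omega>\<^esub> x \<otimes> f x))"
      using shift_crossed[OF f(2,1) \<tau>] by (simp add: coho_one f(3))
    also have "\<dots> = X"
      unfolding f(3) by (rule ext_class_eqI[OF crossed_ext_cong[OF twist_factor_set[OF f(2,1) \<tau>] f(2)]])
        (simp add: one_cocycle_group fsD(2))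
    finally show "shift N H \<one>\<^bsub>H2 N H \<omega>\<^esub> X = X" .
  next
    fix c d assume c: "c \<in> carrier (H2 N H \<omega>)" and d: "d \<in> carrier (H2 N H \<omega>)"
    obtain \<sigma> where \<sigma>: "\<sigma> \<in> cocycles N H \<omega>" "normalised \<sigma>" "c = cohom_class \<sigma>" by (rule H2_normalised[OF c])
    obtain \<tau> where \<tau>: "\<tau> \<in> cocycles N H \<omega>" "normalised \<tau>" "d = cohom_class \<tau>" by (rule H2_normalised[OF d])
    let ?\<sigma>\<tau> = "\<sigma> \<otimes>\<^bsub>cocycle_group N H \<omega>\<^esub> \<tau>"
    have \<sigma>\<tau>: "?\<sigma>\<tau> \<in> cocycles N H \<omega>" "normalised ?\<sigma>\<tau>"
      using C.m_closed[of \<sigma> \<tau>] \<sigma>(1,2) \<tau>(1,2)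
      by (simp_all add: carrier_cocycle_group normalised_def mult_cocycle_group)
    note fs\<tau> = twist_factor_set[OF f(2,1) \<tau>(1,2)]
    have "shift N H (c \<otimes>\<^bsub>H2 N H \<omega>\<^esub> d) X = ext_class N H (crossed_ext N H \<phi> (\<lambda>x. ?\<sigma>\<tau> x \<otimes> f x))"
      using shift_crossed[OF f(2,1) \<sigma>\<tau>] by (simp add: \<sigma>(3) \<tau>(3) coho_mult[OF \<sigma>(1) \<tau>(1)] f(3))
    also have "\<dots> = ext_class N H (crossed_ext N H \<phi> (\<lambda>x. \<sigma> x \<otimes> (\<tau> x \<otimes> f x)))"
      by (rule ext_class_eqI[OF crossed_ext_cong[OF twist_factor_set[OF f(2,1) \<sigma>\<tau>]
              twist_factor_set[OF fs\<tau> f(1) \<sigma>(1,2)]]])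
        (simp add: mult_cocycle_group cocyclesD(1)[OF \<sigma>(1)] cocyclesD(1)[OF \<tau>(1)] N.centre_closed fsD(2) N.m_assoc)
    also have "\<dots> = shift N H c (shift N H d X)"
      by (simp add: \<sigma>(3) \<tau>(3) f(3) shift_crossed[OF f(2,1) \<tau>(1,2)] shift_crossed[OF fs\<tau> f(1) \<sigma>(1,2)])
    finally show "shift N H (c \<otimes>\<^bsub>H2 N H \<omega>\<^esub> d) X = shift N H c (shift N H d X)" .
  }
qed

text \<open>
Conjugation by \<open>f (g, h)\<close> and by \<open>f' (g, h)\<close> is the same automorphism of \<open>N\<close>, so the
quotient \<open>\<tau>\<close> is central. The cocycle identity for \<open>\<tau>\<close> is the quotient of the two identities
for \<open>f'\<close> and \<open>f\<close>.
\<close>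

lemma difference_cocycle:
  assumes fs: "factor_set N H \<phi> f" and fs': "factor_set N H \<phi> f'" and \<phi>: "lifts \<phi>"
  obtains \<tau> where "\<tau> \<in> cocycles N H \<omega>" "normalised \<tau>"
    "\<And>g h. g \<in> carrier H \<Longrightarrow> h \<in> carrier H \<Longrightarrow> \<tau> (g, h) \<otimes> f (g, h) = f' (g, h)"
proof -
  note fsD = factor_setD[OF fs] and fsD' = factor_setD[OF fs']
  define \<tau> where "\<tau> = (\<lambda>x\<in>carrier H \<times> carrier H. f' x \<otimes> inv (f x))"
  have \<tau>f: "\<tau> (g, h) \<otimes> f (g, h) = f' (g, h)" if "g \<in> carrier H" "h \<in> carrier H" for g h
    using that by (simp add: \<tau>_def fsD(2) fsD'(2) N.m_assoc)
  have central: "\<tau> (g, h) \<in> centre N" if gh: "g \<in> carrier H" "h \<in> carrier H" for g h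
  proof (rule N.centreI)
    note c = gh fsD(1,2) fsD'(2) N.auto_closed N.auto_inv_closed
    show t: "\<tau> (g, h) \<in> carrier N" using gh by (simp add: \<tau>_def c)
    fix x assume x: "x \<in> carrier N"
    have "\<exists>y\<in>carrier N. \<phi> g (\<phi> h y) = x"
      by (rule bexI[of _ "(inv\<^bsub>AutoGroup N\<^esub> (\<phi> h)) ((inv\<^bsub>AutoGroup N\<^esub> (\<phi> g)) x)"])
        (use x in \<open>simp_all add: c N.auto_inv_apply\<close>)
    then obtain y where y: "y \<in> carrier N" "\<phi> g (\<phi> h y) = x" by blast
    have "x \<otimes> \<tau> (g, h) \<otimes> f (g, h) = x \<otimes> f' (g, h)"
      using \<tau>f[OF gh] t x by (simp add: c N.m_assoc)
    also have "\<dots> = \<tau> (g, h) \<otimes> (f (g, h) \<otimes> \<phi> (g \<otimes>\<^bsub>H\<^esub> h) y)"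
      using fsD'(5)[OF gh y(1)] \<tau>f[OF gh] t y by (simp add: c N.m_assoc[symmetric])
    also have "\<dots> = \<tau> (g, h) \<otimes> x \<otimes> f (g, h)"
      using fsD(5)[OF gh y(1)] t y x by (simp add: c N.m_assoc)
    finally show "\<tau> (g, h) \<otimes> x = x \<otimes> \<tau> (g, h)" using t x by (simp add: c)
  qed
  have "\<tau> \<in> cocycles N H \<omega>"
  proof (rule cocyclesI)
    show "\<tau> (g, h) \<in> centre N" if "g \<in> carrier H" "h \<in> carrier H" for g h
      using that by (rule central)
    fix g h k assume ghk: "g \<in> carrier H" "h \<in> carrier H" "k \<in> carrier H"
    note c = ghk fsD(1,2) central centre_act_closed centre_m_closed N.centre_closed N.auto_closed
    let ?ff = "\<phi> g (f (h, k)) \<otimes> f (g, h \<otimes>\<^bsub>H\<^esub> k)"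
    have "(centre_act \<omega> g (\<tau> (h, k)) \<otimes> \<tau> (g, h \<otimes>\<^bsub>H\<^esub> k)) \<otimes> ?ff
        = (centre_act \<omega> g (\<tau> (h, k)) \<otimes> \<phi> g (f (h, k))) \<otimes> (\<tau> (g, h \<otimes>\<^bsub>H\<^esub> k) \<otimes> f (g, h \<otimes>\<^bsub>H\<^esub> k))"
      by (simp add: c N.m_assoc N.centre_left_commutes[of "\<tau> (g, h \<otimes>\<^bsub>H\<^esub> k)" "\<phi> g (f (h, k))"])
    also have "\<dots> = \<phi> g (f' (h, k)) \<otimes> f' (g, h \<otimes>\<^bsub>H\<^esub> k)"
      by (simp add: c centre_act_lift[OF \<phi>] N.auto_mult[symmetric] \<tau>f)
    also have "\<dots> = f' (g, h) \<otimes> f' (g \<otimes>\<^bsub>H\<^esub> h, k)" by (rule fsD'(6)[OF ghk])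
    also have "\<dots> = (\<tau> (g, h) \<otimes> f (g, h)) \<otimes> (\<tau> (g \<otimes>\<^bsub>H\<^esub> h, k) \<otimes> f (g \<otimes>\<^bsub>H\<^esub> h, k))"
      by (simp add: c \<tau>f)
    also have "\<dots> = (\<tau> (g, h) \<otimes> \<tau> (g \<otimes>\<^bsub>H\<^esub> h, k)) \<otimes> (f (g, h) \<otimes> f (g \<otimes>\<^bsub>H\<^esub> h, k))"
      by (simp add: c N.m_assoc N.centre_left_commutes[of "\<tau> (g \<otimes>\<^bsub>H\<^esub> h, k)" "f (g, h)"])
    also have "f (g, h) \<otimes> f (g \<otimes>\<^bsub>H\<^esub> h, k) = ?ff" by (rule fsD(6)[OF ghk, symmetric])
    finally show "centre_act \<omega> g (\<tau> (h, k)) \<otimes> \<tau> (g, h \<otimes>\<^bsub>H\<^esub> k) = \<tau> (g, h) \<otimes> \<tau> (g \<otimes>\<^bsub>H\<^esub> h, k)"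
      by (simp add: c)
  qed (simp add: \<tau>_def)
  moreover have "normalised \<tau>"
    by (simp add: normalised_def \<tau>_def fsD(3,4) fsD'(3,4))
  ultimately show thesis using \<tau>f by (rule that)
qed

lemma shift_simply_transitive:
  assumes X: "X \<in> Ex_of N H \<omega>" and Y: "Y \<in> Ex_of N H \<omega>"
  shows "\<exists>!c. c \<in> carrier (H2 N H \<omega>) \<and> shift N H c X = Y"
proof -
  obtain \<phi> f where f: "lifts \<phi>" "factor_set N H \<phi> f" "X = ext_class N H (crossed_ext N H \<phi> f)"
    by (rule Ex_of_crossed_exists[OF X])
  obtain f' where f': "factor_set N H \<phi> f'" "Y = ext_class N H (crossed_ext N H \<phi> f')"
    using Ex_of_crossed[OF Y f(1)] factor_setD(7)[OF f(2)] by metis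
  obtain \<tau> where \<tau>: "\<tau> \<in> cocycles N H \<omega>" "normalised \<tau>"
    and \<tau>f: "\<And>g h. g \<in> carrier H \<Longrightarrow> h \<in> carrier H \<Longrightarrow> \<tau> (g, h) \<otimes> f (g, h) = f' (g, h)"
    using difference_cocycle[OF f(2) f'(1) f(1)] by metis
  have Y_eq: "Y = ext_class N H (crossed_ext N H \<phi> (\<lambda>x. \<tau> x \<otimes> f x))"
    unfolding f'(2)
    by (rule ext_class_eqI[OF crossed_ext_cong[OF twist_factor_set[OF f(2,1) \<tau>] f'(1)], symmetric])
      (simp add: \<tau>f)
  show ?thesis
  proof (rule ex1I[of _ "cohom_class \<tau>"])
    show "cohom_class \<tau> \<in> carrier (H2 N H \<omega>) \<and> shift N H (cohom_class \<tau>) X = Y"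
      using \<tau>(1) by (simp add: carrier_H2 f(3) shift_crossed[OF f(2,1) \<tau>] Y_eq)
    fix c assume c: "c \<in> carrier (H2 N H \<omega>) \<and> shift N H c X = Y"
    then obtain \<tau>' where \<tau>': "\<tau>' \<in> cocycles N H \<omega>" "normalised \<tau>'" "c = cohom_class \<tau>'"
      using H2_normalised by blast
    then have "ext_class N H (crossed_ext N H \<phi> (\<lambda>x. \<tau>' x \<otimes> f x))
        = ext_class N H (crossed_ext N H \<phi> (\<lambda>x. \<tau> x \<otimes> f x))"
      using c shift_crossed[OF f(2,1) \<tau>'(1,2)] by (simp add: f(3) Y_eq)
    then have "cohom_class \<tau>' = cohom_class \<tau>"
      unfolding twist_rel_iff[OF f(2,1) \<tau>'(1,2) \<tau>, symmetric]
      by (subst (asm) ext_class_eq_iff) (auto intro: factor_set_extension twist_factor_set f \<tau> \<tau>')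
    then show "c = cohom_class \<tau>" using \<tau>'(3) by simp
  qed
qed

lemma Ex_of_torsor:
  assumes "Ex_of N H \<omega> \<noteq> {}"
  shows "is_torsor (H2 N H \<omega>) (Ex_of N H \<omega>) (shift N H)"
  using assms group_action_shift shift_simply_transitive by (simp add: is_torsor_def)

lemma act_Ex_crossed:
  assumes k: "k \<in> carrier (K N H)" and fs: "factor_set N H \<phi> f"
  shows "act_Ex N H k (ext_class N H (crossed_ext N H \<phi> f))
    = ext_class N H (crossed_ext N H (act_lift N H k \<phi>) (act_cocycle H k f))"
  using ext_class_eqI[OF act_crossed_ext[OF k fs]]
  by (simp add: act_ext_class[OF k factor_set_extension[OF fs]])

lemma act_Ex_of_closed:
  assumes k: "k \<in> carrier (K_of N H \<omega>)" and X: "X \<in> Ex_of N H \<omega>"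
  shows "act_Ex N H k X \<in> Ex_of N H \<omega>"
proof -
  note kD = K_ofD[OF k]
  obtain \<phi> f where f: "lifts \<phi>" "factor_set N H \<phi> f" "X = ext_class N H (crossed_ext N H \<phi> f)"
    by (rule Ex_of_crossed_exists[OF X])
  show ?thesis
    unfolding f(3) act_Ex_crossed[OF kD(1) f(2)]
    by (rule crossed_mem_Ex_of[OF act_factor_set[OF kD(1) f(2)] act_lift_lifts[OF k f(1)]])
qed

text \<open>
Both sides have the presentation with lift \<open>act_lift N H k \<phi>\<close> and factor set
\<open>\<alpha> ((\<tau> f) (\<beta>\<^sup>-\<^sup>1 g, \<beta>\<^sup>-\<^sup>1 h))\<close>, since \<open>\<alpha>\<close> is multiplicative.
\<close>

lemma act_Ex_shift:
  assumes k: "k \<in> carrier (K_of N H \<omega>)" and c: "c \<in> carrier (H2 N H \<omega>)" and X: "X \<in> Ex_of N H \<omega>"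
  shows "act_Ex N H k (shift N H c X) = shift N H (act_H2 H k c) (act_Ex N H k X)"
proof -
  note kD = K_ofD[OF k]
  have \<beta>: "inv\<^bsub>AutoGroup H\<^esub> (snd k) \<in> auto H" using kD(4) by (rule H.auto_inv_closed)
  obtain \<tau> where \<tau>: "\<tau> \<in> cocycles N H \<omega>" "normalised \<tau>" "c = cohom_class \<tau>"
    by (rule H2_normalised[OF c])
  obtain \<phi> f where f: "lifts \<phi>" "factor_set N H \<phi> f" "X = ext_class N H (crossed_ext N H \<phi> f)"
    by (rule Ex_of_crossed_exists[OF X])
  note fs\<tau> = twist_factor_set[OF f(2,1) \<tau>(1,2)]
  note fsk = act_factor_set[OF kD(1) f(2)] and \<phi>k = act_lift_lifts[OF k f(1)]
  note \<tau>k = act_cocycle_closed[OF k \<tau>(1)] act_cocycle_normalised[OF k \<tau>(2)]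
  have "act_Ex N H k (shift N H c X)
      = ext_class N H (crossed_ext N H (act_lift N H k \<phi>) (act_cocycle H k (\<lambda>x. \<tau> x \<otimes> f x)))"
    by (simp add: \<tau>(3) f(3) shift_crossed[OF f(2,1) \<tau>(1,2)] act_Ex_crossed[OF kD(1) fs\<tau>])
  also have "\<dots> = ext_class N H (crossed_ext N H (act_lift N H k \<phi>)
      (\<lambda>x. act_cocycle H k \<tau> x \<otimes> act_cocycle H k f x))"
    by (rule ext_class_eqI[OF crossed_ext_cong[OF act_factor_set[OF kD(1) fs\<tau>]
            twist_factor_set[OF fsk \<phi>k \<tau>k]]])
      (simp add: act_cocycle_apply H.auto_closed[OF \<beta>] cocyclesD(1)[OF \<tau>(1)] N.centre_closed
        factor_setD(2)[OF f(2)] N.auto_mult[OF kD(3)])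
  also have "\<dots> = shift N H (act_H2 H k c) (act_Ex N H k X)"
    by (simp add: \<tau>(3) f(3) act_H2_coho[OF k \<tau>(1)] act_Ex_crossed[OF kD(1) f(2)] shift_crossed[OF fsk \<phi>k \<tau>k])
  finally show ?thesis .
qed

text \<open>
The bijection sends \<open>X\<close> to the unique class that moves the fixed point \<open>X0\<close> to \<open>X\<close>. It is
equivariant because \<open>k (c X0) = (k c) (k X0) = (k c) X0\<close>.
\<close>

lemma stable_equivariant_bij:
  assumes X0: "X0 \<in> Ex_of N H \<omega>" and stable: "is_stable N H \<omega> X0"
  shows "\<exists>f. bij_betw f (Ex_of N H \<omega>) (carrier (H2 N H \<omega>)) \<and>
    (\<forall>k\<in>carrier (K_of N H \<omega>). \<forall>X\<in>Ex_of N H \<omega>. f (act_Ex N H k X) = act_H2 H k (f X))"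
proof -
  define f where "f X = (THE c. c \<in> carrier (H2 N H \<omega>) \<and> shift N H c X0 = X)" for X
  have f: "f X \<in> carrier (H2 N H \<omega>)" "shift N H (f X) X0 = X" if "X \<in> Ex_of N H \<omega>" for X
    using theI'[OF shift_simply_transitive[OF X0 that]] by (simp_all add: f_def)
  have f_eqI: "f X = c" if "c \<in> carrier (H2 N H \<omega>)" "shift N H c X0 = X" "X \<in> Ex_of N H \<omega>" for X c
    unfolding f_def by (rule the1_equality[OF shift_simply_transitive[OF X0 that(3)]]) (use that in simp)
  have "bij_betw f (Ex_of N H \<omega>) (carrier (H2 N H \<omega>))"
    by (rule bij_betw_byWitness[of _ "\<lambda>c. shift N H c X0"])
      (use f f_eqI shift_closed[OF _ X0] in auto)
  moreover have "f (act_Ex N H k X) = act_H2 H k (f X)"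
    if k: "k \<in> carrier (K_of N H \<omega>)" and X: "X \<in> Ex_of N H \<omega>" for k X
  proof (rule f_eqI)
    show "act_H2 H k (f X) \<in> carrier (H2 N H \<omega>)" by (rule act_H2_closed[OF k f(1)[OF X]])
    show "shift N H (act_H2 H k (f X)) X0 = act_Ex N H k X"
      using act_Ex_shift[OF k f(1)[OF X] X0] stable k f(2)[OF X] by (simp add: is_stable_def)
    show "act_Ex N H k X \<in> Ex_of N H \<omega>" by (rule act_Ex_of_closed[OF k X])
  qed
  ultimately show ?thesis by blast
qed

text \<open>
Let \<open>\<phi> = s \<circ> \<omega>\<close>, a genuine action, and let \<open>(\<alpha>, \<beta>)\<close> fix \<open>\<omega>\<close>. Then \<open>\<alpha>\<close> is
\<open>\<alpha>0 = s [\<alpha>]\<close> followed by conjugation with some \<open>n\<close>, and applying \<open>s\<close> to the stabiliser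
condition shows that \<open>(\<alpha>0, \<beta>)\<close> transforms \<open>\<phi>\<close> into itself. Hence \<open>(\<alpha>, \<beta>)\<close> replaces
\<open>\<phi>\<close> by its conjugate under \<open>n\<close>, and conjugation by \<open>(n, \<one>)\<close> in the semidirect product is
the change of section \<open>m h = n \<cdot> \<phi> h (n\<^sup>-\<^sup>1)\<close>.
\<close>

lemma split_stable_class:
  assumes "aut_sequence_splits N"
  shows "\<exists>X\<in>Ex_of N H \<omega>. is_stable N H \<omega> X"
proof -
  interpret A: group "AutoGroup N" by (rule N.AutoGroup)
  obtain s where s: "s \<in> hom (Out N) (AutoGroup N)"
    and s_lift: "\<And>x. x \<in> carrier (Out N) \<Longrightarrow> out_class N (s x) = x"
    using assms by (auto simp: aut_sequence_splits_def)
  interpret O: group "Out N" by (rule N.group_Out)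
  interpret s: group_hom "Out N" "AutoGroup N" s
    using s N.group_Out A.group_axioms by (simp add: group_hom_def group_hom_axioms_def)
  define \<phi> where "\<phi> h = s (\<omega> h)" for h
  have \<omega>c: "\<omega> h \<in> carrier (Out N)" if "h \<in> carrier H" for h
    using \<omega> that by (auto simp: Hom_Out_def hom_def)
  have \<phi>a: "\<phi> h \<in> auto N" if "h \<in> carrier H" for h
    using s.hom_closed[OF \<omega>c[OF that]] by (simp add: \<phi>_def)
  have \<phi>: "lifts \<phi>" using \<phi>a \<omega>c s_lift by (simp add: lifts_def) (simp add: \<phi>_def)
  have \<phi>m: "\<phi> (g \<otimes>\<^bsub>H\<^esub> h) x = \<phi> g (\<phi> h x)"
    if "g \<in> carrier H" "h \<in> carrier H" "x \<in> carrier N" for g h x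
  proof -
    have "\<phi> (g \<otimes>\<^bsub>H\<^esub> h) = \<phi> g \<otimes>\<^bsub>AutoGroup N\<^esub> \<phi> h"
      using that by (simp add: \<phi>_def coupling_mult \<omega>c)
    then show ?thesis using that by (simp add: N.auto_prod_apply \<phi>a)
  qed
  define E where "E = crossed_ext N H \<phi> (\<lambda>x. \<one>)"
  have fs: "factor_set N H \<phi> (\<lambda>x. \<one>)"
    by (auto simp: factor_set_def \<phi>a \<phi>m N.auto_closed N.auto_one)
  have "is_stable N H \<omega> (ext_class N H E)"
    unfolding is_stable_def
  proof
    fix k assume k: "k \<in> carrier (K_of N H \<omega>)"
    note kD = K_ofD[OF k]
    let ?\<alpha> = "fst k" and ?\<phi>' = "act_lift N H k \<phi>"
    define \<alpha>0 where "\<alpha>0 = s (out_class N ?\<alpha>)"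
    have \<alpha>0: "\<alpha>0 \<in> auto N"
      using s.hom_closed[OF N.out_class_closed[OF kD(3)]] by (simp add: \<alpha>0_def)
    have "out_class N ?\<alpha> = out_class N \<alpha>0"
      using s_lift[OF N.out_class_closed[OF kD(3)]] by (simp add: \<alpha>0_def)
    then obtain n where n: "n \<in> carrier N" and \<alpha>n: "\<And>x. x \<in> carrier N \<Longrightarrow> ?\<alpha> x = n \<otimes> \<alpha>0 x \<otimes> inv n"
      using N.out_class_eq_iff[OF kD(3) \<alpha>0] by blast
    have conj: "\<alpha>0 (\<phi> ((inv\<^bsub>AutoGroup H\<^esub> (snd k)) h) x) = \<phi> h (\<alpha>0 x)"
      if h: "h \<in> carrier H" and x: "x \<in> carrier N" for h x
    proof -
      let ?h = "(inv\<^bsub>AutoGroup H\<^esub> (snd k)) h"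
      have h': "?h \<in> carrier H" using kD(4) h by (simp add: H.auto_simps)
      have "\<omega> h = act_Hom N H k \<omega> h" by (simp add: kD(2))
      then have "\<omega> h \<otimes>\<^bsub>Out N\<^esub> out_class N ?\<alpha> = out_class N ?\<alpha> \<otimes>\<^bsub>Out N\<^esub> \<omega> ?h"
        using h h' kD(3) by (simp add: act_Hom_def \<omega>c N.out_class_closed O.m_assoc)
      then have "s (\<omega> h \<otimes>\<^bsub>Out N\<^esub> out_class N ?\<alpha>) = s (out_class N ?\<alpha> \<otimes>\<^bsub>Out N\<^esub> \<omega> ?h)" by simp
      then have "\<phi> h \<otimes>\<^bsub>AutoGroup N\<^esub> \<alpha>0 = \<alpha>0 \<otimes>\<^bsub>AutoGroup N\<^esub> \<phi> ?h"
        using h h' kD(3) by (simp add: \<omega>c N.out_class_closed \<phi>_def \<alpha>0_def)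
      then have "(\<phi> h \<otimes>\<^bsub>AutoGroup N\<^esub> \<alpha>0) x = (\<alpha>0 \<otimes>\<^bsub>AutoGroup N\<^esub> \<phi> ?h) x" by simp
      then show ?thesis using x h h' \<alpha>0 by (simp add: N.auto_prod_apply \<phi>a)
    qed
    have inv_\<alpha>: "\<exists>y\<in>carrier N. x = ?\<alpha> y \<and> (inv\<^bsub>AutoGroup N\<^esub> ?\<alpha>) x = y" if "x \<in> carrier N" for x
      using that kD(3) by (intro bexI[of _ "(inv\<^bsub>AutoGroup N\<^esub> ?\<alpha>) x"]) (simp_all add: N.auto_simps)
    define m where "m h = n \<otimes> \<phi> h (inv n)" for h
    note c = n \<phi>a \<alpha>0 N.auto_closed
    have m: "m h \<in> carrier N" if "h \<in> carrier H" for h using that by (simp add: m_def c)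
    have "?\<phi>' h x \<otimes> m h = m h \<otimes> \<phi> h x" if h: "h \<in> carrier H" and x: "x \<in> carrier N" for h x
    proof -
      obtain y where y: "y \<in> carrier N" "x = ?\<alpha> y" "(inv\<^bsub>AutoGroup N\<^esub> ?\<alpha>) x = y"
        using inv_\<alpha>[OF x] by blast
      have h': "(inv\<^bsub>AutoGroup H\<^esub> (snd k)) h \<in> carrier H" using kD(4) h by (simp add: H.auto_simps)
      have "?\<phi>' h x = n \<otimes> \<phi> h (\<alpha>0 y) \<otimes> inv n"
        using act_lift_apply[OF kD(1) \<phi>a h x] \<alpha>n[of "\<phi> ((inv\<^bsub>AutoGroup H\<^esub> (snd k)) h) y"] y h'
        by (simp add: conj[OF h] c)
      moreover have "\<phi> h x = \<phi> h n \<otimes> \<phi> h (\<alpha>0 y) \<otimes> inv (\<phi> h n)"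
        using y h by (simp add: \<alpha>n c N.auto_mult N.auto_m_inv)
      ultimately show ?thesis
        using y(1) h by (simp add: m_def c N.auto_m_inv N.m_assoc N.inv_cancel_left)
    qed
    moreover have "m (g \<otimes>\<^bsub>H\<^esub> h) = m g \<otimes> \<phi> g (m h)" if "g \<in> carrier H" "h \<in> carrier H" for g h
      using that by (simp add: m_def c \<phi>m N.auto_mult N.auto_m_inv N.m_assoc N.inv_cancel_left)
    ultimately have "(crossed_ext N H ?\<phi>' (act_cocycle H k (\<lambda>x. \<one>)), E) \<in> ext_rel N H"
      unfolding E_def crossed_rel_iff[OF act_factor_set[OF kD(1) fs] fs]
      using m by (intro bexI[of _ m]) (simp_all add: act_cocycle_apply N.auto_one[OF kD(3)] c)
    then show "act_Ex N H k (ext_class N H E) = ext_class N H E"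
      unfolding E_def act_Ex_crossed[OF kD(1) fs] by (rule ext_class_eqI)
  qed
  moreover have "ext_class N H E \<in> Ex_of N H \<omega>"
    unfolding E_def by (rule crossed_mem_Ex_of[OF fs \<phi>])
  ultimately show ?thesis by blast
qed

end

section \<open>The classification\<close>

theorem theorem2:
  fixes N :: "('n, 'a) monoid_scheme" and H :: "('h, 'b) monoid_scheme"
    and R :: "('h \<Rightarrow> ('n \<Rightarrow> 'n) set) set"
  assumes "group N" and "group H"
    and "orbit_representatives N H R"
  shows "(\<exists>\<Phi>. bij_betw \<Phi> (Gr N H) (orbits (K N H) (Ex_all N H) (act_Ex N H)) \<and>
             (\<forall>C\<in>Gr N H. \<forall>E\<in>C. \<Phi> C = orbit (K N H) (act_Ex N H) (ext_class N H E))) \<and>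
         (\<exists>\<Psi>. bij_betw \<Psi> (orbits (K N H) (Ex_all N H) (act_Ex N H))
                 (SIGMA \<omega>:R. orbits (K_of N H \<omega>) (Ex_of N H \<omega>) (act_Ex N H)) \<and>
             (\<forall>\<omega>\<in>R. \<forall>X\<in>Ex_of N H \<omega>.
                \<Psi> (orbit (K N H) (act_Ex N H) X) = (\<omega>, orbit (K_of N H \<omega>) (act_Ex N H) X))) \<and>
         (\<forall>\<omega>\<in>Hom_Out N H.
             (Ex_of N H \<omega> \<noteq> {} \<longrightarrow> is_torsor (H2 N H \<omega>) (Ex_of N H \<omega>) (shift N H)) \<and>
             ((\<exists>X\<in>Ex_of N H \<omega>. is_stable N H \<omega> X) \<longrightarrow>
                (\<exists>f. bij_betw f (Ex_of N H \<omega>) (carrier (H2 N H \<omega>)) \<and>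
                   (\<forall>k\<in>carrier (K_of N H \<omega>). \<forall>X\<in>Ex_of N H \<omega>.
                      f (act_Ex N H k X) = act_H2 H k (f X))))) \<and>
         (aut_sequence_splits N \<longrightarrow>
             (\<forall>\<omega>\<in>Hom_Out N H. \<exists>X\<in>Ex_of N H \<omega>. is_stable N H \<omega> X) \<and>
             (\<exists>\<Theta>. bij_betw \<Theta> (Gr N H)
                     (SIGMA \<omega>:R. orbits (K_of N H \<omega>) (carrier (H2 N H \<omega>)) (act_H2 H)) \<and>
                 (\<forall>C\<in>Gr N H. \<forall>E\<in>C. coupling N H E \<in> R \<longrightarrow> fst (\<Theta> C) = coupling N H E)))"
proof (intro conjI ballI impI)
  interpret group_pair N H using assms(1,2) by (rule group_pair.intro)
  have coupled: "group_pair_coupling N H \<omega>" if "\<omega> \<in> Hom_Out N H" for \<omega>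
    using that by unfold_locales
  show Phi: "\<exists>\<Phi>. bij_betw \<Phi> (Gr N H) (orbits (K N H) (Ex_all N H) (act_Ex N H)) \<and>
      (\<forall>C\<in>Gr N H. \<forall>E\<in>C. \<Phi> C = orbit (K N H) (act_Ex N H) (ext_class N H E))"
    by (rule Gr_bij_orbits)
  show Psi: "\<exists>\<Psi>. bij_betw \<Psi> (orbits (K N H) (Ex_all N H) (act_Ex N H))
        (SIGMA \<omega>:R. orbits (K_of N H \<omega>) (Ex_of N H \<omega>) (act_Ex N H)) \<and>
      (\<forall>\<omega>\<in>R. \<forall>X\<in>Ex_of N H \<omega>.
        \<Psi> (orbit (K N H) (act_Ex N H) X) = (\<omega>, orbit (K_of N H \<omega>) (act_Ex N H) X))"
    by (rule Ex_all_bij_coproduct[OF assms(3)])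
  show "is_torsor (H2 N H \<omega>) (Ex_of N H \<omega>) (shift N H)"
    if "\<omega> \<in> Hom_Out N H" "Ex_of N H \<omega> \<noteq> {}" for \<omega>
    by (rule group_pair_coupling.Ex_of_torsor[OF coupled[OF that(1)] that(2)])
  show equivariant: "\<exists>f. bij_betw f (Ex_of N H \<omega>) (carrier (H2 N H \<omega>)) \<and>
      (\<forall>k\<in>carrier (K_of N H \<omega>). \<forall>X\<in>Ex_of N H \<omega>. f (act_Ex N H k X) = act_H2 H k (f X))"
    if \<omega>: "\<omega> \<in> Hom_Out N H" and stable: "\<exists>X\<in>Ex_of N H \<omega>. is_stable N H \<omega> X" for \<omega>
  proof -
    obtain X where "X \<in> Ex_of N H \<omega>" "is_stable N H \<omega> X" using stable by blast
    then show ?thesis by (rule group_pair_coupling.stable_equivariant_bij[OF coupled[OF \<omega>]])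
  qed
  assume split: "aut_sequence_splits N"
  show stable: "\<exists>X\<in>Ex_of N H \<omega>. is_stable N H \<omega> X" if "\<omega> \<in> Hom_Out N H" for \<omega>
    by (rule group_pair_coupling.split_stable_class[OF coupled[OF that] split])
  have R: "R \<subseteq> Hom_Out N H" using assms(3) by (simp add: orbit_representatives_def)
  obtain \<Phi> where \<Phi>: "bij_betw \<Phi> (Gr N H) (orbits (K N H) (Ex_all N H) (act_Ex N H))"
    and \<Phi>_val: "\<And>C E. C \<in> Gr N H \<Longrightarrow> E \<in> C \<Longrightarrow> \<Phi> C = orbit (K N H) (act_Ex N H) (ext_class N H E)"
    using Phi by blast
  obtain \<Psi> where \<Psi>: "bij_betw \<Psi> (orbits (K N H) (Ex_all N H) (act_Ex N H))
      (SIGMA \<omega>:R. orbits (K_of N H \<omega>) (Ex_of N H \<omega>) (act_Ex N H))"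
    and \<Psi>_val: "\<And>\<omega> X. \<omega> \<in> R \<Longrightarrow> X \<in> Ex_of N H \<omega> \<Longrightarrow>
      \<Psi> (orbit (K N H) (act_Ex N H) X) = (\<omega>, orbit (K_of N H \<omega>) (act_Ex N H) X)"
    using Psi by blast
  have "\<forall>\<omega>\<in>R. \<exists>f. bij_betw f (Ex_of N H \<omega>) (carrier (H2 N H \<omega>)) \<and>
      (\<forall>k\<in>carrier (K_of N H \<omega>). \<forall>X\<in>Ex_of N H \<omega>. f (act_Ex N H k X) = act_H2 H k (f X))"
  proof
    fix \<omega> assume "\<omega> \<in> R"
    then have "\<omega> \<in> Hom_Out N H" using R by blast
    then show "\<exists>f. bij_betw f (Ex_of N H \<omega>) (carrier (H2 N H \<omega>)) \<and>
        (\<forall>k\<in>carrier (K_of N H \<omega>). \<forall>X\<in>Ex_of N H \<omega>. f (act_Ex N H k X) = act_H2 H k (f X))"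
      by (intro equivariant stable)
  qed
  from bchoice[OF this] obtain F where F_all:
    "\<forall>\<omega>\<in>R. bij_betw (F \<omega>) (Ex_of N H \<omega>) (carrier (H2 N H \<omega>)) \<and>
      (\<forall>k\<in>carrier (K_of N H \<omega>). \<forall>X\<in>Ex_of N H \<omega>. F \<omega> (act_Ex N H k X) = act_H2 H k (F \<omega> X))" ..
  have F: "bij_betw (F \<omega>) (Ex_of N H \<omega>) (carrier (H2 N H \<omega>))"
    and F_act: "\<And>k X. k \<in> carrier (K_of N H \<omega>) \<Longrightarrow> X \<in> Ex_of N H \<omega> \<Longrightarrow>
      F \<omega> (act_Ex N H k X) = act_H2 H k (F \<omega> X)" if "\<omega> \<in> R" for \<omega>
    using bspec[OF F_all that] by auto
  have F_orbits: "bij_betw ((`) (F \<omega>)) (orbits (K_of N H \<omega>) (Ex_of N H \<omega>) (act_Ex N H))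
      (orbits (K_of N H \<omega>) (carrier (H2 N H \<omega>)) (act_H2 H))" if \<omega>: "\<omega> \<in> R" for \<omega>
  proof (rule orbits_equivariant_bij)
    show "bij_betw (F \<omega>) (Ex_of N H \<omega>) (carrier (H2 N H \<omega>))" by (rule F[OF \<omega>])
    fix k X assume k: "k \<in> carrier (K_of N H \<omega>)" and X: "X \<in> Ex_of N H \<omega>"
    have "\<omega> \<in> Hom_Out N H" using \<omega> R by blast
    then show "act_Ex N H k X \<in> Ex_of N H \<omega>"
      by (rule group_pair_coupling.act_Ex_of_closed[OF coupled k X])
    show "F \<omega> (act_Ex N H k X) = act_H2 H k (F \<omega> X)" by (rule F_act[OF \<omega> k X])
  qed
  let ?\<Theta> = "(\<lambda>(\<omega>, Q). (\<omega>, F \<omega> ` Q)) \<circ> (\<Psi> \<circ> \<Phi>)"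
  have "bij_betw ?\<Theta> (Gr N H) (SIGMA \<omega>:R. orbits (K_of N H \<omega>) (carrier (H2 N H \<omega>)) (act_H2 H))"
    by (rule bij_betw_trans[OF bij_betw_trans[OF \<Phi> \<Psi>] bij_betw_Sigma_fibrewise[OF F_orbits]])
  moreover have "fst (?\<Theta> C) = coupling N H E"
    if C: "C \<in> Gr N H" and E: "E \<in> C" and coupling: "coupling N H E \<in> R" for C E
  proof -
    have "is_extension N H E"
      using C E by (auto simp: Gr_def quotient_def virt_rel_def)
    then have "ext_class N H E \<in> Ex_of N H (coupling N H E)" by (auto simp: Ex_of_def)
    from \<Psi>_val[OF coupling this] show ?thesis by (simp add: \<Phi>_val[OF C E])
  qed
  ultimately show "\<exists>\<Theta>. bij_betw \<Theta> (Gr N H)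
        (SIGMA \<omega>:R. orbits (K_of N H \<omega>) (carrier (H2 N H \<omega>)) (act_H2 H)) \<and>
      (\<forall>C\<in>Gr N H. \<forall>E\<in>C. coupling N H E \<in> R \<longrightarrow> fst (\<Theta> C) = coupling N H E)"
    by blast
qed

end
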